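(* Let $N\ge 1$, $0<\theta\le 2$, let $\mu$ be a nonnegative locally integrable function on $\mathbb{R}^N$, and let $f\colon[0,\infty)\to[0,\infty)$ satisfy (M), (S) and (L). (a) If $f$ also satisfies (C), then there exists $\gamma=\gamma(N,\theta,f)>0$ such that if $G(\mu(x))\ge \gamma|x|^{-\theta}$ for almost all $x$ in a neighborhood of the origin, then problem (SHE) is not locally solvable. (b) Let $\mu\in\mathcal{B}$. If $f$ is supercritical, then there exists $\varepsilon=\varepsilon(N,\theta,f)>0$ such that if $G(\mu(x))\le \varepsilon|x|^{-\theta}$ for almost all $x$ in a neighborhood of the origin, then problem (SHE) is locally solvable; in particular there exists a solution $u\in L^\infty_{\rm loc}((0,T),L^\infty(\mathbb{R}^N))$ for some $T>0$.
   Context: Problem (SHE) is $\partial_t u+(-\Delta)^{\theta/2}u=f(u)$ in $\mathbb{R}^N\times(0,\infty)$, $u(\cdot,0)=\mu$. Let $\Gamma_\theta$ be the fundamental solution of $\partial_t u+(-\Delta)^{\theta/2}u=0$ on $\mathbb{R}^N\times(0,\infty)$ (the Gaussian heat kernel if $\theta=2$). For $T>0$ let $Q_T=\mathbb{R}^N\times(0,T)$. A solution of (SHE) in $Q_T$ is a nonnegative measurable function $u$ on $Q_T$, finite a.e., with $u(x,t)=\int_{\mathbb{R}^N}\Gamma_\theta(x-y,t)\mu(y)\,dy+\int_0^t\int_{\mathbb{R}^N}\Gamma_\theta(x-y,t-s)f(u(y,s))\,dy\,ds$ for a.a. $(x,t)\in Q_T$; (SHE) is locally solvable if such a solution exists for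 some $T>0$. Hypotheses: (M) $f$ is continuous, nondecreasing, and $f(u)>0$ for all $u>0$. (S) there is $\tau_0>0$ with $f\in C^1([\tau_0,\infty))$ and $\int_{\tau_0}^\infty ds/f(s)<\infty$. (C) there is $\tau_1\ge0$ such that $f$ is convex on $[\tau_1,\infty)$. For $f$ with (M),(S) define $F(u)=\int_u^\infty ds/f(s)$ for $u>0$, $F_0=\lim_{u\to0}F(u)\in(0,\infty]$, $G(u)=1/F(u)$ for $u>0$ and $G(0)=G_0:=1/F_0$ (with $G_0=0$ if $F_0=\infty$). (L) $q_f:=\lim_{u\to\infty}f'(u)F(u)$ exists and is finite. The growth exponent $p_f\in(1,\infty]$ is defined by $1/p_f+1/q_f=1$, and $f$ is called supercritical if $p_f>1+\theta/N$. $\mathcal{B}=\bigcap_{r>0}L^\infty(\mathbb{R}^N\setminus B_r)$, where $B_r$ is the open ball of radius $r$ centered at $0$. *)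

theory Defs
  imports "HOL-Analysis.Analysis"
begin

text \<open>Fundamental solution of the fractional heat equation
  \<open>\<partial>_t u + (-\<Delta>)^{\<theta>/2} u = 0\<close> on \<open>\<real>^N\<close>, \<open>N = CARD('n)\<close>, given by its
  Fourier representation \<open>(2\<pi>)^{-N} \<integral> e^{i x\<cdot>\<xi>} e^{-t|\<xi>|^\<theta>} d\<xi>\<close>
  (the imaginary part vanishes by symmetry, so we write the real part).\<close>
definition Gamma_frac :: "real \<Rightarrow> real^'n \<Rightarrow> real \<Rightarrow> real" where
  "Gamma_frac \<theta> x t =
     (1 / (2 * pi) ^ CARD('n)) *
     (LINT \<xi>|lborel. cos (x \<bullet> \<xi>) * exp (- t * norm \<xi> powr \<theta>))"

definition Ffun :: "(real \<Rightarrow> real) \<Rightarrow> real \<Rightarrow> real" where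
  "Ffun f u = integral {u..} (\<lambda>s. 1 / f s)"

definition F0 :: "(real \<Rightarrow> real) \<Rightarrow> ereal" where
  "F0 f = Lim (at_right 0) (\<lambda>u. ereal (Ffun f u))"

definition Gfun :: "(real \<Rightarrow> real) \<Rightarrow> real \<Rightarrow> real" where
  "Gfun f u = (if u > 0 then 1 / Ffun f u
               else if F0 f = \<infinity> then 0 else 1 / real_of_ereal (F0 f))"

definition hyp_M :: "(real \<Rightarrow> real) \<Rightarrow> bool" where
  "hyp_M f \<longleftrightarrow> continuous_on {0..} f \<and> mono_on {0..} f \<and> (\<forall>u>0. f u > 0)"

definition hyp_S :: "(real \<Rightarrow> real) \<Rightarrow> bool" where
  "hyp_S f \<longleftrightarrow> (\<exists>\<tau>0>0.
      (\<exists>f'. continuous_on {\<tau>0..} f' \<and>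
            (\<forall>u\<ge>\<tau>0. (f has_real_derivative f' u) (at u within {\<tau>0..}))) \<and>
      (\<lambda>s. 1 / f s) integrable_on {\<tau>0..})"

definition hyp_C :: "(real \<Rightarrow> real) \<Rightarrow> bool" where
  "hyp_C f \<longleftrightarrow> (\<exists>\<tau>1\<ge>0. convex_on {\<tau>1..} f)"

definition hyp_L :: "(real \<Rightarrow> real) \<Rightarrow> bool" where
  "hyp_L f \<longleftrightarrow> (\<exists>q. ((\<lambda>u. deriv f u * Ffun f u) \<longlongrightarrow> q) at_top)"

definition q_f :: "(real \<Rightarrow> real) \<Rightarrow> real" where
  "q_f f = Lim at_top (\<lambda>u. deriv f u * Ffun f u)"

text \<open>Growth exponent \<open>p_f \<in> (1,\<infinity>]\<close>, \<open>1/p_f + 1/q_f = 1\<close>.\<close>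
definition p_f :: "(real \<Rightarrow> real) \<Rightarrow> ereal" where
  "p_f f = (if q_f f = 1 then \<infinity> else ereal (q_f f / (q_f f - 1)))"

definition supercritical :: "real \<Rightarrow> (real \<Rightarrow> real) \<Rightarrow> nat \<Rightarrow> bool" where
  "supercritical \<theta> f N \<longleftrightarrow> p_f f > ereal (1 + \<theta> / real N)"

definition QT :: "real \<Rightarrow> ((real^'n) \<times> real) set" where
  "QT T = UNIV \<times> {0<..<T}"

definition is_solution ::
  "real \<Rightarrow> (real \<Rightarrow> real) \<Rightarrow> (real^'n \<Rightarrow> real) \<Rightarrow> real \<Rightarrow> ((real^'n) \<times> real \<Rightarrow> real) \<Rightarrow> bool" where
  "is_solution \<theta> f \<mu> T u \<longleftrightarrow>
     (\<forall>z\<in>QT T. u z \<ge> 0) \<and>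
     u \<in> borel_measurable (lebesgue_on (QT T)) \<and>
     (AE z in lebesgue. z \<in> QT T \<longrightarrow>
        ennreal (u z) =
          (\<integral>\<^sup>+ y. ennreal (Gamma_frac \<theta> (fst z - y) (snd z) * \<mu> y) \<partial>lebesgue)
          + (\<integral>\<^sup>+ s. indicator {0<..<snd z} s *
                (\<integral>\<^sup>+ y. ennreal (Gamma_frac \<theta> (fst z - y) (snd z - s) * f (u (y, s))) \<partial>lebesgue)
              \<partial>lebesgue))"

definition locally_solvable ::
  "real \<Rightarrow> (real \<Rightarrow> real) \<Rightarrow> (real^'n \<Rightarrow> real) \<Rightarrow> bool" where
  "locally_solvable \<theta> f \<mu> \<longleftrightarrow> (\<exists>T>0. \<exists>u. is_solution \<theta> f \<mu> T u)"

definition nonneg_loc_integrable :: "(real^'n \<Rightarrow> real) \<Rightarrow> bool" where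
  "nonneg_loc_integrable \<mu> \<longleftrightarrow>
     (\<forall>x. \<mu> x \<ge> 0) \<and> (\<forall>K. compact K \<longrightarrow> set_integrable lebesgue K \<mu>)"

definition in_B :: "(real^'n \<Rightarrow> real) \<Rightarrow> bool" where
  "in_B \<mu> \<longleftrightarrow> (\<forall>r>0. \<exists>C. AE x in lebesgue. x \<notin> ball 0 r \<longrightarrow> \<bar>\<mu> x\<bar> \<le> C)"

definition Linf_loc_time :: "real \<Rightarrow> ((real^'n) \<times> real \<Rightarrow> real) \<Rightarrow> bool" where
  "Linf_loc_time T u \<longleftrightarrow>
     (\<forall>a b. 0 < a \<and> a \<le> b \<and> b < T \<longrightarrow>
        (\<exists>C. AE z in lebesgue. snd z \<in> {a..b} \<longrightarrow> \<bar>u z\<bar> \<le> C))"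

end

theory Submission
  imports Defs "HOL-Probability.Characteristic_Functions" "HOL-Real_Asymp.Real_Asymp"
begin

text \<open>The kernel is positive because \<open>|\<xi>|^\<theta>\<close> is a mixture of the functions \<open>1 - exp (- s |\<xi>|^2)\<close>: truncating
  the mixture turns \<open>exp (- t |\<xi>|^\<theta>)\<close> into a power series in mixtures of Gaussians. Mass one and the semigroup law
  then follow by Fourier inversion. Write \<open>S t\<close> for the semigroup.

  Both halves rest on \<open>(f F^\<kappa>)' = F^(\<kappa>-1) (f' F - \<kappa>)\<close>, so that \<open>f F^\<kappa>\<close> is eventually increasing for \<open>\<kappa> < q\<close>
  and eventually decreasing for \<open>\<kappa> > q\<close>.

  (a) \<open>F^(1/2)\<close> is convex near infinity, so Jensen's inequality bounds \<open>F (S t \<mu> x)^(1/2)\<close> by the mean of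
  \<open>F (\<mu>)^(1/2)\<close>, which is at most a small multiple of \<open>t^(1/2)\<close> for \<open>|x| \<le> t^(1/\<theta>)\<close> when \<open>\<gamma>\<close> is large. On the other
  hand, for a solution \<open>u\<close>, convexity of \<open>f\<close> makes \<open>s \<mapsto> S (t - s) (u s) x\<close> grow at least like a solution of
  \<open>w' = f w / 2\<close> up to time \<open>t\<close>, whence \<open>t \<le> 4 F (S t \<mu> x)\<close>.

  (b) Choose \<open>k\<close> with \<open>q - 1 < k < min q (N/\<theta>)\<close>, let \<open>\<Phi>\<close> be the (concave) inverse of \<open>G^k\<close> near infinity and \<open>h\<close> the
  solution of the linear equation with initial value \<open>G (max \<tau> \<mu>)^k\<close>. Then \<open>\<Phi> (2 h)\<close> is a supersolution:
  Jensen gives \<open>S t \<mu> \<le> \<Phi> (h t)\<close>, and as \<open>f (\<Phi> z) / z\<close> is increasing and \<open>h s \<le> const * \<epsilon>^k s^(-k)\<close>, the nonlinear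
  term is at most \<open>h t\<close> times an explicit integral in \<open>s\<close>, which the increment \<open>\<Phi> (2 h) - \<Phi> h\<close> absorbs for small
  \<open>\<epsilon>\<close>. Monotone iteration below the supersolution yields a solution.\<close>

section \<open>Integrals over Euclidean space\<close>

text \<open>For \<theta> < 2 the kernel decays only polynomially and its moment of order \<theta> is
  infinite, so averaging a bound F(\<mu>) \<le> |x|^\<theta> / \<gamma> directly says nothing. The
  square root lowers the order to \<theta>/2, which has a finite mean, and 1/2 is always below q
  because q \<ge> 1 follows from the hypotheses. Tail bounds of the kernel are avoided: its moments
  are read off from its Fourier transform.

  In the existence half, k > q - 1 makes \<Phi> concave, k < q makes f(\<Phi> z)/z nondecreasing,
  and k\<theta> < N makes |x|^(-k\<theta>) locally integrable. Supercriticality is the inequality q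
  - 1 < N/\<theta>, which is what leaves room for such a k. A second exponent k' with q - 1 < k' < k
  turns the bound on f(U) at time s into a multiple of s^(k-k'-1), integrable at 0.

  The integral equation holds only almost everywhere. Nonexistence is therefore derived at a single
  point where the equation holds, and this rules out every point of an open piece of
  space-time.\<close>

lemma nn_integral_lborel_affine:
  fixes f :: "'a::euclidean_space \<Rightarrow> ennreal"
  assumes [measurable]: "f \<in> borel_measurable borel" and c: "c \<noteq> 0"
  shows "(\<integral>\<^sup>+x. f x \<partial>lborel) = ennreal (\<bar>c\<bar> ^ DIM('a)) * (\<integral>\<^sup>+x. f (a + c *\<^sub>R x) \<partial>lborel)"
  by (subst lborel_affine[OF c, of a])
     (simp add: nn_integral_density nn_integral_distr nn_integral_cmult ennreal_power)

lemma lborel_integral_affine: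
  fixes f :: "'a::euclidean_space \<Rightarrow> real"
  assumes [measurable]: "f \<in> borel_measurable borel" and c: "c \<noteq> 0"
  shows "(\<integral>x. f x \<partial>lborel) = \<bar>c\<bar> ^ DIM('a) * (\<integral>x. f (a + c *\<^sub>R x) \<partial>lborel)"
  by (subst lborel_affine[OF c, of a])
     (simp add: integral_density integral_distr ennreal_power)

lemma nn_integral_lborel_reflect:
  fixes f :: "'a::euclidean_space \<Rightarrow> ennreal"
  assumes "f \<in> borel_measurable borel"
  shows "(\<integral>\<^sup>+y. f (x - y) \<partial>lborel) = (\<integral>\<^sup>+y. f y \<partial>lborel)"
  using nn_integral_lborel_affine[OF assms, of "-1" x] by simp

lemma summable_exp_powr_times_power:
  fixes t \<theta> :: real assumes "t > 0" "\<theta> > 0"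
  shows "summable (\<lambda>n. exp (- t * real n powr \<theta>) * (real n + 1) ^ N)"
proof (rule summable_comparison_test_bigo)
  show "summable (\<lambda>n. norm (1 / (real n) ^ 2))"
    using inverse_power_summable[of 2, where 'a=real] by (simp add: field_simps)
  have "(\<lambda>n. exp (- t * real n powr \<theta>) * (real n + 1) powr (real N)) \<in> O(\<lambda>n. 1 / (real n) ^ 2)"
    using assms by real_asymp
  then show "(\<lambda>n. exp (- t * real n powr \<theta>) * (real n + 1) ^ N) \<in> O(\<lambda>n. 1 / (real n) ^ 2)"
    by (simp add: powr_realpow add_nonneg_pos)
qed

lemma ennreal_le_suminf: "f m \<le> (\<Sum>n. f n)" for f :: "nat \<Rightarrow> ennreal"
  using sum_le_suminf[of f "{m}"] by simp

lemma nn_integral_const_ball: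
  assumes "a \<ge> 0" "r \<ge> 0"
  shows "(\<integral>\<^sup>+x. ennreal a * indicator (ball (0::'a::euclidean_space) r) x \<partial>lborel)
    = ennreal (a * (unit_ball_vol (real DIM('a)) * r ^ DIM('a)))"
proof -
  have "(\<integral>\<^sup>+x. ennreal a * indicator (ball (0::'a::euclidean_space) r) x \<partial>lborel)
     = ennreal a * emeasure lborel (ball (0::'a) r)"
    by (rule nn_integral_cmult_indicator) simp
  then show ?thesis using assms by (subst (asm) emeasure_ball) (auto simp: ennreal_mult)
qed

lemma nn_integral_suminf_ball:
  assumes "\<And>n. a n \<ge> 0" "\<And>n. r n \<ge> 0"
  shows "(\<integral>\<^sup>+x. (\<Sum>n. ennreal (a n) * indicator (ball (0::'a::euclidean_space) (r n)) x) \<partial>lborel)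
    = (\<Sum>n. ennreal (a n * (unit_ball_vol (real DIM('a)) * r n ^ DIM('a))))"
proof -
  have "(\<integral>\<^sup>+x. (\<Sum>n. ennreal (a n) * indicator (ball (0::'a) (r n)) x) \<partial>lborel)
    = (\<Sum>n. (\<integral>\<^sup>+x. ennreal (a n) * indicator (ball (0::'a) (r n)) x \<partial>lborel))"
    by (intro nn_integral_suminf borel_measurable_times_ennreal borel_measurable_const borel_measurable_indicator) simp
  also have "\<dots> = (\<Sum>n. ennreal (a n * (unit_ball_vol (real DIM('a)) * r n ^ DIM('a))))"
    by (simp only: nn_integral_const_ball[OF assms])
  finally show ?thesis .
qed

text \<open>The integrand is spread over balls of integer radius: at \<open>x\<close> the single
  summand whose index is the floor of \<open>norm x\<close> already dominates it, and the volumes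
  grow polynomially against \<open>exp (- t * real n powr \<theta>)\<close>.\<close>

lemma integrable_exp_norm_powr:
  fixes t \<theta> :: real assumes t: "t > 0" and th: "\<theta> > 0"
  shows "integrable lborel (\<lambda>x::'a::euclidean_space. exp (- t * norm x powr \<theta>))"
proof (rule integrableI_nonneg)
  let ?a = "\<lambda>n. exp (- t * real n powr \<theta>)"
  let ?V = "unit_ball_vol (real DIM('a))"
  have "(\<integral>\<^sup>+x. ennreal (exp (- t * norm (x::'a) powr \<theta>)) \<partial>lborel)
      \<le> (\<integral>\<^sup>+x. (\<Sum>n. ennreal (?a n) * indicator (ball (0::'a) (real n + 1)) x) \<partial>lborel)"
  proof (rule nn_integral_mono)
    fix x :: 'a
    define m where "m = nat \<lfloor>norm x\<rfloor>"
    have m: "real m \<le> norm x" "norm x < real m + 1" by (auto simp: m_def)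
    have "ennreal (exp (- t * norm x powr \<theta>)) \<le> ennreal (?a m) * indicator (ball 0 (real m + 1)) x"
      using m t th by (auto intro!: ennreal_leI powr_mono2)
    also have "\<dots> \<le> (\<Sum>n. ennreal (?a n) * indicator (ball 0 (real n + 1)) x)"
      by (rule ennreal_le_suminf)
    finally show "ennreal (exp (- t * norm x powr \<theta>)) \<le> (\<Sum>n. ennreal (?a n) * indicator (ball 0 (real n + 1)) x)" .
  qed
  also have "\<dots> = (\<Sum>n. ennreal (?a n * (?V * (real n + 1) ^ DIM('a))))"
    using t by (intro nn_integral_suminf_ball) auto
  also have "\<dots> < \<infinity>"
  proof -
    have "summable (\<lambda>n. ?V * (?a n * (real n + 1) ^ DIM('a)))"
      by (intro summable_mult summable_exp_powr_times_power t th)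
    then have "summable (\<lambda>n. ?a n * (?V * (real n + 1) ^ DIM('a)))"
      by (simp add: mult_ac)
    then show ?thesis
      by (subst suminf_ennreal2) auto
  qed
  finally show "(\<integral>\<^sup>+x. ennreal (exp (- t * norm (x::'a) powr \<theta>)) \<partial>lborel) < \<infinity>" .
qed auto

abbreviation gauss :: "real \<Rightarrow> 'a::euclidean_space \<Rightarrow> real" where
  "gauss d x \<equiv> exp (- d * (norm x)\<^sup>2)"

abbreviation stable :: "real \<Rightarrow> real \<Rightarrow> 'a::euclidean_space \<Rightarrow> real" where
  "stable \<theta> t x \<equiv> exp (- t * norm x powr \<theta>)"

lemma integrable_exp_norm_sq:
  assumes "d > 0"
  shows "integrable lborel (\<lambda>x::'a::euclidean_space. gauss d x)"
  using integrable_exp_norm_powr[OF assms, of 2, where 'a='a] by (simp add: powr_numeral)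

text \<open>Dyadic shells: between the radii r/2^(n+1) and r/2^n the integrand is at most its value
  at the inner radius, so the shells contribute a geometric series of ratio 2^(b-N), which is below
  1 because b < N. The power of \<open>r\<close> stays explicit since \<open>r\<close> later becomes
  a power of time.\<close>

lemma nn_integral_norm_powr_ball:
  fixes b :: real assumes b: "0 < b" "b < real DIM('a::euclidean_space)"
  obtains C where "C > 0" "\<And>r. r > 0 \<Longrightarrow>
    (\<integral>\<^sup>+x. ennreal (norm (x::'a) powr (-b)) * indicator (ball 0 r) x \<partial>lborel) \<le> ennreal (C * r powr (real DIM('a) - b))"
proof -
  let ?V = "unit_ball_vol (real DIM('a))" and ?N = "real DIM('a)"
  define q where "q = (1/2) powr (?N - b)"
  have q: "0 < q" "q < 1" using b by (auto simp: q_def powr01_less_one)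
  define C where "C = 2 powr b * ?V / (1 - q)"
  have "C > 0" using q by (auto simp: C_def)
  moreover have "(\<integral>\<^sup>+x. ennreal (norm (x::'a) powr (-b)) * indicator (ball 0 r) x \<partial>lborel) \<le> ennreal (C * r powr (?N - b))"
    if r: "r > 0" for r
  proof -
    let ?r = "\<lambda>n. r * (1/2) ^ n"
    have "(\<integral>\<^sup>+x. ennreal (norm (x::'a) powr (-b)) * indicator (ball 0 r) x \<partial>lborel)
       \<le> (\<integral>\<^sup>+x. (\<Sum>n. ennreal (?r (Suc n) powr (-b)) * indicator (ball (0::'a) (?r n)) x) \<partial>lborel)"
    proof (rule nn_integral_mono)
      fix x :: 'a
      show "ennreal (norm (x::'a) powr (-b)) * indicator (ball 0 r) x \<le>
         (\<Sum>n. ennreal (?r (Suc n) powr (-b)) * indicator (ball (0::'a) (?r n)) x)"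
      proof (cases "x \<noteq> 0 \<and> norm x < r")
        case True
        have "\<exists>n. ?r n \<le> norm x"
        proof -
          have "(\<lambda>n. r * (1/2)^n) \<longlonglongrightarrow> r * 0" by (intro tendsto_intros) auto
          then have "eventually (\<lambda>n. ?r n < norm x) sequentially"
            by (rule order_tendstoD) (use True in auto)
          then show ?thesis by (meson eventually_sequentially less_imp_le order_refl)
        qed
        \<comment> \<open>The least such index locates the shell containing \<open>x\<close>; it is
          a successor because \<open>norm x < r\<close>.\<close>
        define n where "n = (LEAST n. ?r n \<le> norm x)"
        have n1: "?r n \<le> norm x" unfolding n_def by (rule LeastI_ex) fact
        have "n \<noteq> 0" using n1 True by (intro notI) simp
        then obtain m where m: "n = Suc m" by (cases n) auto
        have m2: "norm x < ?r m"
          using not_less_Least[of m "\<lambda>n. ?r n \<le> norm x"] m by (simp add: n_def[symmetric])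
        have "norm x powr (-b) \<le> ?r (Suc m) powr (-b)"
          using n1 m b r by (intro powr_mono2') auto
        then have "ennreal (norm (x::'a) powr (-b)) * indicator (ball 0 r) x
            \<le> ennreal (?r (Suc m) powr (-b)) * indicator (ball (0::'a) (?r m)) x"
          using True m2 by (auto intro!: ennreal_leI)
        also have "\<dots> \<le> (\<Sum>n. ennreal (?r (Suc n) powr (-b)) * indicator (ball (0::'a) (?r n)) x)"
          by (rule ennreal_le_suminf)
        finally show ?thesis .
      qed (use b in auto)
    qed
    also have "\<dots> = (\<Sum>n. ennreal (?r (Suc n) powr (-b) * (?V * (?r n) ^ DIM('a))))"
      using r by (intro nn_integral_suminf_ball) auto
    also have "(\<lambda>n. ?r (Suc n) powr (-b) * (?V * (?r n) ^ DIM('a))) = (\<lambda>n. (2 powr b * ?V * r powr (?N - b)) * q ^ n)"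
    proof
      fix n
      have 1: "(?r n) ^ DIM('a) = ?r n powr ?N" using r by (simp add: powr_realpow)
      have 2: "?r (Suc n) powr (-b) = 2 powr b * ?r n powr (-b)"
      proof -
        have "?r (Suc n) = (1/2) * ?r n" by simp
        then have "?r (Suc n) powr (-b) = (1/2) powr (-b) * ?r n powr (-b)" by (simp only: powr_mult)
        also have "(1/2::real) powr (-b) = 2 powr b" by (simp add: powr_minus powr_divide)
        finally show ?thesis .
      qed
      have 3: "?r n powr (-b) * ?r n powr ?N = ?r n powr (?N - b)"
        by (simp add: powr_add[symmetric])
      have 4: "?r n powr (?N - b) = r powr (?N - b) * q ^ n"
      proof -
        have "((1/2::real) ^ n) powr c = ((1/2) powr c) ^ n" for c
          by (induction n) (simp_all only: power_Suc power_0 powr_mult powr_one_eq_one)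
        then show ?thesis using r by (simp only: powr_mult q_def) 
      qed
      show "?r (Suc n) powr (-b) * (?V * (?r n) ^ DIM('a)) = (2 powr b * ?V * r powr (?N - b)) * q ^ n"
      proof -
        have "?r (Suc n) powr (-b) * (?V * (?r n) ^ DIM('a)) = 2 powr b * ?V * (?r n powr (-b) * ?r n powr ?N)"
          unfolding 1 2 by (simp only: mult_ac)
        then show ?thesis unfolding 3 4 by (simp only: mult_ac)
      qed
    qed
    also have "(\<Sum>n. ennreal ((2 powr b * ?V * r powr (?N - b)) * q ^ n)) = ennreal (\<Sum>n. (2 powr b * ?V * r powr (?N - b)) * q ^ n)"
      using q by (intro suminf_ennreal2 summable_mult summable_geometric) auto
    also have "(\<Sum>n. (2 powr b * ?V * r powr (?N - b)) * q ^ n) = C * r powr (?N - b)"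
      using q by (subst suminf_mult) (auto simp: suminf_geometric C_def)
    finally show ?thesis .
  qed
  ultimately show ?thesis using that by blast
qed

section \<open>Fourier transform of the Gaussian\<close>

text \<open>Reduction to the characteristic function of the standard normal law: the dilation by
  \<open>c\<close> with 2dc^2 = 1 turns exp(-d \<xi>^2) into exp(-y^2/2).\<close>

lemma gaussian_fourier_real:
  fixes d x :: real assumes d: "d > 0"
  shows "integrable lborel (\<lambda>\<xi>. exp (\<i> * complex_of_real (x * \<xi>)) * complex_of_real (exp (- d * \<xi>\<^sup>2)))"
    and "(LBINT \<xi>. exp (\<i> * complex_of_real (x * \<xi>)) * complex_of_real (exp (- d * \<xi>\<^sup>2)))
       = complex_of_real (sqrt (pi / d) * exp (- x\<^sup>2 / (4 * d)))"
proof -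
  let ?f = "\<lambda>\<xi>. exp (\<i> * complex_of_real (x * \<xi>)) * complex_of_real (exp (- d * \<xi>\<^sup>2))"
  have "integrable lborel (\<lambda>\<xi>::real. gauss d \<xi>)" by (rule integrable_exp_norm_sq[OF d])
  then show "integrable lborel ?f"
    by (rule Bochner_Integration.integrable_bound) (auto simp: norm_mult)
  define c where "c = 1 / sqrt (2 * d)"
  have c: "c > 0" "2 * d * c\<^sup>2 = 1" using d by (auto simp: c_def power_divide)
  define s where "s = x * c"
  have "complex_of_real (exp (- s\<^sup>2 / 2)) = char std_normal_distribution s"
    by (simp add: char_std_normal_distribution)
  also have "\<dots> = (LBINT y. std_normal_density y *\<^sub>R iexp (s * y))"
    unfolding char_def by (subst integral_density) auto
  also have "\<dots> = (LBINT y. complex_of_real (1 / sqrt (2 * pi)) * ?f (0 + c * y))"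
  proof (rule Bochner_Integration.integral_cong[OF refl])
    fix y
    have "d * (c * y)\<^sup>2 = y\<^sup>2 / 2" using c(2) by (simp add: power_mult_distrib)
    then show "std_normal_density y *\<^sub>R iexp (s * y) = complex_of_real (1 / sqrt (2 * pi)) * ?f (0 + c * y)"
      unfolding std_normal_density_def s_def by (simp add: scaleR_conv_of_real mult_ac)
  qed
  also have "\<dots> = complex_of_real (1 / sqrt (2 * pi)) * (LBINT y. ?f (0 + c * y))"
    by (rule integral_mult_right_zero)
  finally have 1: "complex_of_real (exp (- s\<^sup>2 / 2)) = complex_of_real (1 / sqrt (2 * pi)) * (LBINT y. ?f (0 + c * y))" .
  have "(LBINT \<xi>. ?f \<xi>) = \<bar>c\<bar> *\<^sub>R (LBINT y. ?f (0 + c * y))"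
    by (rule lborel_integral_real_affine) (use c in auto)
  also have "(LBINT y. ?f (0 + c * y)) = complex_of_real (sqrt (2 * pi) * exp (- s\<^sup>2 / 2))"
    using 1 by (simp add: field_simps)
  also have "\<bar>c\<bar> *\<^sub>R complex_of_real (sqrt (2 * pi) * exp (- s\<^sup>2 / 2)) = complex_of_real (c * sqrt (2 * pi) * exp (- s\<^sup>2 / 2))"
    using c by (simp add: scaleR_conv_of_real)
  also have "c * sqrt (2 * pi) = sqrt (pi / d)"
    using d by (simp add: c_def real_sqrt_mult real_sqrt_divide field_simps)
  also have "- s\<^sup>2 / 2 = - x\<^sup>2 / (4 * d)"
    using d by (simp add: s_def c_def power_mult_distrib power_divide field_simps)
  finally show "(LBINT \<xi>. ?f \<xi>) = complex_of_real (sqrt (pi / d) * exp (- x\<^sup>2 / (4 * d)))" .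
qed

lemma lborel_integral_prod_Basis:
  fixes f :: "'a::euclidean_space \<Rightarrow> real \<Rightarrow> complex"
  assumes int: "\<And>b. b \<in> Basis \<Longrightarrow> integrable lborel (f b)"
  shows "(LBINT x. (\<Prod>b\<in>Basis. f b (x \<bullet> b))) = (\<Prod>b\<in>Basis. (LBINT y. f b y))"
proof -
  interpret product_sigma_finite "\<lambda>b::'a. lborel :: real measure" by standard
  have [measurable]: "\<And>b. b \<in> Basis \<Longrightarrow> f b \<in> borel_measurable borel"
    using int by (auto dest: borel_measurable_integrable)
  have "(LBINT x. (\<Prod>b\<in>Basis. f b (x \<bullet> b))) =
     (\<integral>g. (\<Prod>b\<in>Basis. f b ((\<Sum>b'\<in>Basis. g b' *\<^sub>R b') \<bullet> b)) \<partial>(\<Pi>\<^sub>M b\<in>Basis. lborel))"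
    by (subst lborel_eq, subst integral_distr) simp_all
  also have "\<dots> = (\<integral>g. (\<Prod>b\<in>Basis. f b (g b)) \<partial>(\<Pi>\<^sub>M b\<in>Basis. lborel))"
    by (intro Bochner_Integration.integral_cong refl prod.cong) simp
  also have "\<dots> = (\<Prod>b\<in>Basis. (LBINT y. f b y))"
    by (rule product_integral_prod) (use int in auto)
  finally show ?thesis .
qed

text \<open>The complex exponential factors over the coordinates where the cosine does not; the real
  part is taken only after the product formula.\<close>

lemma gaussian_fourier:
  fixes d :: real and x :: "'a::euclidean_space" assumes d: "d > 0"
  shows "(LBINT \<xi>. cos (x \<bullet> \<xi>) * gauss d \<xi>)
       = sqrt (pi / d) ^ DIM('a) * exp (- (norm x)\<^sup>2 / (4 * d))"
proof -
  let ?g = "\<lambda>\<xi>. exp (\<i> * complex_of_real (x \<bullet> \<xi>)) * complex_of_real (gauss d \<xi>)"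
  have eq: "?g \<xi> = (\<Prod>b\<in>Basis. exp (\<i> * complex_of_real ((x \<bullet> b) * (\<xi> \<bullet> b))) * complex_of_real (exp (- d * (\<xi> \<bullet> b)\<^sup>2)))" for \<xi>
  proof -
    have 1: "x \<bullet> \<xi> = (\<Sum>b\<in>Basis. (x \<bullet> b) * (\<xi> \<bullet> b))" by (rule euclidean_inner)
    have "(norm \<xi>)\<^sup>2 = (\<Sum>b\<in>Basis. (\<xi> \<bullet> b)\<^sup>2)"
      by (subst power2_norm_eq_inner, subst euclidean_inner) (simp add: power2_eq_square)
    then have 2: "gauss d \<xi> = (\<Prod>b\<in>Basis. exp (- d * (\<xi> \<bullet> b)\<^sup>2))"
      by (simp add: exp_sum[symmetric] sum_distrib_left sum_negf)
    show ?thesis unfolding 1 2 by (simp add: exp_sum prod.distrib sum_distrib_left)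
  qed
  have int: "integrable lborel ?g"
    by (rule Bochner_Integration.integrable_bound[OF integrable_exp_norm_sq[OF d]]) (auto simp: norm_mult)
  have "(LBINT \<xi>. ?g \<xi>) = (\<Prod>b\<in>Basis. (LBINT y. exp (\<i> * complex_of_real ((x \<bullet> b) * y)) * complex_of_real (exp (- d * y\<^sup>2))))"
    unfolding eq by (rule lborel_integral_prod_Basis) (rule gaussian_fourier_real(1)[OF d])
  also have "\<dots> = complex_of_real (\<Prod>b\<in>(Basis::'a set). sqrt (pi / d) * exp (- (x \<bullet> b)\<^sup>2 / (4 * d)))"
    by (simp only: gaussian_fourier_real(2)[OF d] of_real_prod)
  also have "(\<Prod>b\<in>(Basis::'a set). sqrt (pi / d) * exp (- (x \<bullet> b)\<^sup>2 / (4 * d))) = sqrt (pi / d) ^ DIM('a) * exp (\<Sum>b\<in>(Basis::'a set). - (x \<bullet> b)\<^sup>2 / (4 * d))"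
    by (simp only: prod.distrib prod_constant exp_sum[OF finite_Basis])
  also have "(\<Sum>b\<in>(Basis::'a set). - (x \<bullet> b)\<^sup>2 / (4 * d)) = - (norm x)\<^sup>2 / (4 * d)"
    by (subst power2_norm_eq_inner, subst euclidean_inner)
       (simp add: power2_eq_square sum_negf sum_divide_distrib)
  finally have "Re (LBINT \<xi>. ?g \<xi>) = sqrt (pi / d) ^ DIM('a) * exp (- (norm x)\<^sup>2 / (4 * d))"
    by simp
  moreover have "Re (LBINT \<xi>. ?g \<xi>) = (LBINT \<xi>. Re (?g \<xi>))"
    using integral_Re[OF int] by simp
  moreover have "Re (?g \<xi>) = cos (x \<bullet> \<xi>) * gauss d \<xi>" for \<xi>
    by (simp add: Re_exp)
  ultimately show ?thesis by simp
qed

section \<open>Positivity of the kernel\<close>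

lemma nn_integral_powr_near_0:
  fixes a c :: real assumes "a > -1" "c \<ge> 0"
  shows "(\<integral>\<^sup>+s. ennreal (s powr a) * indicator {0..c} s \<partial>lborel) = ennreal (c powr (a + 1) / (a + 1))"
  using has_integral_powr_from_0[OF assms] by (intro nn_integral_has_integral_lebesgue') auto

lemma nn_integral_powr_near_inf:
  fixes a c :: real assumes "a < -1" "c > 0"
  shows "(\<integral>\<^sup>+s. ennreal (s powr a) * indicator {c..} s \<partial>lborel) = ennreal (- (c powr (a + 1)) / (a + 1))"
  using has_integral_powr_to_inf[OF assms] by (intro nn_integral_has_integral_lebesgue') auto

text \<open>Vanishing of order p > a at 0 and boundedness at infinity compensate the two divergences
  of s^(-1-a). It is meant for 1 - exp(-s) and 1 - exp(-s^\<theta>).\<close>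

lemma nn_integral_powr_weight_finite:
  fixes w :: "real \<Rightarrow> real"
  assumes [measurable]: "w \<in> borel_measurable borel"
    and a: "0 < a" "a < p" and w: "\<And>s. s > 0 \<Longrightarrow> 0 \<le> w s" "\<And>s. s > 0 \<Longrightarrow> w s \<le> A * s powr p" "\<And>s. s > 0 \<Longrightarrow> w s \<le> B"
  shows "(\<integral>\<^sup>+s. ennreal (w s * s powr (-1-a)) * indicator {0<..} s \<partial>lborel) < \<infinity>"
proof -
  have A: "A \<ge> 0" using w(1)[of 1] w(2)[of 1] by simp
  have B: "B \<ge> 0" using w(1)[of 1] w(3)[of 1] by simp
  have "(\<integral>\<^sup>+s. ennreal (w s * s powr (-1-a)) * indicator {0<..} s \<partial>lborel)
     \<le> (\<integral>\<^sup>+s. ennreal A * (ennreal (s powr (p-1-a)) * indicator {0..1} s) + ennreal B * (ennreal (s powr (-1-a)) * indicator {1..} s) \<partial>lborel)"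
  proof (rule nn_integral_mono)
    fix s :: real
    show "ennreal (w s * s powr (-1-a)) * indicator {0<..} s \<le> ennreal A * (ennreal (s powr (p-1-a)) * indicator {0..1} s) + ennreal B * (ennreal (s powr (-1-a)) * indicator {1..} s)"
    proof (cases "s > 0")
      case True
      show ?thesis
      proof (cases "s < 1")
        case s1: True
        have "w s * s powr (-1-a) \<le> (A * s powr p) * s powr (-1-a)"
          using w(2)[OF True] by (intro mult_right_mono) auto
        also have "\<dots> = A * s powr (p-1-a)" using True by (simp add: powr_add[symmetric] algebra_simps)
        finally have "ennreal (w s * s powr (-1-a)) \<le> ennreal A * ennreal (s powr (p-1-a))"
          using A by (simp add: ennreal_mult[symmetric] ennreal_leI)
        then show ?thesis using True s1 by simp
      next
        case False
        have "w s * s powr (-1-a) \<le> B * s powr (-1-a)"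
          using w(3)[OF True] by (intro mult_right_mono) auto
        then have "ennreal (w s * s powr (-1-a)) \<le> ennreal B * ennreal (s powr (-1-a))"
          using B by (simp add: ennreal_mult[symmetric] ennreal_leI)
        then show ?thesis using True False by (simp add: add_increasing)
      qed
    qed simp
  qed
  also have "\<dots> = ennreal A * (\<integral>\<^sup>+s. ennreal (s powr (p-1-a)) * indicator {0..1} s \<partial>lborel)
      + ennreal B * (\<integral>\<^sup>+s. ennreal (s powr (-1-a)) * indicator {1..} s \<partial>lborel)"
    by (simp add: nn_integral_add nn_integral_cmult)
  also have "\<dots> < \<infinity>"
    using a by (subst nn_integral_powr_near_0; (subst nn_integral_powr_near_inf)?) (auto simp: ennreal_mult_less_top)
  finally show ?thesis .
qed

text \<open>A dilation of the argument by \<open>c\<close> costs the factor \<open>c powr a\<close>.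
  This is the origin of the power |\<xi>|^\<theta> in the mixture of Gaussians and of the power of t
  in the kernel moments.\<close>

lemma nn_integral_powr_weight_scale:
  fixes w :: "real \<Rightarrow> real"
  assumes [measurable]: "w \<in> borel_measurable borel" and c: "c > 0"
  shows "(\<integral>\<^sup>+s. ennreal (w (c * s) * s powr (-1-a)) * indicator {0<..} s \<partial>lborel)
     = ennreal (c powr a) * (\<integral>\<^sup>+s. ennreal (w s * s powr (-1-a)) * indicator {0<..} s \<partial>lborel)"
proof -
  have "(\<integral>\<^sup>+s. ennreal (w s * s powr (-1-a)) * indicator {0<..} s \<partial>lborel)
     = ennreal \<bar>c\<bar> * (\<integral>\<^sup>+s. ennreal (w (0 + c * s) * (0 + c * s) powr (-1-a)) * indicator {0<..} (0 + c * s) \<partial>lborel)"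
    using c by (intro nn_integral_real_affine) auto
  also have "(\<lambda>s. ennreal (w (0 + c * s) * (0 + c * s) powr (-1-a)) * indicator {0<..} (0 + c * s))
     = (\<lambda>s. ennreal (c powr (-1-a)) * (ennreal (w (c * s) * s powr (-1-a)) * indicator {0<..} s))"
    using c by (auto simp: fun_eq_iff powr_mult indicator_def zero_less_mult_iff ennreal_mult'[symmetric] mult_ac)
  also have "(\<integral>\<^sup>+s. ennreal (c powr (-1-a)) * (ennreal (w (c * s) * s powr (-1-a)) * indicator {0<..} s) \<partial>lborel)
     = ennreal (c powr (-1-a)) * (\<integral>\<^sup>+s. ennreal (w (c * s) * s powr (-1-a)) * indicator {0<..} s \<partial>lborel)"
    by (intro nn_integral_cmult) measurable
  finally have "ennreal (c powr a) * (\<integral>\<^sup>+s. ennreal (w s * s powr (-1-a)) * indicator {0<..} s \<partial>lborel)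
     = (ennreal (c powr a) * ennreal \<bar>c\<bar> * ennreal (c powr (-1-a))) * (\<integral>\<^sup>+s. ennreal (w (c * s) * s powr (-1-a)) * indicator {0<..} s \<partial>lborel)"
    by (simp only: mult.assoc)
  moreover have "ennreal (c powr a) * ennreal \<bar>c\<bar> * ennreal (c powr (-1-a)) = 1"
  proof -
    have "c powr a * c * c powr (-1-a) = c powr a * c powr 1 * c powr (-1-a)" using c by simp
    also have "\<dots> = 1" using c by (simp only: powr_add[symmetric]) simp
    finally show ?thesis using c by (simp add: ennreal_mult''[symmetric] del: powr_one)
  qed
  ultimately show ?thesis by simp
qed

lemma integrable_pair_mult:
  fixes f :: "'a::euclidean_space \<Rightarrow> real" and g :: "'b::euclidean_space \<Rightarrow> real"
  assumes f: "integrable lborel f" and g: "integrable lborel g"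
  shows "integrable (lborel \<Otimes>\<^sub>M lborel) (\<lambda>(x, y). f x * g y)"
proof -
  have [measurable]: "f \<in> borel_measurable borel" "g \<in> borel_measurable borel"
    using f g by (auto dest: borel_measurable_integrable)
  show ?thesis
    using f g by (intro lborel_pair.Fubini_integrable) (auto simp: norm_mult abs_mult)
qed

text \<open>Testing against Gaussians of every width makes sense for functions that are merely bounded,
  and is stable \<theta> under multiplication by a mixture of Gaussians.\<close>

definition gauss_positive :: "('a::euclidean_space \<Rightarrow> real) \<Rightarrow> bool" where
  "gauss_positive \<phi> \<longleftrightarrow> \<phi> \<in> borel_measurable borel \<and> (\<exists>B. \<forall>\<xi>. \<bar>\<phi> \<xi>\<bar> \<le> B) \<and>
     (\<forall>d>0. \<forall>x. 0 \<le> (LBINT \<xi>. cos (x \<bullet> \<xi>) * gauss d \<xi> * \<phi> \<xi>))"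

lemma gauss_positive_integrable:
  fixes \<phi> :: "'a::euclidean_space \<Rightarrow> real"
  assumes [measurable]: "\<phi> \<in> borel_measurable borel" and B: "\<And>\<xi>. \<bar>\<phi> \<xi>\<bar> \<le> B" and d: "d > 0"
  shows "integrable lborel (\<lambda>\<xi>. cos (x \<bullet> \<xi>) * gauss d \<xi> * \<phi> \<xi>)"
proof (rule Bochner_Integration.integrable_bound)
  show "integrable lborel (\<lambda>\<xi>::'a. B * gauss d \<xi>)"
    by (intro integrable_mult_right integrable_exp_norm_sq d)
  have "B \<ge> 0" using B[of 0] by linarith
  show "AE \<xi> in lborel. norm (cos (x \<bullet> \<xi>) * gauss d \<xi> * \<phi> \<xi>) \<le> norm (B * gauss d \<xi>)"
  proof (rule AE_I2)
    fix \<xi>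
    have "\<bar>cos (x \<bullet> \<xi>)\<bar> * (\<bar>\<phi> \<xi>\<bar> * gauss d \<xi>) \<le> 1 * (B * gauss d \<xi>)"
      using B[of \<xi>] by (intro mult_mono) auto
    then show "norm (cos (x \<bullet> \<xi>) * gauss d \<xi> * \<phi> \<xi>) \<le> norm (B * gauss d \<xi>)"
      using \<open>B \<ge> 0\<close> by (simp add: abs_mult mult_ac)
  qed
qed measurable

lemma gauss_positive_one: "gauss_positive (\<lambda>_::'a::euclidean_space. 1)"
  unfolding gauss_positive_def by (auto simp: gaussian_fourier[simplified] intro!: exI[of _ 1])

lemma gauss_positive_cmult:
  assumes "gauss_positive \<phi>" "c \<ge> 0"
  shows "gauss_positive (\<lambda>\<xi>. c * \<phi> \<xi>)"
proof -
  obtain B where B: "\<And>\<xi>. \<bar>\<phi> \<xi>\<bar> \<le> B" and [measurable]: "\<phi> \<in> borel_measurable borel"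
    using assms by (auto simp: gauss_positive_def)
  have "(LBINT \<xi>. cos (x \<bullet> \<xi>) * gauss d \<xi> * (c * \<phi> \<xi>)) = c * (LBINT \<xi>. cos (x \<bullet> \<xi>) * gauss d \<xi> * \<phi> \<xi>)" for x d
    by (subst integral_mult_right_zero[symmetric]) (simp add: mult_ac)
  moreover have "\<bar>c * \<phi> \<xi>\<bar> \<le> c * B" for \<xi>
    using B[of \<xi>] assms(2) by (auto simp: abs_mult intro: mult_left_mono)
  ultimately show ?thesis
    using assms unfolding gauss_positive_def by auto
qed

lemma gauss_positive_add:
  assumes "gauss_positive \<phi>" "gauss_positive \<psi>"
  shows "gauss_positive (\<lambda>\<xi>. \<phi> \<xi> + \<psi> \<xi>)"
proof -
  obtain B B' where B: "\<And>\<xi>. \<bar>\<phi> \<xi>\<bar> \<le> B" "\<And>\<xi>. \<bar>\<psi> \<xi>\<bar> \<le> B'"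
    and [measurable]: "\<phi> \<in> borel_measurable borel" "\<psi> \<in> borel_measurable borel"
    using assms by (auto simp: gauss_positive_def)
  have "(LBINT \<xi>. cos (x \<bullet> \<xi>) * gauss d \<xi> * (\<phi> \<xi> + \<psi> \<xi>))
     = (LBINT \<xi>. cos (x \<bullet> \<xi>) * gauss d \<xi> * \<phi> \<xi>) + (LBINT \<xi>. cos (x \<bullet> \<xi>) * gauss d \<xi> * \<psi> \<xi>)"
    if "d > 0" for x d
    unfolding distrib_left
    by (intro Bochner_Integration.integral_add gauss_positive_integrable[OF _ B(1) that] gauss_positive_integrable[OF _ B(2) that]) measurable
  moreover have "\<bar>\<phi> \<xi> + \<psi> \<xi>\<bar> \<le> B + B'" for \<xi>
    using B[of \<xi>] by linarith
  ultimately show ?thesis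
    using assms unfolding gauss_positive_def by auto
qed

lemma gauss_positive_limit:
  fixes \<phi> :: "nat \<Rightarrow> 'a::euclidean_space \<Rightarrow> real"
  assumes pos: "\<And>n. gauss_positive (\<phi> n)" and B: "\<And>n \<xi>. \<bar>\<phi> n \<xi>\<bar> \<le> B"
    and lim: "\<And>\<xi>. (\<lambda>n. \<phi> n \<xi>) \<longlonglongrightarrow> \<psi> \<xi>"
  shows "gauss_positive \<psi>"
proof -
  have [measurable]: "\<phi> n \<in> borel_measurable borel" for n using pos by (auto simp: gauss_positive_def)
  have [measurable]: "\<psi> \<in> borel_measurable borel"
    by (rule borel_measurable_LIMSEQ_real[OF lim]) auto
  have "B \<ge> 0" using B[of 0 0] by linarith
  have "\<bar>\<psi> \<xi>\<bar> \<le> B" for \<xi>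
    by (rule LIMSEQ_le_const2[OF tendsto_rabs[OF lim]]) (use B in auto)
  moreover have "0 \<le> (LBINT \<xi>. cos (x \<bullet> \<xi>) * gauss d \<xi> * \<psi> \<xi>)" if d: "d > 0" for d x
  proof (rule LIMSEQ_le_const)
    show "(\<lambda>n. LBINT \<xi>. cos (x \<bullet> \<xi>) * gauss d \<xi> * \<phi> n \<xi>) \<longlonglongrightarrow> (LBINT \<xi>. cos (x \<bullet> \<xi>) * gauss d \<xi> * \<psi> \<xi>)"
    proof (rule integral_dominated_convergence)
      show "integrable lborel (\<lambda>\<xi>::'a. B * gauss d \<xi>)"
        by (intro integrable_mult_right integrable_exp_norm_sq d)
      show "AE \<xi> in lborel. (\<lambda>n. cos (x \<bullet> \<xi>) * gauss d \<xi> * \<phi> n \<xi>) \<longlonglongrightarrow> cos (x \<bullet> \<xi>) * gauss d \<xi> * \<psi> \<xi>"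
        by (intro AE_I2 tendsto_intros lim)
      fix n
      show "AE \<xi> in lborel. norm (cos (x \<bullet> \<xi>) * gauss d \<xi> * \<phi> n \<xi>) \<le> B * gauss d \<xi>"
      proof (rule AE_I2)
        fix \<xi>
        have "\<bar>cos (x \<bullet> \<xi>)\<bar> * (\<bar>\<phi> n \<xi>\<bar> * gauss d \<xi>) \<le> 1 * (B * gauss d \<xi>)"
          using B[of n \<xi>] by (intro mult_mono) auto
        then show "norm (cos (x \<bullet> \<xi>) * gauss d \<xi> * \<phi> n \<xi>) \<le> B * gauss d \<xi>"
          by (simp add: abs_mult mult_ac)
      qed
    qed measurable
    show "\<exists>N. \<forall>n\<ge>N. 0 \<le> (LBINT \<xi>. cos (x \<bullet> \<xi>) * gauss d \<xi> * \<phi> n \<xi>)"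
      using pos d by (auto simp: gauss_positive_def)
  qed
  ultimately show ?thesis unfolding gauss_positive_def by auto
qed

text \<open>Widths add when Gaussians are multiplied: after Fubini, the integral tested at
  \<open>d\<close> is the \<open>w\<close>-average of the integrals of \<phi> tested at
  \<open>d + s\<close>. This is why positivity is demanded for all d > 0 at once; the vanishing of
  \<open>w\<close> on the negative axis keeps \<open>d + s\<close> positive.\<close>

lemma gauss_positive_mult_mixture:
  fixes \<phi> :: "'a::euclidean_space \<Rightarrow> real" and w :: "real \<Rightarrow> real"
  assumes pos: "gauss_positive \<phi>" and w: "integrable lborel w" "\<And>s. 0 \<le> w s" "\<And>s. s < 0 \<Longrightarrow> w s = 0"
  shows "gauss_positive (\<lambda>\<xi>. \<phi> \<xi> * (LBINT s. w s * gauss s \<xi>))"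
proof -
  let ?g = "\<lambda>\<xi>::'a. LBINT s. w s * gauss s \<xi>"
  obtain B where B: "\<And>\<xi>. \<bar>\<phi> \<xi>\<bar> \<le> B" and [measurable]: "\<phi> \<in> borel_measurable borel"
    using pos by (auto simp: gauss_positive_def)
  have B0: "B \<ge> 0" using B[of 0] by linarith
  have [measurable]: "w \<in> borel_measurable borel" using w(1) by (auto dest: borel_measurable_integrable)
  have we: "\<bar>w s * gauss s \<xi>\<bar> \<le> w s" for s and \<xi> :: 'a
  proof (cases "s < 0")
    case False
    then have "gauss s \<xi> \<le> 1" by simp
    then show ?thesis using w(2)[of s] by (simp add: abs_mult mult_left_le)
  qed (use w in auto)
  have gb: "\<bar>?g \<xi>\<bar> \<le> (LBINT s. w s)" for \<xi>
  proof -
    have "norm (?g \<xi>) \<le> (LBINT s. w s)"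
    proof (rule Bochner_Integration.integral_norm_bound_integral[OF _ w(1)])
      show "integrable lborel (\<lambda>s. w s * gauss s \<xi>)"
        by (rule Bochner_Integration.integrable_bound[OF w(1)]) (use we w(2) in auto)
      show "norm (w s * gauss s \<xi>) \<le> w s" for s using we[of s \<xi>] by simp
    qed
    then show ?thesis by simp
  qed
  have "\<bar>\<phi> \<xi> * ?g \<xi>\<bar> \<le> B * (LBINT s. w s)" for \<xi>
    unfolding abs_mult using B[of \<xi>] gb[of \<xi>] B0 by (intro mult_mono) auto
  moreover have "(\<lambda>\<xi>. \<phi> \<xi> * ?g \<xi>) \<in> borel_measurable borel" by measurable
  moreover have "0 \<le> (LBINT \<xi>. cos (x \<bullet> \<xi>) * gauss d \<xi> * (\<phi> \<xi> * ?g \<xi>))" if d: "d > 0" for d x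
  proof -
    define h where "h \<xi> s = cos (x \<bullet> \<xi>) * gauss d \<xi> * (\<phi> \<xi> * (w s * gauss s \<xi>))" for \<xi> s
    have h_meas: "(\<lambda>(\<xi>, s). h \<xi> s) \<in> borel_measurable (lborel \<Otimes>\<^sub>M lborel)"
      unfolding h_def by measurable
    have "integrable (lborel \<Otimes>\<^sub>M lborel) (\<lambda>(\<xi>::'a, s). (B * gauss d \<xi>) * w s)"
      by (intro integrable_pair_mult integrable_mult_right integrable_exp_norm_sq d w)
    then have hint: "integrable (lborel \<Otimes>\<^sub>M lborel) (case_prod h)"
    proof (rule Bochner_Integration.integrable_bound[OF _ h_meas], intro AE_I2)
      fix z :: "'a \<times> real"
      obtain \<xi> s where z: "z = (\<xi>, s)" by force
      have "(\<bar>cos (x \<bullet> \<xi>)\<bar> * gauss d \<xi>) * (\<bar>\<phi> \<xi>\<bar> * \<bar>w s * gauss s \<xi>\<bar>) \<le> (1 * gauss d \<xi>) * (B * w s)"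
        using B[of \<xi>] we[of s \<xi>] B0 by (intro mult_mono) auto
      then show "norm (case z of (\<xi>, s) \<Rightarrow> h \<xi> s) \<le> norm (case z of (\<xi>, s) \<Rightarrow> (B * gauss d \<xi>) * w s)"
        using B0 w(2)[of s] unfolding z h_def by (simp add: abs_mult mult_ac)
    qed
    have "(LBINT \<xi>. cos (x \<bullet> \<xi>) * gauss d \<xi> * (\<phi> \<xi> * ?g \<xi>)) = (LBINT \<xi>. LBINT s. h \<xi> s)"
      unfolding h_def by (simp add: mult.assoc)
    also have "\<dots> = (LBINT s. LBINT \<xi>. h \<xi> s)"
      by (rule lborel_pair.Fubini_integral[OF hint, symmetric])
    also have "\<dots> = (LBINT s. w s * (LBINT \<xi>. cos (x \<bullet> \<xi>) * gauss (d + s) \<xi> * \<phi> \<xi>))"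
    proof (intro Bochner_Integration.integral_cong refl)
      fix s
      have "h \<xi> s = w s * (cos (x \<bullet> \<xi>) * gauss (d + s) \<xi> * \<phi> \<xi>)" for \<xi>
      proof -
        have "gauss (d + s) \<xi> = gauss d \<xi> * gauss s \<xi>"
          by (simp add: exp_add[symmetric] algebra_simps)
        then show ?thesis unfolding h_def by (simp only: mult_ac)
      qed
      then show "(LBINT \<xi>. h \<xi> s) = w s * (LBINT \<xi>. cos (x \<bullet> \<xi>) * gauss (d + s) \<xi> * \<phi> \<xi>)"
        by simp
    qed
    also have "\<dots> \<ge> 0"
    proof (rule integral_nonneg_AE, rule AE_I2)
      fix s
      show "0 \<le> w s * (LBINT \<xi>. cos (x \<bullet> \<xi>) * gauss (d + s) \<xi> * \<phi> \<xi>)"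
      proof (cases "s < 0")
        case False
        then have "d + s > 0" using d by simp
        then show ?thesis using pos w(2)[of s] unfolding gauss_positive_def by (blast intro: mult_nonneg_nonneg)
      qed (use w in auto)
    qed
    finally show ?thesis .
  qed
  ultimately show ?thesis unfolding gauss_positive_def by blast
qed

text \<open>The Bernstein (subordination) formula for l^\<alpha>, obtained by scaling from l = 1.
  With l = |\<xi>|^2 and \<alpha> = \<theta>/2 it writes |\<xi>|^\<theta> through Gaussians.
  Convergence at 0 needs \<alpha> < 1, convergence at infinity \<alpha> > 0.\<close>

lemma powr_one_minus_exp_mixture:
  fixes \<alpha> :: real assumes \<alpha>: "0 < \<alpha>" "\<alpha> < 1"
  obtains I where "I > 0"
    "\<And>l. l \<ge> 0 \<Longrightarrow> (\<integral>\<^sup>+s. ennreal ((1 - exp (- (l * s))) * s powr (-1-\<alpha>)) * indicator {0<..} s \<partial>lborel) = ennreal (I * l powr \<alpha>)"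
proof -
  let ?J = "(\<integral>\<^sup>+s. ennreal ((1 - exp (- s)) * s powr (-1-\<alpha>)) * indicator {0<..} s \<partial>lborel)"
  have w: "1 - exp (- s) \<le> s" for s :: real using exp_ge_add_one_self[of "-s"] by linarith
  have fin: "?J < \<infinity>"
    by (rule nn_integral_powr_weight_finite[where p=1 and A=1 and B=1]) (use \<alpha> w in auto)
  define I where "I = enn2real ?J"
  have J: "?J = ennreal I" using fin by (simp add: I_def less_top)
  \<comment> \<open>A lower bound for the integrand on [1,2]; it serves to show that the normalising
    constant is positive.\<close>
  define c where "c = (1 - exp (-1)) * 2 powr (-1-\<alpha>)"
  have c: "c > 0" by (auto simp: c_def)
  have "ennreal c = (\<integral>\<^sup>+s. ennreal c * indicator {1..2::real} s \<partial>lborel)"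
    by (subst nn_integral_cmult_indicator) auto
  also have "\<dots> \<le> ?J"
  proof (rule nn_integral_mono)
    fix s :: real
    show "ennreal c * indicator {1..2} s \<le> ennreal ((1 - exp (- s)) * s powr (-1-\<alpha>)) * indicator {0<..} s"
    proof (cases "s \<in> {1..2}")
      case True
      then have "c \<le> (1 - exp (- s)) * s powr (-1-\<alpha>)"
        unfolding c_def using \<alpha> by (intro mult_mono powr_mono2') auto
      then show ?thesis using True by (simp add: ennreal_leI)
    qed simp
  qed
  finally have "I > 0" unfolding J using c
    by (metis ennreal_le_iff2 less_le_trans not_le)
  moreover have "(\<integral>\<^sup>+s. ennreal ((1 - exp (- (l * s))) * s powr (-1-\<alpha>)) * indicator {0<..} s \<partial>lborel) = ennreal (I * l powr \<alpha>)"
    if "l \<ge> 0" for l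
  proof (cases "l = 0")
    case False
    then have l: "l > 0" using that by simp
    show ?thesis
      using nn_integral_powr_weight_scale[of "\<lambda>s. 1 - exp (- s)" l \<alpha>] l J \<open>I > 0\<close>
      by (simp add: ennreal_mult' mult.commute)
  qed simp
  ultimately show ?thesis using that by blast
qed

text \<open>The exponential series has nonnegative coefficients, so its partial sums inherit
  positivity from the powers of \<open>g\<close>, and they are bounded uniformly by exp(cB).\<close>

lemma gauss_positive_exp:
  assumes pos: "\<And>n. gauss_positive (\<lambda>\<xi>. g \<xi> ^ n)" and B: "\<And>\<xi>. \<bar>g \<xi>\<bar> \<le> B" and c: "c \<ge> 0"
  shows "gauss_positive (\<lambda>\<xi>. exp (c * g \<xi>))"
proof (rule gauss_positive_limit)
  let ?S = "\<lambda>n \<xi>. \<Sum>k<n. c ^ k / fact k * g \<xi> ^ k"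
  show "gauss_positive (?S n)" for n
  proof (induction n)
    case 0
    show ?case using gauss_positive_cmult[OF pos[of 0], of 0] by simp
  next
    case (Suc n)
    have "gauss_positive (\<lambda>\<xi>. c ^ n / fact n * g \<xi> ^ n)"
      using c by (intro gauss_positive_cmult pos) auto
    from gauss_positive_add[OF Suc this] show ?case by simp
  qed
  have eq: "c ^ k / fact k * g \<xi> ^ k = (c * g \<xi>) ^ k /\<^sub>R fact k" for k \<xi>
    by (simp add: power_mult_distrib field_simps)
  show "(\<lambda>n. ?S n \<xi>) \<longlonglongrightarrow> exp (c * g \<xi>)" for \<xi>
    unfolding eq using exp_converges[of "c * g \<xi>"] by (simp add: sums_def)
  show "\<bar>?S n \<xi>\<bar> \<le> exp (c * B)" for n \<xi>
  proof -
    have "\<bar>?S n \<xi>\<bar> \<le> (\<Sum>k<n. \<bar>c ^ k / fact k * g \<xi> ^ k\<bar>)" by (rule sum_abs)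
    also have "\<dots> \<le> (\<Sum>k<n. (c * B) ^ k /\<^sub>R fact k)"
    proof (rule sum_mono)
      fix k
      have "\<bar>c ^ k / fact k * g \<xi> ^ k\<bar> = c ^ k / fact k * \<bar>g \<xi>\<bar> ^ k"
        using c by (simp add: abs_mult power_abs)
      also have "\<dots> \<le> c ^ k / fact k * B ^ k"
        using c B[of \<xi>] by (intro mult_left_mono power_mono) auto
      finally show "\<bar>c ^ k / fact k * g \<xi> ^ k\<bar> \<le> (c * B) ^ k /\<^sub>R fact k"
        by (simp add: power_mult_distrib field_simps)
    qed
    also have "\<dots> \<le> (\<Sum>k. (c * B) ^ k /\<^sub>R fact k)"
    proof (rule sum_le_suminf)
      show "summable (\<lambda>k. (c * B) ^ k /\<^sub>R fact k)" by (rule summable_exp_generic)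
      have "B \<ge> 0" using B[of undefined] by linarith
      then show "0 \<le> (c * B) ^ k /\<^sub>R fact k" for k using c by simp
    qed auto
    also have "\<dots> = exp (c * B)" by (simp add: exp_def)
    finally show ?thesis .
  qed
qed

text \<open>The case \<theta> = 2 is Gaussian and is separated because the mixture formula requires
  \<theta>/2 < 1. Otherwise the mixing measure is cut off near s = 0, where its mass is infinite.
  With m the mass of the truncated measure and g the corresponding mixture of Gaussians, exp(-c(m -
  g)) = exp(-cm) exp(cg) is a positive constant times an exponential of a mixture, and it is bounded
  by 1 since g \<le> m.\<close>

lemma gauss_positive_exp_norm_powr:
  fixes t \<theta> :: real assumes t: "t \<ge> 0" and th: "0 < \<theta>" "\<theta> \<le> 2"
  shows "gauss_positive (\<lambda>\<xi>::'a::euclidean_space. stable \<theta> t \<xi>)"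
proof (cases "\<theta> = 2")
  case True
  have "(LBINT \<xi>. cos (x \<bullet> \<xi>) * gauss d \<xi> * gauss t \<xi>) \<ge> 0" if "d > 0" for d and x :: 'a
  proof -
    have eq: "cos (x \<bullet> \<xi>) * gauss d \<xi> * gauss t \<xi> = cos (x \<bullet> \<xi>) * gauss (d + t) \<xi>" for \<xi>
      by (simp add: exp_add[symmetric] algebra_simps)
    show ?thesis unfolding eq by (subst gaussian_fourier) (use that t in auto)
  qed
  then show ?thesis using t True unfolding gauss_positive_def
    by (auto simp: powr_numeral intro!: exI[of _ 1])
next
  case False
  define \<alpha> where "\<alpha> = \<theta> / 2"
  have \<alpha>: "0 < \<alpha>" "\<alpha> < 1" using th False by (auto simp: \<alpha>_def)
  obtain I where I: "I > 0" and mix: "\<And>l. l \<ge> 0 \<Longrightarrow>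
      (\<integral>\<^sup>+s. ennreal ((1 - exp (- (l * s))) * s powr (-1-\<alpha>)) * indicator {0<..} s \<partial>lborel) = ennreal (I * l powr \<alpha>)"
    using powr_one_minus_exp_mixture[OF \<alpha>] by blast
  \<comment> \<open>Cancels the constant of the mixture formula, so that the exponent in the limit
    is exactly t |\<xi>|^\<theta>.\<close>
  define c where "c = t / I"
  have c: "c \<ge> 0" using t I by (simp add: c_def)
  define w where "w n s = s powr (-1-\<alpha>) * indicator {1 / real (Suc n)..} s" for n and s :: real
  have [measurable]: "w n \<in> borel_measurable borel" for n unfolding w_def by measurable
  have w0: "0 \<le> w n s" for n s by (simp add: w_def)
  have wneg: "w n s = 0" if "s < 0" for n s
  proof -
    have "\<not> 1 / real (Suc n) \<le> s" using that by (smt (verit) divide_nonneg_nonneg of_nat_0_le_iff)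
    then show ?thesis by (simp add: w_def)
  qed
  have wint: "integrable lborel (w n)" for n
  proof (rule integrableI_nonneg)
    have "(\<integral>\<^sup>+s. ennreal (w n s) \<partial>lborel) = (\<integral>\<^sup>+s. ennreal (s powr (-1-\<alpha>)) * indicator {1 / real (Suc n)..} s \<partial>lborel)"
      by (intro nn_integral_cong) (auto simp: w_def indicator_def)
    also have "\<dots> < \<infinity>" using \<alpha> by (subst nn_integral_powr_near_inf) auto
    finally show "(\<integral>\<^sup>+s. ennreal (w n s) \<partial>lborel) < \<infinity>" .
  qed (use w0 in auto)
  define g where "g n \<xi> = (LBINT s. w n s * gauss s \<xi>)" for n and \<xi> :: 'a
  define m where "m n = (LBINT s. w n s)" for n
  have wle: "w n s * gauss s \<xi> \<le> w n s" for n s and \<xi> :: 'a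
    using w0[of n s] wneg[of s n] by (cases "s < 0") (auto simp: mult_left_le)
  have wgint: "integrable lborel (\<lambda>s. w n s * gauss s \<xi>)" for n and \<xi> :: 'a
    by (rule Bochner_Integration.integrable_bound[OF wint[of n]]) (use wle w0 in auto)
  have g0: "0 \<le> g n \<xi>" for n \<xi> unfolding g_def using w0 by (intro integral_nonneg_AE AE_I2) auto
  have gm: "g n \<xi> \<le> m n" for n \<xi>
    unfolding g_def m_def by (rule integral_mono[OF wgint wint wle])
  have gpow: "gauss_positive (\<lambda>\<xi>. g n \<xi> ^ k)" for n k
  proof (induction k)
    case 0
    show ?case using gauss_positive_one by simp
  next
    case (Suc k)
    from gauss_positive_mult_mixture[OF Suc wint[of n] w0 wneg] show ?case
      by (simp add: g_def mult.commute)
  qed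
  have gexp: "gauss_positive (\<lambda>\<xi>. exp (- (c * m n)) * exp (c * g n \<xi>))" for n
    using g0 gm by (intro gauss_positive_cmult gauss_positive_exp[OF gpow _ c, of _ "m n"]) (auto simp: abs_of_nonneg)
  show ?thesis
  proof (rule gauss_positive_limit[OF gexp])
    show "\<bar>exp (- (c * m n)) * exp (c * g n \<xi>)\<bar> \<le> 1" for n \<xi>
      using mult_left_mono[OF gm c, of n \<xi>] by (simp add: exp_add[symmetric])
    show "(\<lambda>n. exp (- (c * m n)) * exp (c * g n \<xi>)) \<longlonglongrightarrow> stable \<theta> t \<xi>" for \<xi> :: 'a
    proof -
      let ?l = "(norm \<xi>)\<^sup>2"
      let ?f = "\<lambda>s. (1 - exp (- (?l * s))) * s powr (-1-\<alpha>) * indicator {0<..} s"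
      have f0: "0 \<le> ?f s" for s by (auto simp: indicator_def)
      have nn: "(\<integral>\<^sup>+s. ennreal (?f s) \<partial>lborel) = ennreal (I * ?l powr \<alpha>)"
        by (subst mix[symmetric]) (auto intro!: nn_integral_cong simp: indicator_def)
      have fint: "integrable lborel ?f"
        by (rule integrableI_nonneg) (use f0 nn in auto)
      have fI: "(LBINT s. ?f s) = I * ?l powr \<alpha>"
        using nn f0 I by (subst integral_eq_nn_integral) auto
      \<comment> \<open>\<open>m n\<close> and \<open>g n \<xi>\<close> need not converge separately
        as the cutoff is removed; their difference does, because 1 - exp(-s|\<xi>|^2) vanishes to
        first order at s = 0.\<close>
      have "(\<lambda>n. LBINT s. w n s * (1 - exp (- s * ?l))) \<longlonglongrightarrow> (LBINT s. ?f s)"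
      proof (rule integral_dominated_convergence[OF _ _ fint])
        show "AE s in lborel. (\<lambda>n. w n s * (1 - exp (- s * ?l))) \<longlonglongrightarrow> ?f s"
        proof (rule AE_I2)
          fix s :: real
          show "(\<lambda>n. w n s * (1 - exp (- s * ?l))) \<longlonglongrightarrow> ?f s"
          proof (cases "s > 0")
            case True
            have "(\<lambda>n. 1 / real (Suc n)) \<longlonglongrightarrow> 0" using LIMSEQ_inverse_real_of_nat by (simp add: inverse_eq_divide)
            then have "eventually (\<lambda>n. 1 / real (Suc n) < s) sequentially" by (rule order_tendstoD) fact
            then have "eventually (\<lambda>n. w n s * (1 - exp (- s * ?l)) = ?f s) sequentially"
              by eventually_elim (use True in \<open>auto simp: w_def mult_ac\<close>)
            then show ?thesis by (rule tendsto_eventually)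
          next
            case False
            then have "w n s = 0" for n using wneg[of s n] by (cases "s = 0") (auto simp: w_def)
            then show ?thesis using False by simp
          qed
        qed
        show "AE s in lborel. norm (w n s * (1 - exp (- s * ?l))) \<le> ?f s" for n
        proof (rule AE_I2)
          fix s :: real
          show "norm (w n s * (1 - exp (- s * ?l))) \<le> ?f s"
          proof (cases "s > 0")
            case False
            then have "w n s = 0" using wneg[of s n] by (cases "s = 0") (auto simp: w_def)
            then show ?thesis using False by simp
          qed (auto simp: w_def indicator_def mult_ac abs_mult)
        qed
      qed measurable
      also have "(\<lambda>n. LBINT s. w n s * (1 - exp (- s * ?l))) = (\<lambda>n. m n - g n \<xi>)"
      proof
        fix n
        show "(LBINT s. w n s * (1 - exp (- s * ?l))) = m n - g n \<xi>"
          unfolding m_def g_def by (subst Bochner_Integration.integral_diff[OF wint wgint, symmetric])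
            (simp add: algebra_simps)
      qed
      finally have lim: "(\<lambda>n. m n - g n \<xi>) \<longlonglongrightarrow> I * ?l powr \<alpha>" unfolding fI .
      have "?l powr \<alpha> = norm \<xi> powr \<theta>"
        unfolding \<alpha>_def by (cases "\<xi> = 0") (auto simp: powr_powr simp flip: powr_numeral)
      then have eq: "c * (I * ?l powr \<alpha>) = t * norm \<xi> powr \<theta>" using I by (simp add: c_def)
      have "(\<lambda>n. exp (- (c * (m n - g n \<xi>)))) \<longlonglongrightarrow> exp (- (c * (I * ?l powr \<alpha>)))"
        by (intro tendsto_intros lim)
      then show ?thesis unfolding eq by (simp add: exp_add[symmetric] algebra_simps)
    qed
  qed
qed

section \<open>The fundamental solution\<close>

lemma Gamma_frac_measurable[measurable]:
  "(\<lambda>z. Gamma_frac \<theta> (fst z) (snd z) :: real) \<in> borel_measurable (borel :: ((real^'n) \<times> real) measure)"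
  unfolding Gamma_frac_def borel_prod[symmetric] by measurable

lemma Gamma_frac_measurable2[measurable (raw)]:
  assumes [measurable]: "f \<in> M \<rightarrow>\<^sub>M borel" "g \<in> M \<rightarrow>\<^sub>M borel"
  shows "(\<lambda>x. Gamma_frac \<theta> (f x :: real^'n) (g x)) \<in> borel_measurable M"
proof -
  have "(\<lambda>x. (\<lambda>z. Gamma_frac \<theta> (fst z) (snd z)) (f x, g x)) \<in> borel_measurable M"
    by (rule measurable_compose[OF _ Gamma_frac_measurable]) (simp add: borel_prod[symmetric])
  then show ?thesis by simp
qed

lemma integrable_cos_exp_norm_powr:
  fixes x :: "'a::euclidean_space"
  assumes "t > 0" "\<theta> > 0"
  shows "integrable lborel (\<lambda>\<xi>. cos (x \<bullet> \<xi>) * stable \<theta> t \<xi>)"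
proof (rule Bochner_Integration.integrable_bound[OF integrable_exp_norm_powr[OF assms]])
  show "AE \<xi> in lborel. norm (cos (x \<bullet> \<xi>) * stable \<theta> t \<xi>) \<le> norm (stable \<theta> t \<xi>)"
  proof (rule AE_I2)
    fix \<xi>
    have "\<bar>cos (x \<bullet> \<xi>)\<bar> * stable \<theta> t \<xi> \<le> 1 * stable \<theta> t \<xi>"
      by (rule mult_right_mono) auto
    then show "norm (cos (x \<bullet> \<xi>) * stable \<theta> t \<xi>) \<le> norm (stable \<theta> t \<xi>)"
      by (simp add: abs_mult)
  qed
qed measurable

lemma inverse_Suc_tendsto_0: "(\<lambda>n. 1 / real (Suc n)) \<longlonglongrightarrow> 0"
  using LIMSEQ_inverse_real_of_nat by (simp add: inverse_eq_divide)

text \<open>The test Gaussian is removed by letting its parameter d tend to 0, with the integrable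
  symbol itself as dominating function.\<close>

lemma Gamma_frac_nonneg:
  fixes x :: "real^'n"
  assumes t: "t > 0" and th: "0 < \<theta>" "\<theta> \<le> 2"
  shows "Gamma_frac \<theta> x t \<ge> 0"
proof -
  let ?\<phi> = "\<lambda>\<xi>::real^'n. stable \<theta> t \<xi>"
  let ?d = "\<lambda>n. 1 / real (Suc n)"
  have pos: "gauss_positive ?\<phi>" using t th by (intro gauss_positive_exp_norm_powr) auto
  have "0 \<le> (LBINT \<xi>. cos (x \<bullet> \<xi>) * ?\<phi> \<xi>)"
  proof (rule LIMSEQ_le_const)
    show "(\<lambda>n. LBINT \<xi>. cos (x \<bullet> \<xi>) * gauss (?d n) \<xi> * ?\<phi> \<xi>) \<longlonglongrightarrow> (LBINT \<xi>. cos (x \<bullet> \<xi>) * ?\<phi> \<xi>)"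
    proof (rule integral_dominated_convergence[OF _ _ integrable_exp_norm_powr[OF t th(1)]])
      show "AE \<xi> in lborel. (\<lambda>n. cos (x \<bullet> \<xi>) * gauss (?d n) \<xi> * ?\<phi> \<xi>) \<longlonglongrightarrow> cos (x \<bullet> \<xi>) * ?\<phi> \<xi>"
      proof (rule AE_I2)
        fix \<xi>
        have "(\<lambda>n. cos (x \<bullet> \<xi>) * gauss (?d n) \<xi> * ?\<phi> \<xi>) \<longlonglongrightarrow> cos (x \<bullet> \<xi>) * exp (- 0 * (norm \<xi>)\<^sup>2) * ?\<phi> \<xi>"
          by (intro tendsto_intros inverse_Suc_tendsto_0)
        then show "(\<lambda>n. cos (x \<bullet> \<xi>) * gauss (?d n) \<xi> * ?\<phi> \<xi>) \<longlonglongrightarrow> cos (x \<bullet> \<xi>) * ?\<phi> \<xi>" by simp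
      qed
      fix n
      show "AE \<xi> in lborel. norm (cos (x \<bullet> \<xi>) * gauss (?d n) \<xi> * ?\<phi> \<xi>) \<le> ?\<phi> \<xi>"
      proof (rule AE_I2)
        fix \<xi>
        have "(\<bar>cos (x \<bullet> \<xi>)\<bar> * gauss (?d n) \<xi>) * ?\<phi> \<xi> \<le> (1 * 1) * ?\<phi> \<xi>"
          by (intro mult_right_mono mult_mono) auto
        then show "norm (cos (x \<bullet> \<xi>) * gauss (?d n) \<xi> * ?\<phi> \<xi>) \<le> ?\<phi> \<xi>"
          by (simp add: abs_mult)
      qed
    qed measurable
    show "\<exists>N. \<forall>n\<ge>N. 0 \<le> (LBINT \<xi>. cos (x \<bullet> \<xi>) * gauss (?d n) \<xi> * ?\<phi> \<xi>)"
    proof (intro exI[of _ 0] allI impI)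
      fix n :: nat
      have "?d n > 0" by simp
      then show "0 \<le> (LBINT \<xi>. cos (x \<bullet> \<xi>) * gauss (?d n) \<xi> * ?\<phi> \<xi>)"
        using pos unfolding gauss_positive_def by blast
    qed
  qed
  then show ?thesis unfolding Gamma_frac_def by simp
qed

text \<open>The cosine is at most 1, and the substitution \<xi> -> t^(-1/\<theta>) \<xi> reduces the
  remaining integral to time 1.\<close>

lemma Gamma_frac_bounded:
  assumes th: "0 < \<theta>"
  obtains C where "C > 0" "\<And>t (x::real^'n). t > 0 \<Longrightarrow> Gamma_frac \<theta> x t \<le> C * t powr (- real CARD('n) / \<theta>)"
proof -
  define A where "A = (LBINT \<xi>::real^'n. exp (- 1 * norm \<xi> powr \<theta>))"
  have A: "A \<ge> 0" unfolding A_def by (intro integral_nonneg_AE AE_I2) auto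
  define C where "C = 1 / (2 * pi) ^ CARD('n) * A + 1"
  have "C > 0" using A unfolding C_def by (intro add_nonneg_pos) auto
  moreover have "Gamma_frac \<theta> x t \<le> C * t powr (- real CARD('n) / \<theta>)" if t: "t > 0" for t and x :: "real^'n"
  proof -
    define c where "c = t powr (- 1 / \<theta>)"
    have c: "c > 0" using t by (simp add: c_def)
    have "t * c powr \<theta> = t * t powr (- 1)" using th by (simp add: c_def powr_powr)
    also have "\<dots> = 1" using t by (simp add: powr_minus)
    finally have tc: "t * c powr \<theta> = 1" .
    have cN: "c ^ CARD('n) = t powr (- real CARD('n) / \<theta>)"
      using t c by (simp add: powr_realpow[symmetric] c_def powr_powr)
    have "(LBINT \<xi>. cos (x \<bullet> \<xi>) * stable \<theta> t \<xi>) \<le> (LBINT \<xi>::real^'n. stable \<theta> t \<xi>)"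
      by (rule integral_mono[OF integrable_cos_exp_norm_powr[OF t th] integrable_exp_norm_powr[OF t th]]) auto
    also have "\<dots> = c ^ CARD('n) * (LBINT \<xi>::real^'n. exp (- t * norm (0 + c *\<^sub>R \<xi>) powr \<theta>))"
      using c by (subst lborel_integral_affine[where c=c and a=0]) auto
    also have "(\<lambda>\<xi>::real^'n. exp (- t * norm (0 + c *\<^sub>R \<xi>) powr \<theta>)) = (\<lambda>\<xi>. exp (- 1 * norm \<xi> powr \<theta>))"
    proof
      fix \<xi> :: "real^'n"
      have "t * norm (0 + c *\<^sub>R \<xi>) powr \<theta> = (t * c powr \<theta>) * norm \<xi> powr \<theta>"
        using c by (simp add: powr_mult)
      then show "exp (- t * norm (0 + c *\<^sub>R \<xi>) powr \<theta>) = exp (- 1 * norm \<xi> powr \<theta>)"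
        unfolding tc by simp
    qed
    also have "(LBINT \<xi>::real^'n. exp (- 1 * norm \<xi> powr \<theta>)) = A" by (simp add: A_def)
    finally have le: "(LBINT \<xi>. cos (x \<bullet> \<xi>) * stable \<theta> t \<xi>) \<le> c ^ CARD('n) * A" .
    have "Gamma_frac \<theta> x t \<le> 1 / (2 * pi) ^ CARD('n) * (c ^ CARD('n) * A)"
      unfolding Gamma_frac_def by (rule mult_left_mono[OF le]) simp
    also have "\<dots> \<le> C * c ^ CARD('n)"
      using c unfolding C_def by (simp add: algebra_simps)
    finally show ?thesis unfolding cN .
  qed
  ultimately show ?thesis using that by blast
qed

lemma Gamma_frac_abs_le:
  fixes x :: "real^'n"
  assumes "t > 0" "\<theta> > 0"
  shows "\<bar>Gamma_frac \<theta> x t\<bar> \<le> 1 / (2 * pi) ^ CARD('n) * (LBINT \<xi>::real^'n. stable \<theta> t \<xi>)"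
proof -
  have "norm (LBINT \<xi>. cos (x \<bullet> \<xi>) * stable \<theta> t \<xi>) \<le> (LBINT \<xi>::real^'n. stable \<theta> t \<xi>)"
  proof (rule Bochner_Integration.integral_norm_bound_integral[OF integrable_cos_exp_norm_powr[OF assms] integrable_exp_norm_powr[OF assms]])
    fix \<xi> :: "real^'n"
    have "\<bar>cos (x \<bullet> \<xi>)\<bar> * stable \<theta> t \<xi> \<le> 1 * stable \<theta> t \<xi>"
      by (rule mult_right_mono) auto
    then show "norm (cos (x \<bullet> \<xi>) * stable \<theta> t \<xi>) \<le> stable \<theta> t \<xi>"
      by (simp add: abs_mult)
  qed
  then show ?thesis unfolding Gamma_frac_def abs_mult by (intro mult_mono) auto
qed

section \<open>Fourier inversion, mass one and the semigroup law\<close>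

lemma lborel_integral_uminus:
  fixes f :: "'a::euclidean_space \<Rightarrow> real"
  assumes "f \<in> borel_measurable borel"
  shows "(LBINT x. f (- x)) = (LBINT x. f x)"
  using lborel_integral_affine[OF assms, of "-1" 0] by simp

lemma cos_gaussian_fourier:
  fixes \<xi> \<eta> :: "'a::euclidean_space" assumes d: "d > 0"
  shows "(LBINT x. cos (\<xi> \<bullet> x) * cos (\<eta> \<bullet> x) * gauss d x)
     = sqrt (pi / d) ^ DIM('a) * (exp (- (norm (\<xi> - \<eta>))\<^sup>2 / (4 * d)) + exp (- (norm (\<xi> + \<eta>))\<^sup>2 / (4 * d))) / 2"
proof -
  have int: "integrable lborel (\<lambda>x. cos (\<zeta> \<bullet> x) * gauss d x)" for \<zeta> :: 'a
    using integrable_cos_exp_norm_powr[OF d, of 2 \<zeta>] by (simp add: powr_numeral)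
  have "cos (\<xi> \<bullet> x) * cos (\<eta> \<bullet> x) * gauss d x
      = (cos ((\<xi> - \<eta>) \<bullet> x) * gauss d x + cos ((\<xi> + \<eta>) \<bullet> x) * gauss d x) / 2" for x
    by (simp add: inner_diff_left inner_add_left cos_add cos_diff algebra_simps)
  then have "(LBINT x. cos (\<xi> \<bullet> x) * cos (\<eta> \<bullet> x) * gauss d x)
     = ((LBINT x. cos ((\<xi> - \<eta>) \<bullet> x) * gauss d x) + (LBINT x. cos ((\<xi> + \<eta>) \<bullet> x) * gauss d x)) / 2"
    by (simp only: integral_divide_zero Bochner_Integration.integral_add[OF int int])
  then show ?thesis
    by (simp only: gaussian_fourier[OF d] distrib_left)
qed

text \<open>Fourier inversion before the limit: Fubini turns the Gaussian cutoff in x into an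
  approximate identity around \<eta> in \<xi>. The substitution \<xi> = \<eta> + 2 sqrt(d) w
  normalises it, so that on the right \<open>d\<close> survives only inside the symbol.\<close>

lemma Gamma_frac_gauss_fourier:
  fixes \<eta> :: "real^'n"
  assumes t: "t > 0" and th: "0 < \<theta>" and d: "d > 0"
  shows "(LBINT x. Gamma_frac \<theta> x t * (cos (\<eta> \<bullet> x) * gauss d x))
      = (1 / sqrt pi) ^ CARD('n) * (LBINT w. exp (- t * norm (\<eta> + (2 * sqrt d) *\<^sub>R w) powr \<theta>) * exp (- (norm w)\<^sup>2))"
proof -
  let ?N = "CARD('n)"
  let ?C = "1 / (2 * pi) ^ ?N"
  let ?\<phi> = "\<lambda>\<xi>::real^'n. stable \<theta> t \<xi>"
  define K where "K = sqrt (pi / d) ^ ?N"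
  define E where "E z = K * exp (- (norm z)\<^sup>2 / (4 * d))" for z :: "real^'n"
  have [measurable]: "E \<in> borel_measurable borel" unfolding E_def by measurable
  have E_le: "\<bar>E z\<bar> \<le> K" "E z \<ge> 0" for z using d unfolding E_def K_def by (auto simp: abs_mult mult_left_le)
  define h where "h x \<xi> = cos (x \<bullet> \<xi>) * ?\<phi> \<xi> * (cos (\<eta> \<bullet> x) * gauss d x)" for x \<xi> :: "real^'n"
  have h_meas: "(\<lambda>(x, \<xi>). h x \<xi>) \<in> borel_measurable (lborel \<Otimes>\<^sub>M lborel)"
    unfolding h_def by measurable
  have hint: "integrable (lborel \<Otimes>\<^sub>M lborel) (case_prod h)"
  proof (rule Bochner_Integration.integrable_bound[OF _ h_meas])
    show "integrable (lborel \<Otimes>\<^sub>M lborel) (\<lambda>(x::real^'n, \<xi>). gauss d x * ?\<phi> \<xi>)"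
      by (intro integrable_pair_mult integrable_exp_norm_sq integrable_exp_norm_powr d t th)
    show "AE z in lborel \<Otimes>\<^sub>M lborel. norm (case z of (x, \<xi>) \<Rightarrow> h x \<xi>) \<le> norm (case z of (x, \<xi>) \<Rightarrow> gauss d x * ?\<phi> \<xi>)"
    proof (rule AE_I2)
      fix z :: "(real^'n) \<times> (real^'n)"
      obtain x \<xi> where z: "z = (x, \<xi>)" by force
      have "(\<bar>cos (x \<bullet> \<xi>)\<bar> * ?\<phi> \<xi>) * (\<bar>cos (\<eta> \<bullet> x)\<bar> * gauss d x) \<le> (1 * ?\<phi> \<xi>) * (1 * gauss d x)"
        by (intro mult_mono) auto
      then show "norm (case z of (x, \<xi>) \<Rightarrow> h x \<xi>) \<le> norm (case z of (x, \<xi>) \<Rightarrow> gauss d x * ?\<phi> \<xi>)"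
        unfolding z h_def by (simp add: abs_mult mult.commute)
    qed
  qed
  have \<phi>E: "integrable lborel (\<lambda>\<xi>. ?\<phi> \<xi> * E (a + b *\<^sub>R \<xi>))" for a b
  proof (rule Bochner_Integration.integrable_bound)
    show "integrable lborel (\<lambda>\<xi>. K * ?\<phi> \<xi>)" by (intro integrable_mult_right integrable_exp_norm_powr t th)
    show "AE \<xi> in lborel. norm (?\<phi> \<xi> * E (a + b *\<^sub>R \<xi>)) \<le> norm (K * ?\<phi> \<xi>)"
    proof (rule AE_I2)
      fix \<xi>
      have "?\<phi> \<xi> * \<bar>E (a + b *\<^sub>R \<xi>)\<bar> \<le> ?\<phi> \<xi> * K" using E_le(1) by (intro mult_left_mono) auto
      then show "norm (?\<phi> \<xi> * E (a + b *\<^sub>R \<xi>)) \<le> norm (K * ?\<phi> \<xi>)"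
        using d by (simp add: abs_mult K_def mult.commute)
    qed
  qed measurable
  have "(LBINT x. Gamma_frac \<theta> x t * (cos (\<eta> \<bullet> x) * gauss d x)) = ?C * (LBINT x. LBINT \<xi>. h x \<xi>)"
    unfolding Gamma_frac_def h_def by (simp only: integral_mult_left_zero mult.assoc[of ?C] integral_mult_right_zero)
  also have "(LBINT x. LBINT \<xi>. h x \<xi>) = (LBINT \<xi>. LBINT x. h x \<xi>)"
    by (rule lborel_pair.Fubini_integral[OF hint, symmetric])
  also have "\<dots> = (LBINT \<xi>. (?\<phi> \<xi> * E (- \<eta> + 1 *\<^sub>R \<xi>) + ?\<phi> \<xi> * E (\<eta> + 1 *\<^sub>R \<xi>)) / 2)"
  proof (intro Bochner_Integration.integral_cong refl)
    fix \<xi> :: "real^'n"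
    have "h x \<xi> = ?\<phi> \<xi> * (cos (\<xi> \<bullet> x) * cos (\<eta> \<bullet> x) * gauss d x)" for x
      unfolding h_def by (simp add: mult_ac inner_commute)
    then have "(LBINT x. h x \<xi>) = ?\<phi> \<xi> * (LBINT x. cos (\<xi> \<bullet> x) * cos (\<eta> \<bullet> x) * gauss d x)" by simp
    also have "(LBINT x. cos (\<xi> \<bullet> x) * cos (\<eta> \<bullet> x) * gauss d x) = (E (- \<eta> + 1 *\<^sub>R \<xi>) + E (\<eta> + 1 *\<^sub>R \<xi>)) / 2"
      unfolding cos_gaussian_fourier[OF d] E_def K_def by (simp add: algebra_simps)
    finally show "(LBINT x. h x \<xi>) = (?\<phi> \<xi> * E (- \<eta> + 1 *\<^sub>R \<xi>) + ?\<phi> \<xi> * E (\<eta> + 1 *\<^sub>R \<xi>)) / 2"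
      by (simp add: algebra_simps)
  qed
  also have "\<dots> = ((LBINT \<xi>. ?\<phi> \<xi> * E (- \<eta> + 1 *\<^sub>R \<xi>)) + (LBINT \<xi>. ?\<phi> \<xi> * E (\<eta> + 1 *\<^sub>R \<xi>))) / 2"
    by (simp only: integral_divide_zero Bochner_Integration.integral_add[OF \<phi>E \<phi>E])
  \<comment> \<open>The symbol is even, so the bumps around \<eta> and -\<eta> contribute
    equally.\<close>
  also have "(LBINT \<xi>. ?\<phi> \<xi> * E (\<eta> + 1 *\<^sub>R \<xi>)) = (LBINT \<xi>. ?\<phi> (-\<xi>) * E (\<eta> + 1 *\<^sub>R (-\<xi>)))"
    by (rule lborel_integral_uminus[symmetric]) measurable
  also have "(\<lambda>\<xi>. ?\<phi> (-\<xi>) * E (\<eta> + 1 *\<^sub>R (-\<xi>))) = (\<lambda>\<xi>. ?\<phi> \<xi> * E (- \<eta> + 1 *\<^sub>R \<xi>))"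
    unfolding E_def by (auto simp: fun_eq_iff norm_minus_commute)
  also have "((LBINT \<xi>. ?\<phi> \<xi> * E (- \<eta> + 1 *\<^sub>R \<xi>)) + (LBINT \<xi>. ?\<phi> \<xi> * E (- \<eta> + 1 *\<^sub>R \<xi>))) / 2 = (LBINT \<xi>. ?\<phi> \<xi> * E (- \<eta> + 1 *\<^sub>R \<xi>))"
    by simp
  also have "\<dots> = \<bar>2 * sqrt d\<bar> ^ DIM(real^'n) * (LBINT w. ?\<phi> (\<eta> + (2 * sqrt d) *\<^sub>R w) * E (- \<eta> + 1 *\<^sub>R (\<eta> + (2 * sqrt d) *\<^sub>R w)))"
    using d by (intro lborel_integral_affine) auto
  also have "(\<lambda>w. ?\<phi> (\<eta> + (2 * sqrt d) *\<^sub>R w) * E (- \<eta> + 1 *\<^sub>R (\<eta> + (2 * sqrt d) *\<^sub>R w)))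
      = (\<lambda>w. K * (?\<phi> (\<eta> + (2 * sqrt d) *\<^sub>R w) * exp (- (norm w)\<^sup>2)))"
    using d unfolding E_def by (auto simp: fun_eq_iff power_mult_distrib)
  also have "(LBINT w. K * (?\<phi> (\<eta> + (2 * sqrt d) *\<^sub>R w) * exp (- (norm w)\<^sup>2))) = K * (LBINT w. ?\<phi> (\<eta> + (2 * sqrt d) *\<^sub>R w) * exp (- (norm w)\<^sup>2))"
    by (rule integral_mult_right_zero)
  finally have eq: "(LBINT x. Gamma_frac \<theta> x t * (cos (\<eta> \<bullet> x) * gauss d x))
     = (?C * (2 * sqrt d) ^ ?N * K) * (LBINT w. ?\<phi> (\<eta> + (2 * sqrt d) *\<^sub>R w) * exp (- (norm w)\<^sup>2))"
    using d by (simp add: mult.assoc)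
  have "?C * (2 * sqrt d) ^ ?N * K = ((1 / (2 * pi)) * (2 * sqrt d) * sqrt (pi / d)) ^ ?N"
    unfolding K_def by (simp add: power_mult_distrib power_divide)
  also have "(1 / (2 * pi)) * (2 * sqrt d) * sqrt (pi / d) = 1 / sqrt pi"
    using d by (simp add: real_sqrt_divide field_simps)
  finally show ?thesis using eq by simp
qed

text \<open>Integrability of the kernel is itself a conclusion. With \<eta> = 0 the regularised
  masses are at most 1 because the symbol is at most 1, and positivity of the kernel allows Fatou's
  lemma. Only then is the cutoff removed on both sides by dominated convergence, which gives the
  transform.\<close>

lemma
  fixes t \<theta> :: real
  assumes t: "t > 0" and th: "0 < \<theta>" "\<theta> \<le> 2"
  shows Gamma_frac_integrable: "integrable lborel (\<lambda>x::real^'n. Gamma_frac \<theta> x t)"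
    and Gamma_frac_fourier: "(LBINT x. Gamma_frac \<theta> x t * cos (\<eta> \<bullet> x)) = exp (- t * norm (\<eta>::real^'n) powr \<theta>)"
proof -
  let ?N = "CARD('n)"
  let ?d = "\<lambda>n. 1 / real (Suc n)"
  let ?\<phi> = "\<lambda>\<xi>::real^'n. stable \<theta> t \<xi>"
  let ?G = "\<lambda>x::real^'n. Gamma_frac \<theta> x t"
  have G0: "?G x \<ge> 0" for x by (rule Gamma_frac_nonneg[OF t th])
  have gint: "integrable lborel (\<lambda>w::real^'n. exp (- (norm w)\<^sup>2))"
    using integrable_exp_norm_sq[of 1, where 'a="real^'n"] by simp
  have gm: "(LBINT w::real^'n. exp (- (norm w)\<^sup>2)) = sqrt pi ^ ?N"
    using gaussian_fourier[of 1 "0::real^'n"] by simp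
  have c1: "(1 / sqrt pi) ^ ?N * sqrt pi ^ ?N = 1"
    by (simp add: power_mult_distrib[symmetric])
  obtain B where B: "\<And>x. ?G x \<le> B" using Gamma_frac_abs_le[OF t th(1), where 'n='n] by (metis abs_le_D1)
  have Gd_int: "integrable lborel (\<lambda>x. ?G x * gauss (?d n) x)" for n
  proof (rule Bochner_Integration.integrable_bound)
    show "integrable lborel (\<lambda>x::real^'n. B * gauss (?d n) x)"
      by (intro integrable_mult_right integrable_exp_norm_sq) simp
    show "AE x in lborel. norm (?G x * gauss (?d n) x) \<le> norm (B * gauss (?d n) x)"
    proof (rule AE_I2)
      fix x
      have "?G x * gauss (?d n) x \<le> B * gauss (?d n) x"
        using B by (intro mult_right_mono) auto
      then show "norm (?G x * gauss (?d n) x) \<le> norm (B * gauss (?d n) x)"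
        using G0[of x] by (simp add: abs_mult)
    qed
  qed measurable
  have J_le: "(LBINT x. ?G x * gauss (?d n) x) \<le> 1" for n
  proof -
    have "(LBINT x. ?G x * gauss (?d n) x) = (LBINT x. ?G x * (cos (0 \<bullet> x) * gauss (?d n) x))"
      by simp
    also have "\<dots> = (1 / sqrt pi) ^ ?N * (LBINT w. ?\<phi> (0 + (2 * sqrt (?d n)) *\<^sub>R w) * exp (- (norm w)\<^sup>2))"
      by (rule Gamma_frac_gauss_fourier[OF t th(1)]) simp
    also have "\<dots> \<le> (1 / sqrt pi) ^ ?N * (LBINT w::real^'n. exp (- (norm w)\<^sup>2))"
    proof (intro mult_left_mono integral_mono gint)
      show le: "?\<phi> (0 + (2 * sqrt (?d n)) *\<^sub>R w) * exp (- (norm w)\<^sup>2) \<le> exp (- (norm w)\<^sup>2)" for w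
        using t by (intro mult_left_le_one_le) auto
      show "integrable lborel (\<lambda>w. ?\<phi> (0 + (2 * sqrt (?d n)) *\<^sub>R w) * exp (- (norm w)\<^sup>2))"
        by (rule Bochner_Integration.integrable_bound[OF gint]) (use le in \<open>auto simp: abs_mult\<close>)
    qed auto
    also have "\<dots> = 1" unfolding gm by (rule c1)
    finally show ?thesis .
  qed
  have expd: "(\<lambda>n. gauss (?d n) x) \<longlonglongrightarrow> 1" for x :: "real^'n"
  proof -
    have "(\<lambda>n. gauss (?d n) x) \<longlonglongrightarrow> exp (- 0 * (norm x)\<^sup>2)"
      by (intro tendsto_intros inverse_Suc_tendsto_0)
    then show ?thesis by simp
  qed
  have "(\<integral>\<^sup>+x. ennreal (?G x) \<partial>lborel) = (\<integral>\<^sup>+x. liminf (\<lambda>n. ennreal (?G x * gauss (?d n) x)) \<partial>lborel)"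
  proof (rule nn_integral_cong)
    fix x :: "real^'n"
    have "(\<lambda>n. ennreal (?G x * gauss (?d n) x)) \<longlonglongrightarrow> ennreal (?G x * 1)"
      by (intro tendsto_intros expd)
    then show "ennreal (?G x) = liminf (\<lambda>n. ennreal (?G x * gauss (?d n) x))"
      by (simp add: lim_imp_Liminf)
  qed
  also have "\<dots> \<le> liminf (\<lambda>n. \<integral>\<^sup>+x. ennreal (?G x * gauss (?d n) x) \<partial>lborel)"
    by (rule nn_integral_liminf) measurable
  also have "\<dots> \<le> liminf (\<lambda>n. 1)"
  proof (rule Liminf_mono, rule always_eventually, rule allI)
    fix n
    have "(\<integral>\<^sup>+x. ennreal (?G x * gauss (?d n) x) \<partial>lborel) = ennreal (LBINT x. ?G x * gauss (?d n) x)"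
      by (rule nn_integral_eq_integral[OF Gd_int]) (use G0 in auto)
    also have "\<dots> \<le> 1" using J_le[of n] by simp
    finally show "(\<integral>\<^sup>+x. ennreal (?G x * gauss (?d n) x) \<partial>lborel) \<le> 1" .
  qed
  also have "\<dots> < \<infinity>" by (simp add: Liminf_const)
  finally have "(\<integral>\<^sup>+x. ennreal (?G x) \<partial>lborel) < \<infinity>" .
  then show int: "integrable lborel ?G"
    by (intro integrableI_nonneg) (use G0 in auto)
  have "(\<lambda>n. LBINT x. ?G x * (cos (\<eta> \<bullet> x) * gauss (?d n) x)) \<longlonglongrightarrow> (LBINT x. ?G x * (cos (\<eta> \<bullet> x) * 1))"
  proof (rule integral_dominated_convergence[OF _ _ int])
    show "AE x in lborel. (\<lambda>n. ?G x * (cos (\<eta> \<bullet> x) * gauss (?d n) x)) \<longlonglongrightarrow> ?G x * (cos (\<eta> \<bullet> x) * 1)"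
      by (intro AE_I2 tendsto_intros expd)
    show "AE x in lborel. norm (?G x * (cos (\<eta> \<bullet> x) * gauss (?d n) x)) \<le> ?G x" for n
    proof (rule AE_I2)
      fix x
      have "?G x * (\<bar>cos (\<eta> \<bullet> x)\<bar> * gauss (?d n) x) \<le> ?G x * (1 * 1)"
        using G0 by (intro mult_left_mono mult_mono) auto
      then show "norm (?G x * (cos (\<eta> \<bullet> x) * gauss (?d n) x)) \<le> ?G x"
        using G0[of x] by (simp add: abs_mult)
    qed
  qed measurable
  moreover have "(\<lambda>n. LBINT x. ?G x * (cos (\<eta> \<bullet> x) * gauss (?d n) x)) \<longlonglongrightarrow> ?\<phi> \<eta>"
  proof -
    have "(\<lambda>n. LBINT w. ?\<phi> (\<eta> + (2 * sqrt (?d n)) *\<^sub>R w) * exp (- (norm w)\<^sup>2)) \<longlonglongrightarrow> (LBINT w::real^'n. ?\<phi> \<eta> * exp (- (norm w)\<^sup>2))"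
    proof (rule integral_dominated_convergence[OF _ _ gint])
      show "AE w in lborel. (\<lambda>n. ?\<phi> (\<eta> + (2 * sqrt (?d n)) *\<^sub>R w) * exp (- (norm w)\<^sup>2)) \<longlonglongrightarrow> ?\<phi> \<eta> * exp (- (norm w)\<^sup>2)"
      proof (rule AE_I2)
        fix w :: "real^'n"
        have "(\<lambda>n. \<eta> + (2 * sqrt (?d n)) *\<^sub>R w) \<longlonglongrightarrow> \<eta> + (2 * sqrt 0) *\<^sub>R w"
          by (intro tendsto_intros inverse_Suc_tendsto_0)
        then have "(\<lambda>n. norm (\<eta> + (2 * sqrt (?d n)) *\<^sub>R w)) \<longlonglongrightarrow> norm \<eta>"
          by (intro tendsto_norm) simp
        then have "(\<lambda>n. norm (\<eta> + (2 * sqrt (?d n)) *\<^sub>R w) powr \<theta>) \<longlonglongrightarrow> norm \<eta> powr \<theta>"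
          using th by (intro tendsto_powr') auto
        then show "(\<lambda>n. ?\<phi> (\<eta> + (2 * sqrt (?d n)) *\<^sub>R w) * exp (- (norm w)\<^sup>2)) \<longlonglongrightarrow> ?\<phi> \<eta> * exp (- (norm w)\<^sup>2)"
          by (intro tendsto_mult[OF tendsto_exp[OF tendsto_mult[OF tendsto_const]] tendsto_const])
      qed
      show "AE w in lborel. norm (?\<phi> (\<eta> + (2 * sqrt (?d n)) *\<^sub>R w) * exp (- (norm w)\<^sup>2)) \<le> exp (- (norm w)\<^sup>2)" for n
        using t by (intro AE_I2) (auto simp: abs_mult intro!: mult_left_le_one_le)
    qed measurable
    then have "(\<lambda>n. (1 / sqrt pi) ^ ?N * (LBINT w. ?\<phi> (\<eta> + (2 * sqrt (?d n)) *\<^sub>R w) * exp (- (norm w)\<^sup>2)))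
        \<longlonglongrightarrow> (1 / sqrt pi) ^ ?N * (LBINT w::real^'n. ?\<phi> \<eta> * exp (- (norm w)\<^sup>2))"
      by (intro tendsto_intros)
    also have "(1 / sqrt pi) ^ ?N * (LBINT w::real^'n. ?\<phi> \<eta> * exp (- (norm w)\<^sup>2)) = ((1 / sqrt pi) ^ ?N * sqrt pi ^ ?N) * ?\<phi> \<eta>"
      by (simp only: integral_mult_right_zero gm mult_ac)
    also have "\<dots> = ?\<phi> \<eta>" unfolding c1 by simp
    also have "(\<lambda>n. (1 / sqrt pi) ^ ?N * (LBINT w. ?\<phi> (\<eta> + (2 * sqrt (?d n)) *\<^sub>R w) * exp (- (norm w)\<^sup>2)))
       = (\<lambda>n. LBINT x. ?G x * (cos (\<eta> \<bullet> x) * gauss (?d n) x))"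
      by (rule ext, rule Gamma_frac_gauss_fourier[OF t th(1), symmetric]) simp
    finally show ?thesis .
  qed
  ultimately have "(LBINT x. ?G x * (cos (\<eta> \<bullet> x) * 1)) = ?\<phi> \<eta>" by (rule LIMSEQ_unique)
  then show "(LBINT x. ?G x * cos (\<eta> \<bullet> x)) = ?\<phi> \<eta>" by simp
qed

lemma Gamma_frac_uminus: "Gamma_frac \<theta> (- x) t = Gamma_frac \<theta> x t"
  by (simp add: Gamma_frac_def)

lemma nn_integral_Gamma_frac:
  fixes x :: "real^'n"
  assumes t: "t > 0" and th: "0 < \<theta>" "\<theta> \<le> 2"
  shows "(\<integral>\<^sup>+y. ennreal (Gamma_frac \<theta> (x - y) t) \<partial>lborel) = 1"
proof -
  have "(LBINT y::real^'n. Gamma_frac \<theta> y t) = 1"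
    using Gamma_frac_fourier[OF assms, of 0] th by simp
  then have "(\<integral>\<^sup>+y. ennreal (Gamma_frac \<theta> (y::real^'n) t) \<partial>lborel) = 1"
    by (subst nn_integral_eq_integral[OF Gamma_frac_integrable[OF assms]])
       (auto simp: Gamma_frac_nonneg[OF assms])
  then show ?thesis by (subst nn_integral_lborel_reflect[where f="\<lambda>z. ennreal (Gamma_frac \<theta> z t)"]) auto
qed

text \<open>Only one factor is opened into its defining integral. Fubini then leaves the Fourier
  transform of the other factor, whose sine part vanishes by evenness, and the symbols
  multiply.\<close>

lemma Gamma_frac_convolution:
  fixes x :: "real^'n"
  assumes t: "t > 0" and s: "s > 0" and th: "0 < \<theta>" "\<theta> \<le> 2"
  shows "(LBINT y. Gamma_frac \<theta> (x - y) t * Gamma_frac \<theta> y s) = Gamma_frac \<theta> x (t + s)"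
proof -
  let ?C = "1 / (2 * pi) ^ CARD('n)"
  let ?\<phi> = "\<lambda>\<xi>::real^'n. stable \<theta> t \<xi>"
  let ?G = "\<lambda>y::real^'n. Gamma_frac \<theta> y s"
  note Gint = Gamma_frac_integrable[OF s th, where 'n='n]
  have sc: "integrable lborel (\<lambda>y. ?G y * cos (\<xi> \<bullet> y))" "integrable lborel (\<lambda>y. ?G y * sin (\<xi> \<bullet> y))" for \<xi>
    by (rule Bochner_Integration.integrable_bound[OF Gint]; auto simp: abs_mult mult_left_le)+
  have sin0: "(LBINT y. ?G y * sin (\<xi> \<bullet> y)) = 0" for \<xi>
  proof -
    have "(LBINT y. ?G y * sin (\<xi> \<bullet> y)) = (LBINT y. ?G (-y) * sin (\<xi> \<bullet> (-y)))"
      by (rule lborel_integral_uminus[symmetric]) measurable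
    then show ?thesis by (simp add: Gamma_frac_uminus)
  qed
  define h where "h y \<xi> = cos ((x - y) \<bullet> \<xi>) * ?\<phi> \<xi> * ?G y" for y \<xi> :: "real^'n"
  have h_meas: "(\<lambda>(y, \<xi>). h y \<xi>) \<in> borel_measurable (lborel \<Otimes>\<^sub>M lborel)"
    unfolding h_def by measurable
  have hint: "integrable (lborel \<Otimes>\<^sub>M lborel) (case_prod h)"
  proof (rule Bochner_Integration.integrable_bound[OF _ h_meas])
    show "integrable (lborel \<Otimes>\<^sub>M lborel) (\<lambda>(y, \<xi>). ?G y * ?\<phi> \<xi>)"
      by (intro integrable_pair_mult Gint integrable_exp_norm_powr t th)
    show "AE z in lborel \<Otimes>\<^sub>M lborel. norm (case z of (y, \<xi>) \<Rightarrow> h y \<xi>) \<le> norm (case z of (y, \<xi>) \<Rightarrow> ?G y * ?\<phi> \<xi>)"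
    proof (rule AE_I2)
      fix z :: "(real^'n) \<times> (real^'n)"
      obtain y \<xi> where z: "z = (y, \<xi>)" by force
      have "(\<bar>cos ((x - y) \<bullet> \<xi>)\<bar> * ?\<phi> \<xi>) * \<bar>?G y\<bar> \<le> (1 * ?\<phi> \<xi>) * \<bar>?G y\<bar>"
        by (intro mult_mono) auto
      then show "norm (case z of (y, \<xi>) \<Rightarrow> h y \<xi>) \<le> norm (case z of (y, \<xi>) \<Rightarrow> ?G y * ?\<phi> \<xi>)"
        unfolding z h_def by (simp add: abs_mult mult.commute)
    qed
  qed
  have "(LBINT y. Gamma_frac \<theta> (x - y) t * ?G y) = ?C * (LBINT y. LBINT \<xi>. h y \<xi>)"
    unfolding h_def Gamma_frac_def[of \<theta> _ t] by (simp only: integral_mult_left_zero mult.assoc[of ?C] integral_mult_right_zero)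
  also have "(LBINT y. LBINT \<xi>. h y \<xi>) = (LBINT \<xi>. LBINT y. h y \<xi>)"
    by (rule lborel_pair.Fubini_integral[OF hint, symmetric])
  also have "\<dots> = (LBINT \<xi>. cos (x \<bullet> \<xi>) * stable \<theta> (t + s) \<xi>)"
  proof (intro Bochner_Integration.integral_cong refl)
    fix \<xi> :: "real^'n"
    have "h y \<xi> = (?\<phi> \<xi> * cos (x \<bullet> \<xi>)) * (?G y * cos (\<xi> \<bullet> y)) + (?\<phi> \<xi> * sin (x \<bullet> \<xi>)) * (?G y * sin (\<xi> \<bullet> y))" for y
      unfolding h_def by (simp add: inner_diff_left cos_diff algebra_simps inner_commute[of y])
    then have "(LBINT y. h y \<xi>) = (LBINT y. (?\<phi> \<xi> * cos (x \<bullet> \<xi>)) * (?G y * cos (\<xi> \<bullet> y)) + (?\<phi> \<xi> * sin (x \<bullet> \<xi>)) * (?G y * sin (\<xi> \<bullet> y)))"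
      by simp
    also have "\<dots> = (LBINT y. (?\<phi> \<xi> * cos (x \<bullet> \<xi>)) * (?G y * cos (\<xi> \<bullet> y))) + (LBINT y. (?\<phi> \<xi> * sin (x \<bullet> \<xi>)) * (?G y * sin (\<xi> \<bullet> y)))"
      by (intro Bochner_Integration.integral_add integrable_mult_right sc)
    also have "\<dots> = ?\<phi> \<xi> * cos (x \<bullet> \<xi>) * stable \<theta> s \<xi>"
      by (simp only: integral_mult_right_zero sin0 Gamma_frac_fourier[OF s th] mult_zero_right add_0_right)
    also have "\<dots> = cos (x \<bullet> \<xi>) * stable \<theta> (t + s) \<xi>"
    proof -
      have "stable \<theta> (t + s) \<xi> = ?\<phi> \<xi> * stable \<theta> s \<xi>"
        by (simp add: exp_add[symmetric] algebra_simps)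
      then show ?thesis by (simp only: mult_ac)
    qed
    finally show "(LBINT y. h y \<xi>) = cos (x \<bullet> \<xi>) * stable \<theta> (t + s) \<xi>" .
  qed
  finally show ?thesis unfolding Gamma_frac_def[of \<theta> x "t + s"] .
qed

lemma Gamma_frac_semigroup:
  fixes x z :: "real^'n"
  assumes t: "t > 0" and s: "s > 0" and th: "0 < \<theta>" "\<theta> \<le> 2"
  shows "(\<integral>\<^sup>+y. ennreal (Gamma_frac \<theta> (x - y) t) * ennreal (Gamma_frac \<theta> (y - z) s) \<partial>lborel)
    = ennreal (Gamma_frac \<theta> (x - z) (t + s))"
proof -
  let ?f = "\<lambda>y. Gamma_frac \<theta> ((x - z) - y) t * Gamma_frac \<theta> y s"
  have nn: "?f y \<ge> 0" for y by (intro mult_nonneg_nonneg Gamma_frac_nonneg assms)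
  let ?B = "1 / (2 * pi) ^ CARD('n) * (LBINT \<xi>::real^'n. stable \<theta> t \<xi>)"
  have int: "integrable lborel ?f"
  proof (rule Bochner_Integration.integrable_bound)
    show "integrable lborel (\<lambda>y::real^'n. ?B * Gamma_frac \<theta> y s)"
      by (intro integrable_mult_right Gamma_frac_integrable s th)
    show "AE y in lborel. norm (?f y) \<le> norm (?B * Gamma_frac \<theta> y s)"
    proof (rule AE_I2)
      fix y
      have "\<bar>Gamma_frac \<theta> ((x - z) - y) t\<bar> \<le> \<bar>?B\<bar>" using Gamma_frac_abs_le[OF t th(1), of "(x - z) - y"] by linarith
      then show "norm (?f y) \<le> norm (?B * Gamma_frac \<theta> y s)"
        unfolding real_norm_def abs_mult[of _ "Gamma_frac \<theta> y s"] by (rule mult_right_mono) simp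
    qed
  qed measurable
  have "(\<integral>\<^sup>+y. ennreal (Gamma_frac \<theta> (x - y) t) * ennreal (Gamma_frac \<theta> (y - z) s) \<partial>lborel)
    = (\<integral>\<^sup>+y. ennreal (Gamma_frac \<theta> (x - (z + y)) t) * ennreal (Gamma_frac \<theta> ((z + y) - z) s) \<partial>lborel)"
    by (subst nn_integral_lborel_affine[where c=1 and a=z]) auto
  also have "\<dots> = (\<integral>\<^sup>+y. ennreal (?f y) \<partial>lborel)"
    by (intro nn_integral_cong) (simp add: ennreal_mult[symmetric] Gamma_frac_nonneg[OF s th] Gamma_frac_nonneg[OF t th] algebra_simps)
  also have "\<dots> = ennreal (LBINT y. ?f y)"
    by (rule nn_integral_eq_integral[OF int]) (use nn in auto)
  also have "(LBINT y. ?f y) = Gamma_frac \<theta> (x - z) (t + s)"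
    by (rule Gamma_frac_convolution[OF assms])
  finally show ?thesis .
qed

text \<open>Split at |y| = t^(1/\<theta>): inside, the sup bound of the kernel meets the local
  integrability of the power (b < N); outside, the power is at most its value at that radius and the
  kernel has mass one. Both parts scale as t^(-b/\<theta>), uniformly in \<open>x\<close>.\<close>

lemma Gamma_frac_negative_moment:
  assumes th: "0 < \<theta>" "\<theta> \<le> 2" and b: "0 < b" "b < real CARD('n)"
  obtains C where "C > 0" "\<And>t (x::real^'n). t > 0 \<Longrightarrow>
     (\<integral>\<^sup>+y. ennreal (Gamma_frac \<theta> (x - y) t) * ennreal (norm y powr (-b)) \<partial>lborel) \<le> ennreal (C * t powr (- b / \<theta>))"
proof -
  obtain A where A: "A > 0" "\<And>t (x::real^'n). t > 0 \<Longrightarrow> Gamma_frac \<theta> x t \<le> A * t powr (- real CARD('n) / \<theta>)"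
    using Gamma_frac_bounded[OF th(1), where 'n='n] by blast
  obtain C1 where C1: "C1 > 0" "\<And>r. r > 0 \<Longrightarrow>
      (\<integral>\<^sup>+x. ennreal (norm (x::real^'n) powr (-b)) * indicator (ball 0 r) x \<partial>lborel) \<le> ennreal (C1 * r powr (real DIM(real^'n) - b))"
    using nn_integral_norm_powr_ball[of b, where 'a="real^'n"] b by auto
  have "(\<integral>\<^sup>+y. ennreal (Gamma_frac \<theta> (x - y) t) * ennreal (norm y powr (-b)) \<partial>lborel) \<le> ennreal ((A * C1 + 1) * t powr (- b / \<theta>))"
    if t: "t > 0" for t and x :: "real^'n"
  proof -
    define r where "r = t powr (1 / \<theta>)"
    have r: "r > 0" using t by (simp add: r_def)
    let ?a = "A * t powr (- real CARD('n) / \<theta>)"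
    have G0: "Gamma_frac \<theta> z t \<ge> 0" for z :: "real^'n" by (rule Gamma_frac_nonneg[OF t th])
    have "(\<integral>\<^sup>+y. ennreal (Gamma_frac \<theta> (x - y) t) * ennreal (norm y powr (-b)) \<partial>lborel)
      \<le> (\<integral>\<^sup>+y. ennreal ?a * (ennreal (norm y powr (-b)) * indicator (ball 0 r) y) + ennreal (r powr (-b)) * ennreal (Gamma_frac \<theta> (x - y) t) \<partial>lborel)"
    proof (rule nn_integral_mono)
      fix y :: "real^'n"
      show "ennreal (Gamma_frac \<theta> (x - y) t) * ennreal (norm y powr (-b))
        \<le> ennreal ?a * (ennreal (norm y powr (-b)) * indicator (ball 0 r) y) + ennreal (r powr (-b)) * ennreal (Gamma_frac \<theta> (x - y) t)"
      proof (cases "norm y < r")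
        case True
        have "ennreal (Gamma_frac \<theta> (x - y) t) * ennreal (norm y powr (-b)) \<le> ennreal ?a * ennreal (norm y powr (-b))"
          using A(2)[OF t] by (intro mult_right_mono ennreal_leI) auto
        then show ?thesis using True by (simp add: add_increasing2)
      next
        case False
        have "norm y powr (-b) \<le> r powr (-b)"
          using False r b by (intro powr_mono2') auto
        then have "ennreal (Gamma_frac \<theta> (x - y) t) * ennreal (norm y powr (-b)) \<le> ennreal (Gamma_frac \<theta> (x - y) t) * ennreal (r powr (-b))"
          by (intro mult_left_mono ennreal_leI) auto
        then show ?thesis by (simp add: add_increasing mult.commute)
      qed
    qed
    also have "\<dots> = ennreal ?a * (\<integral>\<^sup>+y. ennreal (norm (y::real^'n) powr (-b)) * indicator (ball 0 r) y \<partial>lborel)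
        + ennreal (r powr (-b)) * (\<integral>\<^sup>+y. ennreal (Gamma_frac \<theta> (x - y) t) \<partial>lborel)"
    proof -
      have m: "(\<lambda>y::real^'n. ennreal (norm y powr (-b)) * indicator (ball 0 r) y) \<in> borel_measurable lborel"
        by (intro borel_measurable_times_ennreal borel_measurable_indicator) auto
      have m': "(\<lambda>y. ennreal (Gamma_frac \<theta> (x - y) t)) \<in> borel_measurable lborel" by measurable
      show ?thesis
        by (subst nn_integral_add[OF borel_measurable_times_ennreal[OF borel_measurable_const m] borel_measurable_times_ennreal[OF borel_measurable_const m']])
           (simp only: nn_integral_cmult[OF m] nn_integral_cmult[OF m'])
    qed
    also have "\<dots> \<le> ennreal ?a * ennreal (C1 * r powr (real CARD('n) - b)) + ennreal (r powr (-b)) * 1"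
      using C1(2)[OF r] nn_integral_Gamma_frac[OF t th, of x] by (intro add_mono mult_left_mono) auto
    also have "\<dots> = ennreal (?a * (C1 * r powr (real CARD('n) - b)) + r powr (-b))"
      using A C1 by (simp add: ennreal_mult' ennreal_plus)
    also have "?a * (C1 * r powr (real CARD('n) - b)) + r powr (-b) = (A * C1 + 1) * t powr (- b / \<theta>)"
    proof -
      have 1: "r powr (-b) = t powr (- b / \<theta>)" by (simp add: r_def powr_powr)
      have "t powr (- real CARD('n) / \<theta>) * r powr (real CARD('n) - b) = t powr (- b / \<theta>)"
        by (simp add: r_def powr_powr powr_add[symmetric] diff_divide_distrib)
      then have "?a * (C1 * r powr (real CARD('n) - b)) = A * C1 * t powr (- b / \<theta>)"
        by (simp only: mult.assoc mult.left_commute[of "t powr (- real CARD('n) / \<theta>)" C1])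
      then show ?thesis unfolding 1 by (simp add: algebra_simps)
    qed
    finally show ?thesis .
  qed
  moreover have "A * C1 + 1 > 0" using A C1 by (simp add: add_pos_pos)
  ultimately show ?thesis using that by blast
qed

text \<open>Restrict r to [1/|v|, 2/|v|]: there r|v| lies in [1,2], inside [0,pi], so 1 - cos(rv) is
  at least 1 - cos 1. It converts powers into cosines, whose means under the kernel are known
  exactly.\<close>

lemma abs_powr_le_cos_integral:
  fixes a v :: real assumes a: "0 < a"
  shows "ennreal ((1 - cos 1) * 2 powr (-1-a) * \<bar>v\<bar> powr a)
     \<le> (\<integral>\<^sup>+r. ennreal ((1 - cos (r * v)) * r powr (-1-a)) * indicator {0<..} r \<partial>lborel)"
proof (cases "v = 0")
  case False
  let ?w = "\<bar>v\<bar>"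
  have w: "?w > 0" using False by simp
  have c1: "cos (1::real) < 1" using cos_monotone_0_pi[of 0 1] pi_gt3 by simp
  let ?c = "(1 - cos 1) * (2 / ?w) powr (-1-a)"
  have c0: "?c \<ge> 0" using c1 by simp
  have eq: "?c * (2 / ?w - 1 / ?w) = (1 - cos 1) * 2 powr (-1-a) * ?w powr a"
  proof -
    have "(2 / ?w) powr (-1-a) = 2 powr (-1-a) * ?w powr (1 + a)"
      using w by (simp add: powr_divide powr_diff powr_minus powr_add field_simps)
    moreover have "?w powr (1 + a) * (2 / ?w - 1 / ?w) = ?w powr a"
      using w by (simp add: powr_add field_simps)
    ultimately show ?thesis by (simp only: mult.assoc)
  qed
  have "ennreal ((1 - cos 1) * 2 powr (-1-a) * ?w powr a) = ennreal ?c * emeasure lborel {1/?w..2/?w}"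
  proof -
    have "1 / ?w \<le> 2 / ?w" using w by (simp add: divide_right_mono)
    then show ?thesis
      unfolding eq[symmetric] using c0 by (simp only: emeasure_lborel_Icc ennreal_mult diff_ge_0_iff_ge)
  qed
  also have "\<dots> = (\<integral>\<^sup>+r. ennreal ?c * indicator {1/?w..2/?w} r \<partial>lborel)"
    by (subst nn_integral_cmult_indicator) auto
  also have "\<dots> \<le> (\<integral>\<^sup>+r. ennreal ((1 - cos (r * v)) * r powr (-1-a)) * indicator {0<..} r \<partial>lborel)"
  proof (rule nn_integral_mono)
    fix r :: real
    show "ennreal ?c * indicator {1/?w..2/?w} r \<le> ennreal ((1 - cos (r * v)) * r powr (-1-a)) * indicator {0<..} r"
    proof (cases "r \<in> {1/?w..2/?w}")
      case True
      have r0: "r > 0" using True w by (smt (verit) atLeastAtMost_iff divide_pos_pos)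
      have r1: "1 \<le> r * ?w" "r * ?w \<le> 2" using True w by (auto simp: field_simps)
      have "cos (r * v) = cos \<bar>r * v\<bar>" by simp
      also have "\<bar>r * v\<bar> = r * ?w" using r0 by (simp add: abs_mult)
      also have "cos (r * ?w) \<le> cos 1"
        using r1 pi_gt3 by (intro cos_monotone_0_pi_le) auto
      finally have "cos (r * v) \<le> cos 1" .
      moreover have "(2 / ?w) powr (-1-a) \<le> r powr (-1-a)"
        using True a r0 by (intro powr_mono2') auto
      ultimately have "?c \<le> (1 - cos (r * v)) * r powr (-1-a)"
        using c1 by (intro mult_mono) auto
      then show ?thesis using True r0 by (simp add: ennreal_leI)
    qed simp
  qed
  finally show ?thesis .
qed simp

text \<open>Compares the norm with the largest coordinate, since the cosine integral controls one
  coordinate at a time.\<close>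

lemma norm_powr_le_sum:
  fixes x :: "'a::euclidean_space" assumes a: "0 < a"
  shows "norm x powr a \<le> real DIM('a) powr a * (\<Sum>b\<in>Basis. \<bar>x \<bullet> b\<bar> powr a)"
proof -
  obtain b where b: "b \<in> Basis" "\<And>b'. b' \<in> Basis \<Longrightarrow> \<bar>x \<bullet> b'\<bar> \<le> \<bar>x \<bullet> b\<bar>"
  proof -
    have "Max ((\<lambda>b. \<bar>x \<bullet> b\<bar>) ` Basis) \<in> (\<lambda>b. \<bar>x \<bullet> b\<bar>) ` Basis" by (intro Max_in) auto
    then obtain b where "b \<in> Basis" "Max ((\<lambda>b. \<bar>x \<bullet> b\<bar>) ` Basis) = \<bar>x \<bullet> b\<bar>" by (metis (no_types, lifting) imageE)
    then show ?thesis using that[of b] by (metis (no_types, lifting) Max_ge finite_Basis finite_imageI image_eqI)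
  qed
  have "norm x \<le> (\<Sum>b\<in>Basis. \<bar>x \<bullet> b\<bar>)" by (rule norm_le_l1)
  also have "\<dots> \<le> real DIM('a) * \<bar>x \<bullet> b\<bar>" using b(2) by (rule sum_bounded_above)
  finally have "norm x powr a \<le> (real DIM('a) * \<bar>x \<bullet> b\<bar>) powr a"
    using a by (intro powr_mono2) auto
  also have "\<dots> = real DIM('a) powr a * \<bar>x \<bullet> b\<bar> powr a" by (simp add: powr_mult)
  also have "\<bar>x \<bullet> b\<bar> powr a \<le> (\<Sum>b\<in>Basis. \<bar>x \<bullet> b\<bar> powr a)"
    using b(1) by (intro member_le_sum) auto
  finally show ?thesis by (simp add: mult_left_mono)
qed

text \<open>The mean of 1 - cos(r y.b) under the kernel is 1 - exp(-t r^\<theta>) for a unit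
  coordinate vector b. Integrated against r^(-1-a) this converges at r = 0 because a < \<theta>, and
  dilation in r produces t^(a/\<theta>).\<close>

lemma Gamma_frac_moment:
  assumes th: "0 < \<theta>" "\<theta> \<le> 2" and a: "0 < a" "a < \<theta>"
  obtains C where "C > 0" "\<And>t. t > 0 \<Longrightarrow>
     (\<integral>\<^sup>+y. ennreal (Gamma_frac \<theta> (y::real^'n) t) * ennreal (norm y powr a) \<partial>lborel) \<le> ennreal (C * t powr (a / \<theta>))"
proof -
  define c0 where "c0 = (1 - cos 1) * 2 powr (-1-a)"
  have c0: "c0 > 0" using cos_monotone_0_pi[of 0 1] pi_gt3 by (simp add: c0_def)
  let ?J = "(\<integral>\<^sup>+s. ennreal ((1 - exp (- (s powr \<theta>))) * s powr (-1-a)) * indicator {0<..} s \<partial>lborel)"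
  have "1 - exp (- x) \<le> x" for x :: real using exp_ge_add_one_self[of "-x"] by linarith
  then have "?J < \<infinity>"
    by (intro nn_integral_powr_weight_finite[where p=\<theta> and A=1 and B=1]) (use a in auto)
  then obtain J where J: "?J = ennreal J" "J \<ge> 0" by (cases ?J) auto
  have coord: "(\<integral>\<^sup>+y. ennreal (Gamma_frac \<theta> (y::real^'n) t) * ennreal (\<bar>y \<bullet> b\<bar> powr a) \<partial>lborel) \<le> ennreal (J / c0 * t powr (a / \<theta>))"
    if t: "t > 0" and b: "b \<in> Basis" for t and b :: "real^'n"
  proof -
    let ?G = "\<lambda>y::real^'n. Gamma_frac \<theta> y t"
    have G0: "?G y \<ge> 0" for y by (rule Gamma_frac_nonneg[OF t th])
    have Gcos: "(\<integral>\<^sup>+y. ennreal (?G y * (1 - cos (r * (y \<bullet> b)))) \<partial>lborel) = ennreal (1 - exp (- t * r powr \<theta>))" if r: "r > 0" for r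
    proof -
      have i1: "integrable lborel ?G" by (rule Gamma_frac_integrable[OF t th])
      have i2: "integrable lborel (\<lambda>y. ?G y * cos ((r *\<^sub>R b) \<bullet> y))"
        by (rule Bochner_Integration.integrable_bound[OF i1]) (auto simp: abs_mult mult_left_le)
      have eq: "?G y * (1 - cos (r * (y \<bullet> b))) = ?G y - ?G y * cos ((r *\<^sub>R b) \<bullet> y)" for y
        by (simp add: algebra_simps inner_commute)
      have "(LBINT y. ?G y) = 1" using Gamma_frac_fourier[OF t th, of 0] th by simp
      then have I: "(LBINT y. ?G y * (1 - cos (r * (y \<bullet> b)))) = 1 - exp (- t * r powr \<theta>)"
        unfolding eq using r b by (subst Bochner_Integration.integral_diff[OF i1 i2])
            (simp add: Gamma_frac_fourier[OF t th, of "r *\<^sub>R b"] del: inner_scaleR_left)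
      have "integrable lborel (\<lambda>y. ?G y * (1 - cos (r * (y \<bullet> b))))"
        unfolding eq by (intro Bochner_Integration.integrable_diff i1 i2)
      then show ?thesis unfolding I[symmetric]
        by (rule nn_integral_eq_integral) (use G0 in auto)
    qed
    have "ennreal c0 * (\<integral>\<^sup>+y. ennreal (?G y) * ennreal (\<bar>y \<bullet> b\<bar> powr a) \<partial>lborel) = (\<integral>\<^sup>+y. ennreal (?G y) * ennreal (c0 * \<bar>y \<bullet> b\<bar> powr a) \<partial>lborel)"
      using c0 by (subst nn_integral_cmult[symmetric]) (auto simp: ennreal_mult' mult_ac)
    also have "\<dots> \<le> (\<integral>\<^sup>+y. ennreal (?G y) * (\<integral>\<^sup>+r. ennreal ((1 - cos (r * (y \<bullet> b))) * r powr (-1-a)) * indicator {0<..} r \<partial>lborel) \<partial>lborel)"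
      unfolding c0_def by (intro nn_integral_mono mult_left_mono abs_powr_le_cos_integral a) auto
    also have "\<dots> = (\<integral>\<^sup>+y. (\<integral>\<^sup>+r. ennreal (?G y * (1 - cos (r * (y \<bullet> b)))) * (ennreal (r powr (-1-a)) * indicator {0<..} r) \<partial>lborel) \<partial>lborel)"
    proof (intro nn_integral_cong)
      fix y
      have "ennreal (?G y) * (\<integral>\<^sup>+r. ennreal ((1 - cos (r * (y \<bullet> b))) * r powr (-1-a)) * indicator {0<..} r \<partial>lborel)
         = (\<integral>\<^sup>+r. ennreal (?G y) * (ennreal ((1 - cos (r * (y \<bullet> b))) * r powr (-1-a)) * indicator {0<..} r) \<partial>lborel)"
        by (rule nn_integral_cmult[symmetric]) measurable
      then show "ennreal (?G y) * (\<integral>\<^sup>+r. ennreal ((1 - cos (r * (y \<bullet> b))) * r powr (-1-a)) * indicator {0<..} r \<partial>lborel)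
        = (\<integral>\<^sup>+r. ennreal (?G y * (1 - cos (r * (y \<bullet> b)))) * (ennreal (r powr (-1-a)) * indicator {0<..} r) \<partial>lborel)"
        using G0[of y] by (simp add: ennreal_mult' ennreal_mult'' mult.assoc)
    qed
    also have "\<dots> = (\<integral>\<^sup>+r. (\<integral>\<^sup>+y. ennreal (?G y * (1 - cos (r * (y \<bullet> b)))) * (ennreal (r powr (-1-a)) * indicator {0<..} r) \<partial>lborel) \<partial>lborel)"
      by (rule lborel_pair.Fubini'[symmetric]) measurable
    also have "\<dots> = (\<integral>\<^sup>+r. ennreal ((1 - exp (- ((t powr (1/\<theta>) * r) powr \<theta>))) * r powr (-1-a)) * indicator {0<..} r \<partial>lborel)"
    proof (intro nn_integral_cong)
      fix r :: real
      have "(\<integral>\<^sup>+y. ennreal (?G y * (1 - cos (r * (y \<bullet> b)))) * (ennreal (r powr (-1-a)) * indicator {0<..} r) \<partial>lborel)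
        = (\<integral>\<^sup>+y. ennreal (?G y * (1 - cos (r * (y \<bullet> b)))) \<partial>lborel) * (ennreal (r powr (-1-a)) * indicator {0<..} r)"
        by (rule nn_integral_multc) measurable
      also have "\<dots> = ennreal ((1 - exp (- ((t powr (1/\<theta>) * r) powr \<theta>))) * r powr (-1-a)) * indicator {0<..} r"
      proof (cases "r > 0")
        case True
        have "(t powr (1/\<theta>) * r) powr \<theta> = t * r powr \<theta>"
          using t th by (simp add: powr_mult powr_powr)
        then show ?thesis unfolding Gcos[OF True] using True by (simp add: ennreal_mult'')
      qed simp
      finally show "(\<integral>\<^sup>+y. ennreal (?G y * (1 - cos (r * (y \<bullet> b)))) * (ennreal (r powr (-1-a)) * indicator {0<..} r) \<partial>lborel)
        = ennreal ((1 - exp (- ((t powr (1/\<theta>) * r) powr \<theta>))) * r powr (-1-a)) * indicator {0<..} r" .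
    qed
    also have "\<dots> = ennreal ((t powr (1/\<theta>)) powr a) * ?J"
      using t by (intro nn_integral_powr_weight_scale[where w="\<lambda>s. 1 - exp (- (s powr \<theta>))"]) auto
    also have "\<dots> = ennreal c0 * ennreal (J / c0 * t powr (a / \<theta>))"
      unfolding J(1) using c0 J(2) by (simp add: ennreal_mult[symmetric] powr_powr mult_ac)
    finally show ?thesis using c0 by (simp add: ennreal_mult_le_mult_iff)
  qed
  define C where "C = real CARD('n) powr a * (real CARD('n) * (J / c0)) + 1"
  have "C > 0" unfolding C_def using c0 J by (intro add_nonneg_pos) auto
  moreover have "(\<integral>\<^sup>+y. ennreal (Gamma_frac \<theta> (y::real^'n) t) * ennreal (norm y powr a) \<partial>lborel) \<le> ennreal (C * t powr (a / \<theta>))"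
    if t: "t > 0" for t
  proof -
    let ?G = "\<lambda>y::real^'n. Gamma_frac \<theta> y t"
    let ?K = "real CARD('n) powr a"
    have "(\<integral>\<^sup>+y. ennreal (?G y) * ennreal (norm y powr a) \<partial>lborel)
       \<le> (\<integral>\<^sup>+y. ennreal ?K * (\<Sum>b\<in>Basis. ennreal (?G y) * ennreal (\<bar>y \<bullet> b\<bar> powr a)) \<partial>lborel)"
    proof (rule nn_integral_mono)
      fix y :: "real^'n"
      have "ennreal (norm y powr a) \<le> ennreal (?K * (\<Sum>b\<in>Basis. \<bar>y \<bullet> b\<bar> powr a))"
        using norm_powr_le_sum[OF a(1), of y] by (intro ennreal_leI) simp
      also have "\<dots> = ennreal ?K * (\<Sum>b\<in>Basis. ennreal (\<bar>y \<bullet> b\<bar> powr a))"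
        by (simp add: ennreal_mult sum_nonneg sum_ennreal)
      finally have "ennreal (?G y) * ennreal (norm y powr a) \<le> ennreal (?G y) * (ennreal ?K * (\<Sum>b\<in>Basis. ennreal (\<bar>y \<bullet> b\<bar> powr a)))"
        by (rule mult_left_mono) simp
      then show "ennreal (?G y) * ennreal (norm y powr a) \<le> ennreal ?K * (\<Sum>b\<in>Basis. ennreal (?G y) * ennreal (\<bar>y \<bullet> b\<bar> powr a))"
        by (simp only: sum_distrib_left mult.left_commute[of "ennreal (?G y)"])
    qed
    also have "\<dots> = ennreal ?K * (\<Sum>b\<in>Basis. (\<integral>\<^sup>+y. ennreal (?G y) * ennreal (\<bar>y \<bullet> b\<bar> powr a) \<partial>lborel))"
      by (subst nn_integral_cmult, measurable, subst nn_integral_sum) auto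
    also have "\<dots> \<le> ennreal ?K * (\<Sum>b\<in>(Basis::(real^'n) set). ennreal (J / c0 * t powr (a / \<theta>)))"
      by (intro mult_left_mono sum_mono coord[OF t]) auto
    also have "\<dots> = ennreal (?K * (real CARD('n) * (J / c0 * t powr (a / \<theta>))))"
    proof -
      have "ennreal ?K * (of_nat CARD('n) * ennreal z) = ennreal (?K * (real CARD('n) * z))" if "z \<ge> 0" for z
        using that by (simp add: ennreal_mult ennreal_of_nat_eq_real_of_nat)
      moreover have "J / c0 * t powr (a / \<theta>) \<ge> 0" using J(2) c0 by simp
      ultimately show ?thesis by simp
    qed
    also have "\<dots> \<le> ennreal (C * t powr (a / \<theta>))"
      unfolding C_def by (intro ennreal_leI) (simp add: algebra_simps)
    finally show ?thesis .
  qed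
  ultimately show ?thesis using that by blast
qed

section \<open>The nonlinearity\<close>

locale admissible =
  fixes f :: "real \<Rightarrow> real"
  assumes M: "hyp_M f" and S: "hyp_S f" and L: "hyp_L f"
begin

abbreviation F :: "real \<Rightarrow> real" where "F \<equiv> Ffun f"

lemma f_cont: "continuous_on {0..} f" and f_mono: "0 \<le> u \<Longrightarrow> u \<le> v \<Longrightarrow> f u \<le> f v"
  and f_pos: "u > 0 \<Longrightarrow> f u > 0"
  using M by (auto simp: hyp_M_def mono_on_def)

lemma f_cont_pos: "continuous_on A f" if "\<And>u. u \<in> A \<Longrightarrow> u > 0"
proof (rule continuous_on_subset[OF f_cont], rule subsetI)
  fix u assume "u \<in> A"
  from that[OF this] show "u \<in> {0..}" by simp
qed

lemma inv_f_cont: "0 < a \<Longrightarrow> continuous_on {a..b} (\<lambda>s. 1 / f s)"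
proof (intro continuous_intros f_cont_pos)
  fix s assume "0 < a" "s \<in> {a..b}"
  then show "s > 0" by simp
next
  assume "0 < a"
  then show "\<forall>s\<in>{a..b}. f s \<noteq> 0" using f_pos by (metis atLeastAtMost_iff less_le_trans less_numeral_extra(3))
qed

text \<open>The derivative is asked for strictly beyond \<open>tau\<close>: at the endpoint the
  hypothesis on f gives only a one-sided derivative, whereas \<open>deriv f\<close>, in which the
  limit q is stated, is two-sided.\<close>

definition tau :: real where
  "tau = (SOME \<tau>. \<tau> > 0 \<and> (\<forall>u>\<tau>. (f has_real_derivative deriv f u) (at u)) \<and> (\<lambda>s. 1 / f s) integrable_on {\<tau>..})"

lemma tau: "tau > 0" "u > tau \<Longrightarrow> (f has_real_derivative deriv f u) (at u)" "(\<lambda>s. 1 / f s) integrable_on {tau..}"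
proof -
  have "\<exists>\<tau>. \<tau> > 0 \<and> (\<forall>u>\<tau>. (f has_real_derivative deriv f u) (at u)) \<and> (\<lambda>s. 1 / f s) integrable_on {\<tau>..}"
  proof -
    obtain \<tau> f' where \<tau>: "\<tau> > 0" "\<And>u. u \<ge> \<tau> \<Longrightarrow> (f has_real_derivative f' u) (at u within {\<tau>..})"
       "(\<lambda>s. 1 / f s) integrable_on {\<tau>..}"
      using S unfolding hyp_S_def by blast
    have "(f has_real_derivative deriv f u) (at u)" if "u > \<tau>" for u
    proof -
      have "at u within {\<tau>..} = at u" using that by (intro at_within_interior) (auto simp: interior_Ici[of "\<tau> - 1"])
      then have "(f has_real_derivative f' u) (at u)" using \<tau>(2)[of u] that by simp
      then show ?thesis by (simp add: DERIV_imp_deriv)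
    qed
    then show ?thesis using \<tau> by blast
  qed
  from someI_ex[OF this] show "tau > 0" "u > tau \<Longrightarrow> (f has_real_derivative deriv f u) (at u)" "(\<lambda>s. 1 / f s) integrable_on {tau..}"
    unfolding tau_def by auto
qed

section \<open>The transform F: derivative, monotonicity and range\<close>

lemma inv_f_abs_integrable:
  assumes "u > 0" shows "set_integrable lebesgue {u..} (\<lambda>s. 1 / f s)"
proof -
  let ?m = "min u tau"
  have m: "?m > 0" using assms tau(1) by simp
  have nn: "0 \<le> 1 / f s" if "s \<ge> ?m" for s using f_pos[of s] that m by simp
  have "set_integrable lebesgue {?m..tau} (\<lambda>s. 1 / f s)"
    by (rule nonnegative_absolutely_integrable_1[OF integrable_continuous_real[OF inv_f_cont[OF m]]])
       (use nn in auto)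
  moreover have "set_integrable lebesgue {tau..} (\<lambda>s. 1 / f s)"
    by (rule nonnegative_absolutely_integrable_1[OF tau(3)]) (use nn in auto)
  ultimately have "set_integrable lebesgue ({?m..tau} \<union> {tau..}) (\<lambda>s. 1 / f s)"
    by (intro set_integrable_Un) auto
  then show ?thesis by (rule set_integrable_subset) auto
qed

lemma inv_f_integrable: "u > 0 \<Longrightarrow> (\<lambda>s. 1 / f s) integrable_on {u..}"
  by (rule set_lebesgue_integral_eq_integral(1)[OF inv_f_abs_integrable])

lemma F_split:
  assumes "0 < u" "u \<le> v" shows "F u = integral {u..v} (\<lambda>s. 1 / f s) + F v"
proof -
  have "((\<lambda>s. 1 / f s) has_integral (integral {u..v} (\<lambda>s. 1 / f s) + F v)) ({u..v} \<union> {v..})"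
  proof (rule has_integral_Un)
    show "((\<lambda>s. 1 / f s) has_integral integral {u..v} (\<lambda>s. 1 / f s)) {u..v}"
      using integrable_continuous_real[OF inv_f_cont[OF assms(1)]] by (rule integrable_integral)
    show "((\<lambda>s. 1 / f s) has_integral F v) {v..}"
      unfolding Ffun_def using inv_f_integrable[of v] assms by (intro integrable_integral) auto
    have "{u..v} \<inter> {v..} \<subseteq> {v}" by auto
    then show "negligible ({u..v} \<inter> {v..})" by (rule negligible_subset[OF negligible_sing])
  qed
  moreover have "{u..v} \<union> {v..} = {u..}" using assms by auto
  ultimately show ?thesis unfolding Ffun_def[of f u] by (simp add: integral_unique)
qed

lemma F_has_derivative:
  assumes "u > 0" shows "(F has_real_derivative - 1 / f u) (at u)"
proof -
  let ?a = "u / 2" and ?b = "u + 1"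
  have a: "?a > 0" using assms by simp
  have "((\<lambda>x. integral {?a..x} (\<lambda>s. 1 / f s)) has_real_derivative 1 / f u) (at u within {?a..?b})"
    by (rule integral_has_real_derivative[OF inv_f_cont[OF a]]) (use assms in auto)
  moreover have "at u within {?a..?b} = at u" using assms by (intro at_within_interior) auto
  ultimately have "((\<lambda>x. integral {?a..x} (\<lambda>s. 1 / f s)) has_real_derivative 1 / f u) (at u)" by simp
  then have "((\<lambda>x. F ?a - integral {?a..x} (\<lambda>s. 1 / f s)) has_real_derivative 0 - 1 / f u) (at u)"
    by (intro DERIV_diff DERIV_const)
  then have "((\<lambda>x. F ?a - integral {?a..x} (\<lambda>s. 1 / f s)) has_real_derivative - 1 / f u) (at u)" by simp
  then show ?thesis
  proof (rule has_field_derivative_transform_within_open)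
    show "open {?a<..}" "u \<in> {?a<..}" using assms by auto
    show "F ?a - integral {?a..x} (\<lambda>s. 1 / f s) = F x" if "x \<in> {?a<..}" for x
      using F_split[OF a, of x] that by simp
  qed
qed

text \<open>On [u,v] the integrand 1/f is at least 1/f(v). Read as a time, it says that the equation
  w' = f(w) needs at least (v-u)/f(v) to climb from u to v; this form drives the blow-up
  estimate.\<close>

lemma F_diff_ge:
  assumes "0 < u" "u \<le> v" shows "(v - u) / f v \<le> F u - F v"
proof -
  have I: "F u - F v = integral {u..v} (\<lambda>s. 1 / f s)" using F_split[OF assms] by simp
  have int: "(\<lambda>s. 1 / f s) integrable_on {u..v}" by (rule integrable_continuous_real[OF inv_f_cont[OF assms(1)]])
  have "integral {u..v} (\<lambda>s. 1 / f v) \<le> integral {u..v} (\<lambda>s. 1 / f s)"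
    using assms by (intro integral_le int integrable_const_ivl) (auto intro!: divide_left_mono f_mono mult_pos_pos f_pos)
  then show ?thesis unfolding I using assms by simp
qed

lemma F_strict_antimono:
  assumes "0 < u" "u < v" shows "F v < F u"
proof -
  have "0 < (v - u) / f v" using assms f_pos[of v] by simp
  then show ?thesis using F_diff_ge[of u v] assms by simp
qed

lemma F_antimono: "0 < u \<Longrightarrow> u \<le> v \<Longrightarrow> F v \<le> F u"
  using F_strict_antimono[of u v] by (cases "u = v") auto

lemma F_nonneg: "u > 0 \<Longrightarrow> F u \<ge> 0"
  unfolding Ffun_def using f_pos less_le_trans by (intro integral_nonneg inv_f_integrable) (auto intro!: less_imp_le)

lemma F_pos: "u > 0 \<Longrightarrow> F u > 0"
  using F_strict_antimono[of u "u + 1"] F_nonneg[of "u + 1"] by simp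

lemma F_le_iff: "0 < u \<Longrightarrow> 0 < v \<Longrightarrow> F v \<le> F u \<longleftrightarrow> u \<le> v"
  using F_antimono[of u v] F_strict_antimono[of v u] by (meson not_le)

lemma F_tendsto_0: "(F \<longlongrightarrow> 0) at_top"
proof -
  let ?g = "\<lambda>s. 1 / f s"
  have "((\<lambda>b. LINT x:{1..b}|lebesgue. ?g x) \<longlongrightarrow> (LINT x:{1..}|lebesgue. ?g x)) at_top"
    by (rule tendsto_set_lebesgue_integral_at_top[OF _ inv_f_abs_integrable]) auto
  moreover have "(LINT x:{1..}|lebesgue. ?g x) = F 1"
    unfolding Ffun_def by (rule set_lebesgue_integral_eq_integral(2)[OF inv_f_abs_integrable]) simp
  moreover have *: "(LINT x:{1..b}|lebesgue. ?g x) = F 1 - F b" if "b \<ge> 1" for b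
  proof -
    have "set_integrable lebesgue {1..b} ?g"
      by (rule set_integrable_subset[OF inv_f_abs_integrable[of 1]]) auto
    then have "(LINT x:{1..b}|lebesgue. ?g x) = integral {1..b} ?g"
      by (rule set_lebesgue_integral_eq_integral(2))
    then show ?thesis using F_split[of 1 b] that by simp
  qed
  moreover have "eventually (\<lambda>b. (LINT x:{1..b}|lebesgue. ?g x) = F 1 - F b) at_top"
    using eventually_ge_at_top[of 1] by eventually_elim (rule *)
  ultimately have "((\<lambda>b. F 1 - F b) \<longlongrightarrow> F 1) at_top"
    by (simp only: tendsto_cong)
  then have "((\<lambda>b. F 1 - (F 1 - F b)) \<longlongrightarrow> F 1 - F 1) at_top"
    by (intro tendsto_diff tendsto_const)
  then show ?thesis by simp
qed

lemma F_surj: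
  assumes "0 < a" "0 < y" "y \<le> F a" obtains u where "u \<ge> a" "F u = y"
proof -
  have "eventually (\<lambda>u. F u < y) at_top" using order_tendstoD(2)[OF F_tendsto_0] assms by blast
  then obtain c where "\<And>u. u \<ge> c \<Longrightarrow> F u < y" by (auto simp: eventually_at_top_linorder)
  then obtain b where b: "b \<ge> a" "F b < y" using that by (meson max.cobounded1 max.cobounded2)
  have "continuous_on {a..b} F"
  proof (rule DERIV_continuous_on)
    fix x assume "x \<in> {a..b}"
    then show "(F has_real_derivative - 1 / f x) (at x within {a..b})"
      using assms(1) by (intro has_field_derivative_at_within[OF F_has_derivative]) auto
  qed
  then have "\<exists>u. a \<le> u \<and> u \<le> b \<and> F u = y"
    using IVT2'[of F b y a] b assms by auto
  then show ?thesis using that by blast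
qed

section \<open>The limit q and the monotonicity of f F^\<kappa>\<close>

definition q :: real where "q = q_f f"

lemma q_tendsto: "((\<lambda>u. deriv f u * F u) \<longlongrightarrow> q) at_top"
proof -
  obtain q' where q': "((\<lambda>u. deriv f u * F u) \<longlongrightarrow> q') at_top" using L by (auto simp: hyp_L_def)
  then have "q = q'" unfolding q_def q_f_def by (intro tendsto_Lim) auto
  then show ?thesis using q' by simp
qed

lemma fF_powr_has_derivative:
  assumes "u > tau"
  shows "((\<lambda>u. f u * F u powr k) has_real_derivative F u powr (k - 1) * (deriv f u * F u - k)) (at u)"
proof -
  have u: "u > 0" using assms tau(1) by simp
  have Fu: "F u > 0" by (rule F_pos[OF u])
  have fu: "f u > 0" by (rule f_pos[OF u])
  have "((\<lambda>u. F u powr k) has_real_derivative (k * F u powr (k - 1) * (- 1 / f u))) (at u)"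
    using DERIV_fun_powr[OF F_has_derivative[OF u] Fu, of k] by simp
  from DERIV_mult[OF tau(2)[OF assms] this]
  have "((\<lambda>u. f u * F u powr k) has_real_derivative deriv f u * F u powr k + (k * F u powr (k - 1) * (- 1 / f u)) * f u) (at u)" .
  also have "deriv f u * F u powr k + (k * F u powr (k - 1) * (- 1 / f u)) * f u = F u powr (k - 1) * (deriv f u * F u - k)"
  proof -
    have "F u powr k = F u powr (k - 1) * F u" using Fu by (simp add: powr_diff)
    then show ?thesis using fu by (simp add: algebra_simps)
  qed
  finally show ?thesis .
qed

lemma fF_powr_eventually_mono:
  assumes "k < q" obtains a where "a > tau" "\<And>u v. a \<le> u \<Longrightarrow> u \<le> v \<Longrightarrow> f u * F u powr k \<le> f v * F v powr k"
proof -
  have "eventually (\<lambda>u. deriv f u * F u > k) at_top" using order_tendstoD(1)[OF q_tendsto assms] .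
  then obtain b where b: "\<And>u. u \<ge> b \<Longrightarrow> deriv f u * F u > k" by (auto simp: eventually_at_top_linorder)
  define a where "a = max b (tau + 1)"
  have "f u * F u powr k \<le> f v * F v powr k" if "a \<le> u" "u \<le> v" for u v
  proof (rule DERIV_nonneg_imp_nondecreasing[OF that(2)])
    fix x assume "u \<le> x" "x \<le> v"
    then have x: "x > tau" "x \<ge> b" using that by (auto simp: a_def)
    show "\<exists>y. ((\<lambda>u. f u * F u powr k) has_real_derivative y) (at x) \<and> 0 \<le> y"
      using fF_powr_has_derivative[OF x(1), of k] b[OF x(2)] by (intro exI conjI) (auto intro!: mult_nonneg_nonneg)
  qed
  moreover have "a > tau" by (simp add: a_def)
  ultimately show ?thesis using that by blast
qed

lemma fF_powr_eventually_antimono: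
  assumes "k > q" obtains a where "a > tau" "\<And>u v. a \<le> u \<Longrightarrow> u \<le> v \<Longrightarrow> f v * F v powr k \<le> f u * F u powr k"
proof -
  have "eventually (\<lambda>u. deriv f u * F u < k) at_top" using order_tendstoD(2)[OF q_tendsto assms] .
  then obtain b where b: "\<And>u. u \<ge> b \<Longrightarrow> deriv f u * F u < k" by (auto simp: eventually_at_top_linorder)
  define a where "a = max b (tau + 1)"
  have "f v * F v powr k \<le> f u * F u powr k" if "a \<le> u" "u \<le> v" for u v
  proof (rule DERIV_nonpos_imp_nonincreasing[OF that(2)])
    fix x assume "u \<le> x" "x \<le> v"
    then have x: "x > tau" "x \<ge> b" using that by (auto simp: a_def)
    show "\<exists>y. ((\<lambda>u. f u * F u powr k) has_real_derivative y) (at x) \<and> y \<le> 0"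
      using fF_powr_has_derivative[OF x(1), of k] b[OF x(2)] by (intro exI conjI) (auto intro!: mult_nonneg_nonpos)
  qed
  moreover have "a > tau" by (simp add: a_def)
  ultimately show ?thesis using that by blast
qed

text \<open>The exponent \<kappa> = 1: the derivative of f F is f' F - 1, so a limit below 1 would
  make f F decrease at least linearly and eventually become negative.\<close>

lemma q_ge_1: "q \<ge> 1"
proof (rule ccontr)
  assume "\<not> q \<ge> 1"
  then have q1: "q < 1" by simp
  define c where "c = (1 - q) / 2"
  have c: "c > 0" "q < 1 - c" using q1 by (auto simp: c_def field_simps)
  have "eventually (\<lambda>u. deriv f u * F u < 1 - c) at_top" using order_tendstoD(2)[OF q_tendsto c(2)] .
  then obtain b where b: "\<And>u. u \<ge> b \<Longrightarrow> deriv f u * F u < 1 - c" by (auto simp: eventually_at_top_linorder)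
  define a where "a = max b (tau + 1)"
  have a: "a > tau" "a > 0" using tau(1) by (auto simp: a_def)
  have le: "f v * F v powr 1 + c * v \<le> f a * F a powr 1 + c * a" if "a \<le> v" for v
  proof (rule DERIV_nonpos_imp_nonincreasing[OF that, of "\<lambda>v. f v * F v powr 1 + c * v"])
    fix x assume "a \<le> x" "x \<le> v"
    then have x: "x > tau" "x \<ge> b" by (auto simp: a_def)
    have Fx: "F x > 0" using x tau(1) by (intro F_pos) simp
    have "((\<lambda>v. f v * F v powr 1 + c * v) has_real_derivative F x powr (1 - 1) * (deriv f x * F x - 1) + c * 1) (at x)"
      by (intro DERIV_add fF_powr_has_derivative x DERIV_cmult DERIV_ident)
    moreover have "F x powr (1 - 1) * (deriv f x * F x - 1) + c * 1 \<le> 0" using b[OF x(2)] Fx by simp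
    ultimately show "\<exists>y. ((\<lambda>v. f v * F v powr 1 + c * v) has_real_derivative y) (at x) \<and> y \<le> 0" by blast
  qed
  \<comment> \<open>At this point the linear decrease c(v - a) exceeds the initial value of f F by
    1.\<close>
  define v where "v = a + (f a * F a powr 1 + 1) / c"
  have "f a * F a powr 1 \<ge> 0" using f_pos[OF a(2)] by simp
  then have v: "v \<ge> a" using c by (simp add: v_def)
  have "f v * F v powr 1 \<ge> 0" using f_pos[of v] v a by simp
  then have "c * v \<le> f a * F a powr 1 + c * a" using le[OF v] by simp
  moreover have "c * v = c * a + (f a * F a powr 1 + 1)" using c unfolding v_def distrib_left by simp
  ultimately show False by simp
qed

text \<open>The conjugate exponent is p = 1 + 1/(q-1), so p > 1 + \<theta>/N inverts to q - 1 <
  N/\<theta>. For q = 1, where p is infinite, the bound is immediate.\<close>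

lemma supercritical_q:
  assumes "supercritical \<theta> f N" "\<theta> > 0" "N > 0" shows "q - 1 < real N / \<theta>"
proof (cases "q = 1")
  case False
  then have q1: "q > 1" using q_ge_1 by simp
  have "1 + \<theta> / real N < q / (q - 1)"
    using assms(1) False by (simp add: supercritical_def p_f_def q_def[symmetric])
  moreover have "q / (q - 1) = 1 + 1 / (q - 1)" using q1 by (simp add: field_simps)
  ultimately have "\<theta> / real N < 1 / (q - 1)" by simp
  then show ?thesis using q1 assms by (simp add: field_simps)
qed (use assms in simp)

end

section \<open>The semigroup and the Duhamel term\<close>

text \<open>Values in [0,\<infinity>] let Tonelli and monotone convergence apply before anything is
  known to be finite; finiteness is recovered from a supersolution or from a given solution.\<close>

definition heat :: "real \<Rightarrow> real \<Rightarrow> (real^'n \<Rightarrow> ennreal) \<Rightarrow> real^'n \<Rightarrow> ennreal" where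
  "heat \<theta> t v x = (\<integral>\<^sup>+y. ennreal (Gamma_frac \<theta> (x - y) t) * v y \<partial>lborel)"

definition duhamel :: "real \<Rightarrow> ((real^'n) \<times> real \<Rightarrow> ennreal) \<Rightarrow> (real^'n) \<times> real \<Rightarrow> ennreal" where
  "duhamel \<theta> v z = (\<integral>\<^sup>+s. indicator {0<..<snd z} s * heat \<theta> (snd z - s) (\<lambda>y. v (y, s)) (fst z) \<partial>lborel)"

lemma heat_measurable_param[measurable (raw)]:
  assumes [measurable]: "t \<in> M \<rightarrow>\<^sub>M borel" "x \<in> M \<rightarrow>\<^sub>M borel" "(\<lambda>(m, y). v m y) \<in> borel_measurable (M \<Otimes>\<^sub>M borel)"
  shows "(\<lambda>m. heat \<theta> (t m) (v m) (x m :: real^'n)) \<in> borel_measurable M"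
  unfolding heat_def by measurable

lemma heat_measurable[measurable]:
  assumes [measurable]: "v \<in> borel_measurable borel"
  shows "(\<lambda>z. heat \<theta> (snd z) v (fst z :: real^'n)) \<in> borel_measurable borel"
  unfolding borel_prod[symmetric] by measurable

text \<open>The endpoint of the time interval varies with the point; written as two inequalities,
  the indicator is visibly measurable in the time variable and the endpoint jointly.\<close>

lemma indicator_Ioo_eq_if: "indicator {a<..<b} s = (if a < s \<and> s < b then 1 else 0)"
  by (simp add: indicator_def)

lemma duhamel_measurable[measurable]:
  fixes v :: "(real^'n) \<times> real \<Rightarrow> ennreal"
  assumes v: "v \<in> borel_measurable borel"
  shows "duhamel \<theta> v \<in> borel_measurable borel"
proof -
  have [measurable]: "v \<in> borel_measurable (borel \<Otimes>\<^sub>M borel)" using v by (simp add: borel_prod)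
  show ?thesis unfolding duhamel_def[abs_def] indicator_Ioo_eq_if borel_prod[symmetric] by measurable
qed

lemma heat_mono: "(\<And>y. v y \<le> w y) \<Longrightarrow> heat \<theta> t v x \<le> heat \<theta> t w x"
  unfolding heat_def by (intro nn_integral_mono mult_left_mono) auto

lemma heat_mono_AE: "(AE y in lborel. v y \<le> w y) \<Longrightarrow> heat \<theta> t v x \<le> heat \<theta> t w x"
  unfolding heat_def by (rule nn_integral_mono_AE) (erule AE_mp, rule AE_I2, auto intro: mult_left_mono)

lemma heat_cong_AE: "(AE y in lborel. v y = w y) \<Longrightarrow> heat \<theta> t v x = heat \<theta> t w x"
  unfolding heat_def by (intro nn_integral_cong_AE) auto

lemma heat_add:
  assumes [measurable]: "v \<in> borel_measurable borel" "w \<in> borel_measurable borel"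
  shows "heat \<theta> t (\<lambda>y. v y + w y) x = heat \<theta> t v x + heat \<theta> t w x"
  unfolding heat_def distrib_left by (rule nn_integral_add) measurable

lemma heat_cmult:
  assumes [measurable]: "v \<in> borel_measurable borel"
  shows "heat \<theta> t (\<lambda>y. c * v y) x = c * heat \<theta> t v x"
proof -
  have "heat \<theta> t (\<lambda>y. c * v y) x = (\<integral>\<^sup>+y. c * (ennreal (Gamma_frac \<theta> (x - y) t) * v y) \<partial>lborel)"
    unfolding heat_def by (simp only: mult.left_commute)
  then show ?thesis unfolding heat_def by (subst (asm) nn_integral_cmult) auto
qed

lemma heat_const:
  assumes "t > 0" "0 < \<theta>" "\<theta> \<le> 2"
  shows "heat \<theta> t (\<lambda>_. c) (x::real^'n) = c"
  unfolding heat_def by (subst nn_integral_multc) (auto simp: nn_integral_Gamma_frac[OF assms])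

lemma heat_nn_integral:
  fixes v :: "'b::euclidean_space \<Rightarrow> real^'n \<Rightarrow> ennreal"
  assumes [measurable]: "(\<lambda>(s, y). v s y) \<in> borel_measurable (borel \<Otimes>\<^sub>M borel)"
  shows "heat \<theta> t (\<lambda>y. \<integral>\<^sup>+s. v s y \<partial>lborel) x = (\<integral>\<^sup>+s. heat \<theta> t (v s) x \<partial>lborel)"
proof -
  have "heat \<theta> t (\<lambda>y. \<integral>\<^sup>+s. v s y \<partial>lborel) x = (\<integral>\<^sup>+y. (\<integral>\<^sup>+s. ennreal (Gamma_frac \<theta> (x - y) t) * v s y \<partial>lborel) \<partial>lborel)"
    unfolding heat_def by (intro nn_integral_cong nn_integral_cmult[symmetric]) measurable
  also have "\<dots> = (\<integral>\<^sup>+s. heat \<theta> t (v s) x \<partial>lborel)"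
    unfolding heat_def by (rule lborel_pair.Fubini'[symmetric]) measurable
  finally show ?thesis .
qed

lemma heat_semigroup:
  fixes x :: "real^'n"
  assumes t: "t > 0" and s: "s > 0" and th: "0 < \<theta>" "\<theta> \<le> 2" and [measurable]: "v \<in> borel_measurable borel"
  shows "heat \<theta> t (heat \<theta> s v) x = heat \<theta> (t + s) v x"
proof -
  have "heat \<theta> t (heat \<theta> s v) x = heat \<theta> t (\<lambda>y. \<integral>\<^sup>+z. ennreal (Gamma_frac \<theta> (y - z) s) * v z \<partial>lborel) x"
  proof -
    have "heat \<theta> s v = (\<lambda>y. \<integral>\<^sup>+z. ennreal (Gamma_frac \<theta> (y - z) s) * v z \<partial>lborel)"
      by (rule ext) (rule heat_def)
    then show ?thesis by (rule arg_cong)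
  qed
  also have "\<dots> = (\<integral>\<^sup>+z. heat \<theta> t (\<lambda>y. ennreal (Gamma_frac \<theta> (y - z) s) * v z) x \<partial>lborel)"
    by (rule heat_nn_integral) measurable
  also have "\<dots> = (\<integral>\<^sup>+z. ennreal (Gamma_frac \<theta> (x - z) (t + s)) * v z \<partial>lborel)"
  proof (intro nn_integral_cong)
    fix z
    have "heat \<theta> t (\<lambda>y. ennreal (Gamma_frac \<theta> (y - z) s) * v z) x
       = (\<integral>\<^sup>+y. ennreal (Gamma_frac \<theta> (x - y) t) * ennreal (Gamma_frac \<theta> (y - z) s) \<partial>lborel) * v z"
      unfolding heat_def mult.assoc[symmetric] by (rule nn_integral_multc) measurable
    then show "heat \<theta> t (\<lambda>y. ennreal (Gamma_frac \<theta> (y - z) s) * v z) x = ennreal (Gamma_frac \<theta> (x - z) (t + s)) * v z"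
      by (simp only: Gamma_frac_semigroup[OF t s th])
  qed
  finally show ?thesis unfolding heat_def .
qed

lemma duhamel_mono:
  assumes "\<And>y s. 0 < s \<Longrightarrow> s < snd z \<Longrightarrow> v (y, s) \<le> w (y, s)"
  shows "duhamel \<theta> v z \<le> duhamel \<theta> w z"
  unfolding duhamel_def using assms
  by (intro nn_integral_mono) (auto simp: indicator_def intro!: heat_mono)

lemma duhamel_LIMSEQ:
  fixes v :: "nat \<Rightarrow> (real^'n) \<times> real \<Rightarrow> ennreal"
  assumes inc: "\<And>z. incseq (\<lambda>n. v n z)" and vm: "\<And>n. v n \<in> borel_measurable borel"
    and lim: "\<And>z. (\<lambda>n. v n z) \<longlonglongrightarrow> w z"
  shows "(\<lambda>n. duhamel \<theta> (v n) z) \<longlonglongrightarrow> duhamel \<theta> w z"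
proof -
  have [measurable]: "v n \<in> borel_measurable (borel \<Otimes>\<^sub>M borel)" for n using vm by (simp add: borel_prod)
  have h: "(\<lambda>n. heat \<theta> t (\<lambda>y. v n (y, s)) x) \<longlonglongrightarrow> heat \<theta> t (\<lambda>y. w (y, s)) x" for t s x
    unfolding heat_def
  proof (rule nn_integral_LIMSEQ)
    show "incseq (\<lambda>n y. ennreal (Gamma_frac \<theta> (x - y) t) * v n (y, s))"
      using inc by (auto simp: incseq_def le_fun_def intro!: mult_left_mono)
    show "(\<lambda>n. ennreal (Gamma_frac \<theta> (x - y) t) * v n (y, s)) \<longlonglongrightarrow> ennreal (Gamma_frac \<theta> (x - y) t) * w (y, s)" for y
      by (intro ennreal_tendsto_cmult lim) simp
  qed measurable
  show ?thesis unfolding duhamel_def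
  proof (rule nn_integral_LIMSEQ)
    show "incseq (\<lambda>n s. indicator {0<..<snd z} s * heat \<theta> (snd z - s) (\<lambda>y. v n (y, s)) (fst z))"
      using inc by (auto simp: incseq_def le_fun_def intro!: mult_left_mono heat_mono)
    show "(\<lambda>s. indicator {0<..<snd z} s * heat \<theta> (snd z - s) (\<lambda>y. v n (y, s)) (fst z)) \<in> borel_measurable lborel" for n
      unfolding indicator_Ioo_eq_if by measurable
    show "(\<lambda>n. indicator {0<..<snd z} s * heat \<theta> (snd z - s) (\<lambda>y. v n (y, s)) (fst z))
       \<longlonglongrightarrow> indicator {0<..<snd z} s * heat \<theta> (snd z - s) (\<lambda>y. w (y, s)) (fst z)" for s
      using h by (auto simp: indicator_def)
  qed
qed

lemma QT_borel[measurable]: "QT T \<in> sets borel"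
  unfolding QT_def by (intro borel_open open_Times) auto

text \<open>Passing from the completed measure to Borel measure changes neither the nonnegative
  integrals nor the null sets. Nonnegativity of the kernel is what allows \<open>ennreal\<close> to
  be distributed over the product.\<close>

lemma is_solution_iff:
  fixes \<mu> :: "real^'n \<Rightarrow> real"
  assumes th: "0 < \<theta>" "\<theta> \<le> 2"
  shows "is_solution \<theta> f \<mu> T u \<longleftrightarrow>
     (\<forall>z\<in>QT T. u z \<ge> 0) \<and> u \<in> borel_measurable (lebesgue_on (QT T)) \<and>
     (AE z in lborel. z \<in> QT T \<longrightarrow> ennreal (u z) = heat \<theta> (snd z) (\<lambda>y. ennreal (\<mu> y)) (fst z) + duhamel \<theta> (\<lambda>w. ennreal (f (u w))) z)"
proof -
  have 1: "(\<integral>\<^sup>+y. ennreal (Gamma_frac \<theta> (x - y) t * g y) \<partial>lebesgue) = heat \<theta> t (\<lambda>y. ennreal (g y)) x"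
    if "t > 0" for t g and x :: "real^'n"
    unfolding heat_def nn_integral_completion
    by (intro nn_integral_cong ennreal_mult' Gamma_frac_nonneg that th)
  have 2: "(\<integral>\<^sup>+s. indicator {0<..<snd z} s *
                (\<integral>\<^sup>+y. ennreal (Gamma_frac \<theta> (fst z - y) (snd z - s) * f (u (y, s))) \<partial>lebesgue) \<partial>lebesgue)
      = duhamel \<theta> (\<lambda>w. ennreal (f (u w))) z" for z :: "(real^'n) \<times> real"
    unfolding duhamel_def nn_integral_completion[of _ "\<lambda>s. indicator {0<..<snd z} s * _ s"]
    by (intro nn_integral_cong) (auto simp: indicator_def 1)
  show ?thesis
    unfolding is_solution_def AE_completion_iff 2
    by (intro conj_cong refl AE_cong) (auto simp: QT_def 1)
qed

text \<open>The nonlinearity is continuous on [0,\<infinity>) only; clamping the argument at 0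
  extends it continuously to the line, and it changes nothing for nonnegative functions.\<close>

lemma measurable_comp_max_0:
  fixes f :: "real \<Rightarrow> real"
  assumes "continuous_on {0..} f" and [measurable]: "u \<in> borel_measurable M"
  shows "(\<lambda>z. f (max 0 (u z))) \<in> borel_measurable M"
proof -
  have "continuous_on UNIV (\<lambda>r. f (max 0 r))"
    by (rule continuous_on_compose2[OF assms(1)]) (auto intro!: continuous_intros)
  then have "(\<lambda>r. f (max 0 r)) \<in> borel_measurable borel" by (rule borel_measurable_continuous_onI)
  then show ?thesis by (rule measurable_compose[OF assms(2)])
qed

text \<open>Iterating u -> v0 + duhamel(f(u)) from 0 gives an increasing sequence, kept below U by
  the supersolution inequality. Monotone convergence passes to the limit in the integrals,
  continuity of f inside them.\<close>

lemma solution_below_supersolution: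
  fixes v0 :: "(real^'n) \<times> real \<Rightarrow> ennreal"
  assumes fc: "continuous_on {0..} f" and fm: "\<And>a b. 0 \<le> a \<Longrightarrow> a \<le> b \<Longrightarrow> f a \<le> f b"
    and [measurable]: "v0 \<in> borel_measurable borel"
    and U0: "\<And>z. z \<in> QT T \<Longrightarrow> 0 \<le> U z"
    and super: "\<And>z. z \<in> QT T \<Longrightarrow> v0 z + duhamel \<theta> (\<lambda>w. ennreal (f (U w))) z \<le> ennreal (U z)"
  obtains u where "u \<in> borel_measurable borel" "\<And>z. 0 \<le> u z" "\<And>z. z \<in> QT T \<Longrightarrow> u z \<le> U z"
    "\<And>z. z \<in> QT T \<Longrightarrow> ennreal (u z) = v0 z + duhamel \<theta> (\<lambda>w. ennreal (f (u w))) z"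
proof -
  \<comment> \<open>The value 0 outside \<open>QT T\<close> keeps the iterates Borel and monotone on
    the whole space, while the integrals only see times inside.\<close>
  define step where "step u z = (if z \<in> QT T then enn2real (v0 z + duhamel \<theta> (\<lambda>w. ennreal (f (u w))) z) else 0)"
    for u :: "(real^'n) \<times> real \<Rightarrow> real" and z
  define u where "u n = (step ^^ n) (\<lambda>_. 0)" for n
  have u_Suc: "u (Suc n) = step (u n)" and u_0: "u 0 = (\<lambda>_. 0)" for n by (auto simp: u_def)
  have QTs: "(y, s) \<in> QT T" if "z \<in> QT T" "0 < s" "s < snd z" for z :: "(real^'n) \<times> real" and y :: "real^'n" and s
    using that by (auto simp: QT_def)
  have nn: "0 \<le> u n z" for n z by (cases n) (auto simp: u_0 u_Suc step_def)
  have [measurable]: "u n \<in> borel_measurable borel" for n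
  proof (induction n)
    case (Suc n)
    note [measurable] = Suc
    have "(\<lambda>w. f (max 0 (u n w))) \<in> borel_measurable borel" by (rule measurable_comp_max_0[OF fc]) measurable
    then have [measurable]: "(\<lambda>w. f (u n w)) \<in> borel_measurable borel" using nn by (simp add: max_absorb2)
    have [measurable]: "duhamel \<theta> (\<lambda>w. ennreal (f (u n w))) \<in> borel_measurable borel" by (rule duhamel_measurable) measurable
    show ?case unfolding u_Suc step_def[abs_def] by measurable
  qed (simp add: u_0)
  have leU: "z \<in> QT T \<Longrightarrow> u n z \<le> U z" for n z
  proof (induction n arbitrary: z)
    case (Suc n)
    have "v0 z + duhamel \<theta> (\<lambda>w. ennreal (f (u n w))) z \<le> v0 z + duhamel \<theta> (\<lambda>w. ennreal (f (U w))) z"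
      using Suc nn QTs by (intro add_left_mono duhamel_mono ennreal_leI fm) blast+
    also have "\<dots> \<le> ennreal (U z)" by (rule super[OF Suc.prems])
    finally show ?case using Suc.prems U0[OF Suc.prems] unfolding u_Suc step_def
      by (simp add: enn2real_leI)
  qed (simp add: u_0 U0)
  \<comment> \<open>\<open>enn2real\<close> sends infinity to 0; domination by the finite
    \<open>U\<close> rules this default out, so the equation can be read in both directions.\<close>
  have fin: "ennreal (u (Suc n) z) = v0 z + duhamel \<theta> (\<lambda>w. ennreal (f (u n w))) z" if "z \<in> QT T" for n z
  proof -
    have "v0 z + duhamel \<theta> (\<lambda>w. ennreal (f (u n w))) z \<le> v0 z + duhamel \<theta> (\<lambda>w. ennreal (f (U w))) z"
      using leU nn QTs that by (intro add_left_mono duhamel_mono ennreal_leI fm) blast+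
    also have "\<dots> \<le> ennreal (U z)" by (rule super[OF that])
    also have "ennreal (U z) < \<infinity>" by simp
    finally have "v0 z + duhamel \<theta> (\<lambda>w. ennreal (f (u n w))) z < \<infinity>" .
    then show ?thesis using that unfolding u_Suc step_def by simp
  qed
  have mono1: "u n z \<le> u (Suc n) z" for n z
  proof (induction n arbitrary: z)
    case (Suc n)
    show ?case
    proof (cases "z \<in> QT T")
      case True
      have "ennreal (u (Suc n) z) \<le> ennreal (u (Suc (Suc n)) z)"
        unfolding fin[OF True] using Suc nn by (intro add_left_mono duhamel_mono ennreal_leI fm) auto
      then show ?thesis using nn by (simp add: ennreal_le_iff)
    next
      case False
      then show ?thesis by (simp add: u_Suc step_def)
    qed
  qed (use nn in \<open>simp add: u_0\<close>)
  have inc: "incseq (\<lambda>n. u n z)" for z by (rule incseq_SucI) (rule mono1)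
  have "\<exists>l. (\<lambda>n. u n z) \<longlonglongrightarrow> l" for z
  proof (cases "z \<in> QT T")
    case True
    obtain l where "(\<lambda>n. u n z) \<longlonglongrightarrow> l" using incseq_convergent[OF inc, of z "U z"] leU[OF True] by blast
    then show ?thesis by blast
  next
    case False
    then have "u n z = 0" for n by (cases n) (auto simp: u_0 u_Suc step_def)
    then show ?thesis by auto
  qed
  then obtain ui where lim: "\<And>z. (\<lambda>n. u n z) \<longlonglongrightarrow> ui z" by metis
  have ui_m: "ui \<in> borel_measurable borel" by (rule borel_measurable_LIMSEQ_real[OF lim]) measurable
  have ui_nn: "0 \<le> ui z" for z by (rule LIMSEQ_le_const[OF lim]) (use nn in auto)
  have ui_le: "ui z \<le> U z" if "z \<in> QT T" for z by (rule LIMSEQ_le_const2[OF lim]) (use leU that in auto)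
  have flim: "(\<lambda>n. ennreal (f (u n z))) \<longlonglongrightarrow> ennreal (f (ui z))" for z
  proof (rule tendsto_ennrealI)
    show "(\<lambda>n. f (u n z)) \<longlonglongrightarrow> f (ui z)"
      using continuous_on_tendsto_compose[OF fc lim] ui_nn nn by auto
  qed
  have dlim: "(\<lambda>n. duhamel \<theta> (\<lambda>w. ennreal (f (u n w))) z) \<longlonglongrightarrow> duhamel \<theta> (\<lambda>w. ennreal (f (ui w))) z" for z
  proof (rule duhamel_LIMSEQ)
    show "incseq (\<lambda>n. ennreal (f (u n z)))" for z
      by (rule incseq_SucI) (intro ennreal_leI fm nn mono1)
    have "(\<lambda>w. f (max 0 (u n w))) \<in> borel_measurable borel" for n by (rule measurable_comp_max_0[OF fc]) measurable
    then show "(\<lambda>w. ennreal (f (u n w))) \<in> borel_measurable borel" for n using nn by (simp add: max_absorb2)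
  qed (rule flim)
  have "ennreal (ui z) = v0 z + duhamel \<theta> (\<lambda>w. ennreal (f (ui w))) z" if "z \<in> QT T" for z
  proof (rule LIMSEQ_unique)
    show "(\<lambda>n. ennreal (u (Suc n) z)) \<longlonglongrightarrow> ennreal (ui z)" using LIMSEQ_Suc[OF lim] by (rule tendsto_ennrealI)
    show "(\<lambda>n. ennreal (u (Suc n) z)) \<longlonglongrightarrow> v0 z + duhamel \<theta> (\<lambda>w. ennreal (f (ui w))) z"
      unfolding fin[OF that] by (intro tendsto_add tendsto_const dlim)
  qed
  then show ?thesis using that ui_m ui_nn ui_le by blast
qed

section \<open>Existence\<close>

text \<open>The supporting line that replaces Jensen's inequality: integrated against the kernel,
  which has mass one, it needs no integrability of the convex function.\<close>

lemma tangent_below_if_mono_deriv: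
  fixes g g' :: "real \<Rightarrow> real"
  assumes d: "\<And>x. x \<ge> a \<Longrightarrow> (g has_real_derivative g' x) (at x)"
    and m: "\<And>x y. a \<le> x \<Longrightarrow> x \<le> y \<Longrightarrow> g' x \<le> g' y" and xy: "x \<ge> a" "y \<ge> a"
  shows "g x + g' x * (y - x) \<le> g y"
proof -
  consider "x = y" | "x < y" | "y < x" by linarith
  then show ?thesis
  proof cases
    case 2
    obtain z where z: "x < z" "z < y" "g y - g x = (y - x) * g' z"
      using MVT2[OF 2, of g g'] d xy by auto
    have "(y - x) * g' x \<le> (y - x) * g' z" using z m xy 2 by (intro mult_left_mono) auto
    then have "(y - x) * g' x \<le> g y - g x" by (simp only: z(3))
    then show ?thesis by (simp add: algebra_simps)
  next
    case 3
    obtain z where z: "y < z" "z < x" "g x - g y = (x - y) * g' z"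
      using MVT2[OF 3, of g g'] d xy by auto
    have "(x - y) * g' z \<le> (x - y) * g' x" using z m xy 3 by (intro mult_left_mono) auto
    then have "g x - g y \<le> (x - y) * g' x" by (simp only: z(3))
    then show ?thesis by (simp add: algebra_simps)
  qed simp
qed

text \<open>Local integrability yields measurability only on bounded sets; the truncations to balls
  converge pointwise, and the limit is then modified on a null set and at negative values.\<close>

lemma nonneg_loc_integrable_borel:
  assumes "nonneg_loc_integrable \<mu>"
  obtains \<mu>' where "\<mu>' \<in> borel_measurable borel" "\<And>x. \<mu>' x \<ge> 0" "AE x in lborel. \<mu> x = \<mu>' (x::real^'n)"
proof -
  have "(\<lambda>x. \<mu> x) \<in> borel_measurable lebesgue"
  proof (rule borel_measurable_LIMSEQ_real)
    show "(\<lambda>x. indicator (cball 0 (real n)) x *\<^sub>R \<mu> x) \<in> borel_measurable lebesgue" for n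
      using assms unfolding nonneg_loc_integrable_def set_integrable_def by (intro borel_measurable_integrable) auto
    fix x :: "real^'n"
    have "eventually (\<lambda>n. real n \<ge> norm x) sequentially"
      using filterlim_real_sequentially by (auto simp: filterlim_at_top)
    then have "eventually (\<lambda>n. indicator (cball 0 (real n)) x *\<^sub>R \<mu> x = \<mu> x) sequentially"
      by eventually_elim simp
    then show "(\<lambda>n. indicator (cball 0 (real n)) x *\<^sub>R \<mu> x) \<longlonglongrightarrow> \<mu> x" by (rule tendsto_eventually)
  qed
  then obtain g where g: "g \<in> borel_measurable lborel" "AE x in lborel. \<mu> x = g x"
    using completion_ex_borel_measurable_real[of \<mu> lborel] by auto
  show ?thesis
  proof (rule that[of "\<lambda>x. max 0 (g x)"])
    show "(\<lambda>x. max 0 (g x)) \<in> borel_measurable borel" using g(1) by simp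
    have "\<mu> x \<ge> 0" for x using assms by (simp add: nonneg_loc_integrable_def)
    then have "\<mu> x = g x \<Longrightarrow> \<mu> x = max 0 (g x)" for x by (metis max_absorb2)
    with g(2) show "AE x in lborel. \<mu> x = max 0 (g x)" by (auto elim: eventually_mono)
  qed auto
qed

context admissible
begin

text \<open>The denominator is arranged as f F^\<kappa> with \<kappa> = 1 - k, whose monotonicity is
  known, so convexity can be read off. It is applied with negative exponents for the inverse of
  \<Phi> and with 1/2 for nonexistence.\<close>

lemma F_powr_has_derivative:
  assumes u: "u > 0" shows "((\<lambda>u. F u powr k) has_real_derivative - k / (f u * F u powr (1 - k))) (at u)"
proof -
  have Fu: "F u > 0" by (rule F_pos[OF u])
  have "((\<lambda>u. F u powr k) has_real_derivative (k * F u powr (k - 1) * (- 1 / f u))) (at u)"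
    using DERIV_fun_powr[OF F_has_derivative[OF u] Fu, of k] by simp
  also have "k * F u powr (k - 1) * (- 1 / f u) = - k / (f u * F u powr (1 - k))"
    using Fu powr_minus_divide[of "F u" "1 - k"] by simp
  finally show ?thesis .
qed

text \<open>\<open>\<Phi>\<close> inverts \<open>G ^ k\<close> on \<open>[\<tau>, \<infinity>)\<close>, where \<open>G = 1 / F\<close> is the transform of the paper;
  the derivative of \<open>\<Phi>\<close> is \<open>f F ^ (k + 1) / k\<close> evaluated at \<open>\<Phi>\<close>.\<close>

definition concave_profile :: "real \<Rightarrow> real \<Rightarrow> real \<Rightarrow> (real \<Rightarrow> real) \<Rightarrow> bool" where
  "concave_profile k k' \<tau> \<Phi> \<longleftrightarrow> \<tau> > 0 \<and>
    (\<forall>z \<ge> F \<tau> powr (-k). \<Phi> z \<ge> \<tau> \<and> F (\<Phi> z) = z powr (-1/k)) \<and>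
    (\<forall>u \<ge> \<tau>. \<Phi> (F u powr (-k)) = u) \<and>
    (\<forall>z \<ge> F \<tau> powr (-k). \<forall>z0 \<ge> F \<tau> powr (-k).
       \<Phi> z \<le> \<Phi> z0 + f (\<Phi> z0) * F (\<Phi> z0) powr (k+1) / k * (z - z0)) \<and>
    (\<forall>u v. \<tau> \<le> u \<and> u \<le> v \<longrightarrow> f u * F u powr k \<le> f v * F v powr k \<and>
       f v * F v powr (k'+1) \<le> f u * F u powr (k'+1) \<and> f v * F v powr (k+1) \<le> f u * F u powr (k+1))"

text \<open>Beyond a common threshold the monotonicity of f F^k and of f F^(k'+1) is available, the
  latter because k' + 1 > q. Since F decreases continuously to 0, it attains every value in (0, F
  \<tau>], which makes \<Phi> well defined.\<close>

lemma concave_profile_exists: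
  assumes k: "q - 1 < k'" "k' < k" "k < q"
  shows "\<exists>\<tau> \<Phi>. concave_profile k k' \<tau> \<Phi>"
proof -
  have k0: "k > 0" using k q_ge_1 by simp
  obtain a1 where a1: "a1 > tau" "\<And>u v. a1 \<le> u \<Longrightarrow> u \<le> v \<Longrightarrow> f u * F u powr k \<le> f v * F v powr k"
    using fF_powr_eventually_mono[OF k(3)] by blast
  obtain a2 where a2: "a2 > tau" "\<And>u v. a2 \<le> u \<Longrightarrow> u \<le> v \<Longrightarrow> f v * F v powr (k'+1) \<le> f u * F u powr (k'+1)"
    using fF_powr_eventually_antimono[of "k'+1"] k by auto
  define \<tau> where "\<tau> = max a1 a2"
  have \<tau>: "\<tau> > 0" "\<tau> \<ge> a1" "\<tau> \<ge> a2" using a1 a2 tau(1) by (auto simp: \<tau>_def)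
  \<comment> \<open>A product of two decreasing factors: f F^(k'+1) and F^(k-k').\<close>
  have anti: "f v * F v powr (k+1) \<le> f u * F u powr (k+1)" if "\<tau> \<le> u" "u \<le> v" for u v
  proof -
    have uv: "0 < u" "0 < v" using that \<tau> by auto
    have eq: "f w * F w powr (k+1) = (f w * F w powr (k'+1)) * F w powr (k - k')" for w
      by (simp add: mult.assoc powr_add[symmetric] add.commute)
    show ?thesis unfolding eq
    proof (rule mult_mono)
      show "f v * F v powr (k'+1) \<le> f u * F u powr (k'+1)" using a2(2)[of u v] that \<tau> by simp
      show "F v powr (k - k') \<le> F u powr (k - k')"
        using k that F_antimono[OF uv(1)] F_nonneg[OF uv(2)] by (intro powr_mono2) auto
    qed (use f_pos[OF uv(1)] in auto)
  qed
  let ?P0 = "F \<tau> powr (-k)"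
  define \<Phi> where "\<Phi> z = (SOME u. u \<ge> \<tau> \<and> F u = z powr (-1/k))" for z
  have \<Phi>: "\<Phi> z \<ge> \<tau> \<and> F (\<Phi> z) = z powr (-1/k)" if z: "z \<ge> ?P0" for z
  proof -
    have P0: "?P0 > 0" using F_pos[OF \<tau>(1)] by simp
    have "z powr (-1/k) \<le> ?P0 powr (-1/k)" using z P0 k0 by (intro powr_mono2') auto
    also have "?P0 powr (-1/k) = F \<tau>" using k0 F_pos[OF \<tau>(1)] by (simp add: powr_powr)
    finally have "z powr (-1/k) \<le> F \<tau>" .
    moreover have "z > 0" using z P0 by linarith
    then have "z powr (-1/k) > 0" by simp
    ultimately obtain u where "u \<ge> \<tau>" "F u = z powr (-1/k)"
      using F_surj[OF \<tau>(1)] by blast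
    then show ?thesis unfolding \<Phi>_def by (intro someI[of "\<lambda>u. u \<ge> \<tau> \<and> F u = z powr (-1/k)"]) auto
  qed
  have F_inj: "u = v" if "u \<ge> \<tau>" "v \<ge> \<tau>" "F u = F v" for u v
    using F_le_iff[of u v] F_le_iff[of v u] that \<tau> by simp
  have P_mono: "F u powr (-k) \<ge> ?P0" if "u \<ge> \<tau>" for u
    using that F_antimono[OF \<tau>(1) that] F_pos[of u] \<tau> k0 by (intro powr_mono2') auto
  have \<Phi>\<Psi>: "\<Phi> (F u powr (-k)) = u" if "u \<ge> \<tau>" for u
  proof (rule F_inj)
    have "F u > 0" using that \<tau> by (intro F_pos) simp
    then show "F (\<Phi> (F u powr (-k))) = F u" using \<Phi>[OF P_mono[OF that]] k0 by (simp add: powr_powr)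
  qed (use \<Phi>[OF P_mono[OF that]] that in auto)
  have \<Psi>\<Phi>: "F (\<Phi> z) powr (-k) = z" if "z \<ge> ?P0" for z
  proof -
    have "?P0 > 0" using F_pos[OF \<tau>(1)] by simp
    then have "z > 0" using that by linarith
    then show ?thesis using \<Phi>[OF that] k0 by (simp add: powr_powr)
  qed
  \<comment> \<open>Concavity of \<Phi> is obtained from convexity of its inverse F^(-k), whose
    derivative k / (f F^(k+1)) is increasing. The tangent inequality of the inverse is then solved
    for \<Phi>, without differentiating \<Phi>.\<close>
  have tang: "\<Phi> z \<le> \<Phi> z0 + f (\<Phi> z0) * F (\<Phi> z0) powr (k+1) / k * (z - z0)"
    if z: "z \<ge> ?P0" "z0 \<ge> ?P0" for z z0
  proof -
    let ?g' = "\<lambda>u. k / (f u * F u powr (k+1))"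
    have pos: "f u * F u powr (k+1) > 0" if "u \<ge> \<tau>" for u using f_pos[of u] F_pos[of u] that \<tau> by simp
    have "F (\<Phi> z0) powr (-k) + ?g' (\<Phi> z0) * (\<Phi> z - \<Phi> z0) \<le> F (\<Phi> z) powr (-k)"
    proof (rule tangent_below_if_mono_deriv[where a=\<tau> and g="\<lambda>u. F u powr (-k)"])
      show "((\<lambda>u. F u powr (-k)) has_real_derivative ?g' x) (at x)" if "x \<ge> \<tau>" for x
        using F_powr_has_derivative[of x "-k"] that \<tau> by (simp add: add.commute)
      show "?g' x \<le> ?g' y" if "\<tau> \<le> x" "x \<le> y" for x y
        using anti[OF that] pos[of x] pos[of y] that k0 by (intro divide_left_mono) auto
    qed (use \<Phi> z in auto)
    then have le: "?g' (\<Phi> z0) * (\<Phi> z - \<Phi> z0) \<le> z - z0" unfolding \<Psi>\<Phi>[OF z(1)] \<Psi>\<Phi>[OF z(2)] by simp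
    define P where "P = f (\<Phi> z0) * F (\<Phi> z0) powr (k+1)"
    have "P > 0" unfolding P_def using pos \<Phi>[OF z(2)] by blast
    moreover have "k / P * (\<Phi> z - \<Phi> z0) \<le> z - z0" using le by (simp only: P_def)
    ultimately have "k * (\<Phi> z - \<Phi> z0) \<le> P * (z - z0)" by (simp add: field_simps)
    then have "\<Phi> z \<le> \<Phi> z0 + P / k * (z - z0)" using k0 by (simp add: field_simps)
    then show ?thesis by (simp only: P_def)
  qed
  have mono: "f u * F u powr k \<le> f v * F v powr k" if "\<tau> \<le> u" "u \<le> v" for u v
    using a1(2)[of u v] that \<tau> by simp
  have anti': "f v * F v powr (k'+1) \<le> f u * F u powr (k'+1)" if "\<tau> \<le> u" "u \<le> v" for u v
    using a2(2)[of u v] that \<tau> by simp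
  show ?thesis
    unfolding concave_profile_def
    by (intro exI[of _ \<tau>] exI[of _ \<Phi>] conjI allI impI \<tau>(1) tang \<Phi>\<Psi> mono anti' anti)
       (use \<Phi> in auto)
qed

lemma F_max_powr_measurable:
  assumes "\<tau> > 0" shows "(\<lambda>r. F (max \<tau> r) powr k) \<in> borel_measurable borel"
proof -
  have "continuous_on {0<..} F"
    by (rule DERIV_continuous_on) (rule has_field_derivative_at_within[OF F_has_derivative], simp)
  then have "continuous_on UNIV (\<lambda>r. F (max \<tau> r))"
    by (rule continuous_on_compose2) (use assms in \<open>auto intro!: continuous_intros\<close>)
  then have "(\<lambda>r. F (max \<tau> r)) \<in> borel_measurable borel" by (rule borel_measurable_continuous_onI)
  then show ?thesis by measurable
qed

text \<open>\<open>Z t\<close> bounds the linear solution uniformly in space. \<open>Z_eq\<close>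
  makes F(\<Phi>(2 Z t)) proportional to t, so U lies below a function of time alone whose F grows
  linearly. The factor 2k/(k-k') is the one for which the time integral in the Duhamel bound equals
  the derivative of \<Phi> at that upper level.\<close>

lemma supersolution:
  fixes \<mu> :: "real^'n \<Rightarrow> real" and \<Phi> :: "real \<Rightarrow> real"
  assumes th: "0 < \<theta>" "\<theta> \<le> 2" and k: "0 < k'" "k' < k"
    and prof: "concave_profile k k' \<tau> \<Phi>"
    and \<mu>[measurable]: "\<mu> \<in> borel_measurable borel"
    and Z: "\<And>t x. 0 < t \<Longrightarrow> t < T \<Longrightarrow> heat \<theta> t (\<lambda>y. ennreal (F (max \<tau> (\<mu> y)) powr (-k))) x \<le> ennreal (Z t)"
    and Z_eq: "\<And>t. 0 < t \<Longrightarrow> (2 * Z t) powr (-1/k) = (2 * k / (k - k')) * t"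
  defines "U z \<equiv> \<Phi> (2 * enn2real (heat \<theta> (snd z) (\<lambda>y. ennreal (F (max \<tau> (\<mu> y)) powr (-k))) (fst z)))"
  assumes z: "z \<in> QT T"
  shows "0 < U z" "F (U z) \<ge> (2 * k / (k - k')) * snd z"
    "heat \<theta> (snd z) (\<lambda>y. ennreal (\<mu> y)) (fst z) + duhamel \<theta> (\<lambda>w. ennreal (f (U w))) z \<le> ennreal (U z)"
proof -
  define p0 where "p0 = F \<tau> powr (-k)"
  have \<tau>: "\<tau> > 0" using prof by (simp add: concave_profile_def)
  have \<Phi>: "\<Phi> z \<ge> \<tau> \<and> F (\<Phi> z) = z powr (-1/k)" if "z \<ge> p0" for z
    using prof that unfolding concave_profile_def p0_def by blast
  have \<Phi>\<Psi>: "\<Phi> (F u powr (-k)) = u" if "u \<ge> \<tau>" for u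
    using prof that unfolding concave_profile_def by blast
  have tang: "\<Phi> z \<le> \<Phi> z0 + f (\<Phi> z0) * F (\<Phi> z0) powr (k+1) / k * (z - z0)" if "z \<ge> p0" "z0 \<ge> p0" for z z0
    using prof that unfolding concave_profile_def p0_def by blast
  have mono: "f u * F u powr k \<le> f v * F v powr k"
    and anti': "f v * F v powr (k'+1) \<le> f u * F u powr (k'+1)"
    and anti: "f v * F v powr (k+1) \<le> f u * F u powr (k+1)" if "\<tau> \<le> u" "u \<le> v" for u v
    using prof that unfolding concave_profile_def by blast+
  have k0: "k > 0" using k by simp
  have P0: "p0 > 0" using F_pos[OF \<tau>] by (simp add: p0_def)
  define h0 where "h0 y = F (max \<tau> (\<mu> y)) powr (-k)" for y
  have [measurable]: "h0 \<in> borel_measurable borel"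
    unfolding h0_def by (rule measurable_compose[OF \<mu> F_max_powr_measurable[OF \<tau>]])
  have h0_ge: "h0 y \<ge> p0" for y
    unfolding h0_def p0_def using F_antimono[OF \<tau>, of "max \<tau> (\<mu> y)"] F_pos[of "max \<tau> (\<mu> y)"] \<tau> k0
    by (intro powr_mono2') auto
  have \<Phi>h0: "\<Phi> (h0 y) = max \<tau> (\<mu> y)" for y unfolding h0_def by (rule \<Phi>\<Psi>) simp
  define h where "h t x = enn2real (heat \<theta> t (\<lambda>y. ennreal (h0 y)) x)" for t x
  have U_eq: "U w = \<Phi> (2 * h (snd w) (fst w))" for w by (simp add: U_def h_def h0_def)
  have Zh: "heat \<theta> t (\<lambda>y. ennreal (h0 y)) x \<le> ennreal (Z t)" if "0 < t" "t < T" for t x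
    using Z[OF that] by (simp add: h0_def)
  have h_eq: "heat \<theta> t (\<lambda>y. ennreal (h0 y)) x = ennreal (h t x)" if "0 < t" "t < T" for t x
    unfolding h_def using Zh[OF that, of x] ennreal_less_top[of "Z t"] by (intro ennreal_enn2real[symmetric]) (rule le_less_trans)
  have h_ge: "h t x \<ge> p0" if "0 < t" "t < T" for t x
  proof -
    have "ennreal p0 = heat \<theta> t (\<lambda>_. ennreal p0) x" by (rule heat_const[OF that(1) th, symmetric])
    also have "\<dots> \<le> heat \<theta> t (\<lambda>y. ennreal (h0 y)) x" by (intro heat_mono ennreal_leI h0_ge)
    finally have "ennreal p0 \<le> ennreal (h t x)" unfolding h_eq[OF that] .
    then show ?thesis using P0 by (metis ennreal_le_iff2 not_le order.asym)
  qed
  have h_pos: "h t x > 0" if "0 < t" "t < T" for t x using h_ge[OF that, of x] P0 by linarith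
  have h_le: "h t x \<le> Z t" if "0 < t" "t < T" for t x
  proof -
    have "ennreal (h t x) \<le> ennreal (Z t)" using Zh[OF that, of x] unfolding h_eq[OF that] .
    then show ?thesis using h_pos[OF that, of x] by (metis ennreal_le_iff2 not_le)
  qed
  have \<Phi>_mono: "\<Phi> a \<le> \<Phi> b" if "p0 \<le> a" "a \<le> b" for a b
  proof -
    have "a > 0" using that P0 by linarith
    then have "b powr (-1/k) \<le> a powr (-1/k)" using that k0 by (intro powr_mono2') auto
    then have "F (\<Phi> b) \<le> F (\<Phi> a)" using \<Phi>[of a] \<Phi>[of b] that by simp
    then show ?thesis using F_le_iff[of "\<Phi> a" "\<Phi> b"] \<Phi>[of a] \<Phi>[of b] that \<tau> by simp
  qed
  obtain x t where zxt: "z = (x, t)" by force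
  have t: "0 < t" "t < T" using z by (auto simp: zxt QT_def)
  \<comment> \<open>\<open>K u / k\<close> is the derivative of \<Phi> at the point that \<Phi> maps
    to \<open>u\<close>.\<close>
  define K where "K u = f u * F u powr (k+1)" for u
  have K0: "K u \<ge> 0" if "u \<ge> \<tau>" for u using f_pos[of u] that \<tau> by (simp add: K_def)
  define b where "b s = \<Phi> (2 * Z s)" for s
  have two_h: "2 * h s y \<ge> p0" "2 * Z s \<ge> p0" if "0 < s" "s < T" for s y
    using h_ge[OF that, of y] h_le[OF that, of y] P0 by linarith+
  have b_ge: "b s \<ge> \<tau>" "F (b s) = (2 * k / (k - k')) * s" if "0 < s" "s < T" for s
    using \<Phi>[OF two_h(2)[OF that]] Z_eq[OF that(1)] by (auto simp: b_def)
  have U_le: "\<Phi> (2 * h s y) \<le> b s" if "0 < s" "s < T" for s y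
    unfolding b_def using h_le[OF that, of y] by (intro \<Phi>_mono two_h that) simp
  show U_pos: "0 < U z" using \<Phi>[OF two_h(1)[OF t, of x]] \<tau> by (simp add: U_eq zxt)
  show "F (U z) \<ge> (2 * k / (k - k')) * snd z"
    using F_antimono[OF U_pos, of "b t"] U_le[OF t, of x] b_ge(2)[OF t] by (simp add: U_eq zxt)

  \<comment> \<open>Jensen's inequality, through the tangent of \<open>\<Phi>\<close> at \<open>h t x\<close>\<close>
  have linear: "heat \<theta> t (\<lambda>y. ennreal (\<mu> y)) x \<le> ennreal (\<Phi> (h t x))"
  proof -
    define c where "c = K (\<Phi> (h t x)) / k"
    have c: "c \<ge> 0" unfolding c_def using K0 \<Phi>[OF h_ge[OF t, of x]] k0 by simp
    have "heat \<theta> t (\<lambda>y. ennreal (\<mu> y)) x + ennreal (c * h t x)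
        \<le> heat \<theta> t (\<lambda>y. ennreal (max \<tau> (\<mu> y))) x + heat \<theta> t (\<lambda>_. ennreal (c * h t x)) x"
      unfolding heat_const[OF t(1) th] by (intro add_right_mono heat_mono ennreal_leI) simp
    also have "\<dots> = heat \<theta> t (\<lambda>y. ennreal (max \<tau> (\<mu> y)) + ennreal (c * h t x)) x"
      by (rule heat_add[symmetric]) measurable
    also have "\<dots> \<le> heat \<theta> t (\<lambda>y. ennreal (\<Phi> (h t x)) + ennreal c * ennreal (h0 y)) x"
    proof (rule heat_mono)
      fix y
      have "max \<tau> (\<mu> y) + c * h t x \<le> \<Phi> (h t x) + c * h0 y"
      proof -
        have "max \<tau> (\<mu> y) \<le> \<Phi> (h t x) + c * (h0 y - h t x)"
          using tang[OF h0_ge[of y] h_ge[OF t, of x]] by (simp only: \<Phi>h0 K_def c_def)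
        then show ?thesis by (simp add: algebra_simps)
      qed
      then have "ennreal (max \<tau> (\<mu> y) + c * h t x) \<le> ennreal (\<Phi> (h t x) + c * h0 y)" by (rule ennreal_leI)
      moreover have "max \<tau> (\<mu> y) \<ge> 0" "c * h t x \<ge> 0" "c * h0 y \<ge> 0" "\<Phi> (h t x) \<ge> 0" "h0 y \<ge> 0"
        using \<tau> c h_pos[OF t, of x] h0_ge[of y] P0 \<Phi>[OF h_ge[OF t, of x]]
        by (auto simp: max_def intro!: mult_nonneg_nonneg)
      ultimately show "ennreal (max \<tau> (\<mu> y)) + ennreal (c * h t x) \<le> ennreal (\<Phi> (h t x)) + ennreal c * ennreal (h0 y)"
        using c by (simp only: ennreal_plus ennreal_mult)
    qed
    also have "\<dots> = heat \<theta> t (\<lambda>y. ennreal (\<Phi> (h t x))) x + heat \<theta> t (\<lambda>y. ennreal c * ennreal (h0 y)) x"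
      by (rule heat_add) measurable
    also have "\<dots> = ennreal (\<Phi> (h t x)) + ennreal c * ennreal (h t x)"
    proof -
      have "heat \<theta> t (\<lambda>y. ennreal c * ennreal (h0 y)) x = ennreal c * heat \<theta> t (\<lambda>y. ennreal (h0 y)) x"
        by (rule heat_cmult) measurable
      then show ?thesis unfolding heat_const[OF t(1) th] h_eq[OF t] by simp
    qed
    also have "ennreal c * ennreal (h t x) = ennreal (c * h t x)"
      using c h_pos[OF t, of x] by (simp add: ennreal_mult)
    finally have "ennreal (c * h t x) + heat \<theta> t (\<lambda>y. ennreal (\<mu> y)) x \<le> ennreal (c * h t x) + ennreal (\<Phi> (h t x))"
      by (simp only: add.commute)
    then show ?thesis unfolding ennreal_add_left_cancel_le by simp
  qed

  \<comment> \<open>Since \<open>f (\<Phi> z) / z\<close> is nondecreasing, \<open>f (U s)\<close> is at most a function of \<open>s\<close> times \<open>h s\<close>,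
      and \<open>h\<close> is invariant under the semigroup.\<close>
  define A where "A s = 2 * (f (b s) * F (b s) powr k)" for s
  have fU: "f (\<Phi> (2 * h s y)) \<le> A s * h s y" if s: "0 < s" "s < T" for s y
  proof -
    let ?u = "\<Phi> (2 * h s y)"
    have u: "?u \<ge> \<tau>" "F ?u = (2 * h s y) powr (-1/k)" using \<Phi>[OF two_h(1)[OF s]] by auto
    have "F ?u powr k = (2 * h s y) powr (-1)" unfolding u(2) using k0 by (simp add: powr_powr)
    moreover have "(2 * h s y) powr (-1) * (2 * h s y) = 1" using h_pos[OF s, of y] by (simp add: powr_minus)
    ultimately have "F ?u powr k * (2 * h s y) = 1" by (simp only:)
    then have "f ?u = (f ?u * F ?u powr k) * (2 * h s y)" by (simp only: mult.assoc mult_1_right)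
    also have "\<dots> \<le> (f (b s) * F (b s) powr k) * (2 * h s y)"
      using mono[OF u(1) U_le[OF s]] h_pos[OF s, of y] by (intro mult_right_mono) auto
    finally show ?thesis by (simp add: A_def mult_ac)
  qed
  have A0: "A s \<ge> 0" if "0 < s" "s < T" for s
    using f_pos[of "b s"] b_ge[OF that] \<tau> by (simp add: A_def)
  let ?e = "2 * k / (k - k')" and ?p = "k - k'"
  have e: "?e > 0" using k k0 by simp
  \<comment> \<open>For s < t the level \<open>b s\<close> is the larger one, so the decreasing
    quantity f F^(k'+1) may be evaluated at \<open>b t\<close> and taken out of the time integral.
    What remains of F(b s)^k is the power k - k' - 1 of a multiple of s.\<close>
  have A_le: "A s \<le> 2 * (f (b t) * F (b t) powr (k'+1)) * ?e powr (?p - 1) * s powr (?p - 1)" if s: "0 < s" "s < t" for s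
  proof -
    have sT: "s < T" using s t by simp
    have "F (b t) \<ge> F (b s)" unfolding b_ge(2)[OF t] b_ge(2)[OF s(1) sT] using s e by (intro mult_left_mono) auto
    then have bb: "b t \<le> b s" using F_le_iff[of "b t" "b s"] b_ge(1)[OF t] b_ge(1)[OF s(1) sT] \<tau> by simp
    have "F (b s) powr k = F (b s) powr (k'+1) * F (b s) powr (?p - 1)"
      by (simp add: powr_add[symmetric])
    also have "F (b s) powr (?p - 1) = ?e powr (?p - 1) * s powr (?p - 1)"
      unfolding b_ge(2)[OF s(1) sT] by (rule powr_mult)
    finally have eq: "A s = 2 * (f (b s) * F (b s) powr (k'+1)) * (?e powr (?p - 1) * s powr (?p - 1))"
      by (simp only: A_def mult.assoc)
    show ?thesis unfolding eq mult.assoc[of _ "?e powr (?p - 1)"]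
      using anti'[OF b_ge(1)[OF t] bb] by (intro mult_right_mono) auto
  qed
  let ?c = "2 * (f (b t) * F (b t) powr (k'+1)) * ?e powr (?p - 1)"
  have c0: "?c \<ge> 0" using f_pos[of "b t"] b_ge(1)[OF t] \<tau> by simp
  let ?B = "\<lambda>s. ennreal (s powr (?p - 1)) * indicator {0..t} s"
  \<comment> \<open>Integrating s^(p-1) gives t^p/p with p = k - k'. The powers of \<open>?e\<close>
    combine with t into F(b t)^p / e, and 2/(ep) = 1/k by the choice of e.\<close>
  have B_int: "ennreal ?c * (\<integral>\<^sup>+s. ?B s \<partial>lborel) = ennreal (K (b t) / k)"
  proof -
    have "(\<integral>\<^sup>+s. ?B s \<partial>lborel) = ennreal (t powr (?p - 1 + 1) / (?p - 1 + 1))"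
      using k t by (intro nn_integral_powr_near_0) auto
    then have "ennreal ?c * (\<integral>\<^sup>+s. ?B s \<partial>lborel) = ennreal (?c * (t powr ?p / ?p))"
      using c0 by (simp add: ennreal_mult'[symmetric])
    also have "?c * (t powr ?p / ?p) = K (b t) / k"
    proof -
      have "E powr (p - 1) * (t powr p) = (E * t) powr p / E" if "E > 0" for E p :: real
        using that by (simp add: powr_mult powr_diff)
      from this[OF e] have "?e powr (?p - 1) * (t powr ?p) = (?e * t) powr ?p / ?e" .
      also have "\<dots> = F (b t) powr ?p / ?e" unfolding b_ge(2)[OF t] ..
      finally have 1: "?e powr (?p - 1) * (t powr ?p) = F (b t) powr ?p / ?e" .
      have "?c * (t powr ?p / ?p) = 2 * (f (b t) * F (b t) powr (k'+1)) * (?e powr (?p - 1) * t powr ?p) / ?p" by simp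
      also have "\<dots> = 2 / (?e * ?p) * (f (b t) * (F (b t) powr (k'+1) * F (b t) powr ?p))" unfolding 1 by simp
      also have "F (b t) powr (k'+1) * F (b t) powr ?p = F (b t) powr (k+1)"
        by (simp add: powr_add[symmetric] add.commute)
      also have "2 / (?e * ?p) = 1 / k" using k k0 by simp
      finally show ?thesis by (simp add: K_def)
    qed
    finally show ?thesis .
  qed
  have "duhamel \<theta> (\<lambda>w. ennreal (f (U w))) z \<le> (\<integral>\<^sup>+s. (ennreal ?c * ennreal (h t x)) * ?B s \<partial>lborel)"
    unfolding duhamel_def zxt fst_conv snd_conv
  proof (rule nn_integral_mono)
    fix s
    show "indicator {0<..<t} s * heat \<theta> (t - s) (\<lambda>y. ennreal (f (U (y, s)))) x \<le> (ennreal ?c * ennreal (h t x)) * ?B s"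
    proof (cases "0 < s \<and> s < t")
      case True
      then have s: "0 < s" "s < T" "0 < t - s" using t by auto
      have "heat \<theta> (t - s) (\<lambda>y. ennreal (f (U (y, s)))) x \<le> heat \<theta> (t - s) (\<lambda>y. ennreal (A s) * ennreal (h s y)) x"
      proof (rule heat_mono)
        fix y
        have "ennreal (f (U (y, s))) \<le> ennreal (A s * h s y)" using fU[OF s(1,2), of y] by (intro ennreal_leI) (simp add: U_eq)
        then show "ennreal (f (U (y, s))) \<le> ennreal (A s) * ennreal (h s y)"
          using A0[OF s(1,2)] by (simp add: ennreal_mult')
      qed
      also have "(\<lambda>y. ennreal (A s) * ennreal (h s y)) = (\<lambda>y. ennreal (A s) * heat \<theta> s (\<lambda>y. ennreal (h0 y)) y)"
        using h_eq[OF s(1,2)] by simp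
      also have "heat \<theta> (t - s) \<dots> x = ennreal (A s) * heat \<theta> (t - s) (heat \<theta> s (\<lambda>y. ennreal (h0 y))) x"
        by (rule heat_cmult) measurable
      also have "heat \<theta> (t - s) (heat \<theta> s (\<lambda>y. ennreal (h0 y))) x = heat \<theta> (t - s + s) (\<lambda>y. ennreal (h0 y)) x"
        by (rule heat_semigroup[OF s(3) s(1) th]) measurable
      also have "t - s + s = t" by simp
      also have "heat \<theta> t (\<lambda>y. ennreal (h0 y)) x = ennreal (h t x)" by (rule h_eq[OF t])
      also have "ennreal (A s) * ennreal (h t x) \<le> ennreal (?c * s powr (?p - 1)) * ennreal (h t x)"
        using A_le[of s] True by (intro mult_right_mono ennreal_leI) auto
      also have "\<dots> = (ennreal ?c * ennreal (h t x)) * ?B s"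
        using True by (simp only: ennreal_mult[OF c0 powr_ge_zero]) (simp add: mult_ac)
      finally show ?thesis using True by simp
    qed auto
  qed
  also have "\<dots> = (ennreal ?c * ennreal (h t x)) * (\<integral>\<^sup>+s. ?B s \<partial>lborel)"
    by (rule nn_integral_cmult) measurable
  also have "\<dots> = (ennreal ?c * (\<integral>\<^sup>+s. ?B s \<partial>lborel)) * ennreal (h t x)" by (simp only: mult_ac)
  also have "\<dots> = ennreal (K (b t) / k) * ennreal (h t x)" unfolding B_int ..
  also have "\<dots> = ennreal (h t x * (K (b t) / k))"
    using K0[OF b_ge(1)[OF t]] k0 h_pos[OF t, of x] by (simp add: ennreal_mult'[symmetric] mult.commute)
  finally have duh: "duhamel \<theta> (\<lambda>w. ennreal (f (U w))) z \<le> ennreal (h t x * (K (b t) / k))" .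
  \<comment> \<open>The tangent of \<Phi> at 2h, evaluated at h, gives an increment of at least h
    times the derivative at 2h. As U lies below \<open>b t\<close> and K is decreasing, that
    derivative is at least \<open>K (b t) / k\<close>, so the gap covers the Duhamel term.\<close>
  have "\<Phi> (h t x) + h t x * (K (b t) / k) \<le> \<Phi> (2 * h t x)"
  proof -
    let ?u = "\<Phi> (2 * h t x)"
    have "K (b t) \<le> K ?u" unfolding K_def using U_le[OF t] \<Phi>[OF two_h(1)[OF t]] by (intro anti) auto
    then have "h t x * (K (b t) / k) \<le> h t x * (K ?u / k)"
      using h_pos[OF t, of x] k0 by (intro mult_left_mono divide_right_mono) auto
    moreover have "\<Phi> (h t x) \<le> ?u + K ?u / k * (h t x - 2 * h t x)"
      using tang[OF h_ge[OF t, of x] two_h(1)[OF t, of x]] unfolding K_def .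
    moreover have "K ?u / k * (h t x - 2 * h t x) = - (h t x * (K ?u / k))" by (simp add: algebra_simps)
    moreover have "a + y \<le> u" if "y \<le> x'" "a \<le> u + z" "z = - x'" for a y x' u z :: real using that by linarith
    ultimately show ?thesis by blast
  qed
  then have "ennreal (\<Phi> (h t x) + h t x * (K (b t) / k)) \<le> ennreal (U z)"
    unfolding U_eq zxt by (intro ennreal_leI) simp
  moreover have "\<Phi> (h t x) \<ge> 0" "h t x * (K (b t) / k) \<ge> 0"
    using \<Phi>[OF h_ge[OF t, of x]] \<tau> K0[OF b_ge(1)[OF t]] k0 h_pos[OF t, of x] by auto
  ultimately show "heat \<theta> (snd z) (\<lambda>y. ennreal (\<mu> y)) (fst z) + duhamel \<theta> (\<lambda>w. ennreal (f (U w))) z \<le> ennreal (U z)"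
    using add_mono[OF linear duh] by (simp add: zxt)
qed

lemma locally_solvable_if_small:
  assumes th: "0 < \<theta>" "\<theta> \<le> 2" and super: "supercritical \<theta> f CARD('n)"
  shows "\<exists>\<epsilon>>0. \<forall>\<mu> :: real^'n \<Rightarrow> real. nonneg_loc_integrable \<mu> \<and> in_B \<mu> \<and>
     (\<exists>r>0. AE x in lebesgue. x \<in> ball 0 r \<longrightarrow> Gfun f (\<mu> x) \<le> \<epsilon> * norm x powr (- \<theta>))
       \<longrightarrow> (\<exists>T>0. \<exists>u. is_solution \<theta> f \<mu> T u \<and> Linf_loc_time T u)"
proof -
  have "q - 1 < min q (real CARD('n) / \<theta>)" using supercritical_q[OF super th(1)] by simp
  then obtain k where k1: "q - 1 < k" "k < min q (real CARD('n) / \<theta>)" using dense by blast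
  then obtain k' where k': "q - 1 < k'" "k' < k" using dense by blast
  have k0: "0 < k'" "0 < k" using k' q_ge_1 by auto
  have kq: "k < q" "k * \<theta> < real CARD('n)" using k1 th by (auto simp: field_simps)
  obtain \<tau> \<Phi> where prof: "concave_profile k k' \<tau> \<Phi>"
    using concave_profile_exists[OF k' kq(1)] by blast
  have \<tau>: "\<tau> > 0" using prof by (simp add: concave_profile_def)
  have kt: "0 < k * \<theta>" using k0 th by simp
  obtain C where C: "C > 0" "\<And>t (x::real^'n). t > 0 \<Longrightarrow>
     (\<integral>\<^sup>+y. ennreal (Gamma_frac \<theta> (x - y) t) * ennreal (norm y powr (-(k * \<theta>))) \<partial>lborel) \<le> ennreal (C * t powr (- (k * \<theta>) / \<theta>))"
    using Gamma_frac_negative_moment[OF th kt kq(2)] by blast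
  have C2: "heat \<theta> t (\<lambda>y. ennreal (norm y powr (-(k * \<theta>)))) (x::real^'n) \<le> ennreal (C * t powr (-k))" if "t > 0" for t x
    using C(2)[OF that, of x] th unfolding heat_def by simp
  \<comment> \<open>Solves (4 C \<epsilon>^k t^(-k))^(-1/k) = (2k/(k-k')) t for \<epsilon>; the
    value is free of t and of the initial data.\<close>
  define \<epsilon> where "\<epsilon> = (4 * C) powr (-1/k) * ((k - k') / (2 * k))"
  have \<epsilon>: "\<epsilon> > 0" using C k' k0 by (simp add: \<epsilon>_def)
  define D where "D = \<epsilon> powr k * C"
  have D: "D > 0" using \<epsilon> C by (simp add: D_def)
  \<comment> \<open>The factor 2 leaves room for the constant that bounds the contribution of
    moderate values of \<mu>, which is at most D t^(-k) for short times; T is where the two are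
    equal.\<close>
  define Z where "Z t = 2 * D * t powr (-k)" for t
  have Z_eq: "(2 * Z t) powr (-1/k) = (2 * k / (k - k')) * t" if t: "0 < t" for t
  proof -
    have "2 * Z t = (4 * C) * \<epsilon> powr k * t powr (-k)" by (simp add: Z_def D_def)
    then have "(2 * Z t) powr (-1/k) = (4 * C) powr (-1/k) * (\<epsilon> powr k) powr (-1/k) * (t powr (-k)) powr (-1/k)"
      by (simp only: powr_mult)
    also have "(\<epsilon> powr k) powr (-1/k) = 1 / \<epsilon>" using \<epsilon> k0 by (simp add: powr_powr powr_minus_divide)
    also have "(t powr (-k)) powr (-1/k) = t" using t k0 by (simp add: powr_powr)
    also have "(4 * C) powr (-1/k) * (1 / \<epsilon>) * t = (2 * k / (k - k')) * t"
      unfolding \<epsilon>_def using C k' k0 by simp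
    finally show ?thesis .
  qed
  show ?thesis
  proof (rule exI[of _ \<epsilon>], intro conjI allI impI \<epsilon>)
    fix \<mu> :: "real^'n \<Rightarrow> real"
    assume as: "nonneg_loc_integrable \<mu> \<and> in_B \<mu> \<and>
       (\<exists>r>0. AE x in lebesgue. x \<in> ball 0 r \<longrightarrow> Gfun f (\<mu> x) \<le> \<epsilon> * norm x powr (- \<theta>))"
    obtain \<mu>' where \<mu>'m[measurable]: "\<mu>' \<in> borel_measurable borel" and \<mu>'0: "\<And>x. \<mu>' x \<ge> 0"
      and \<mu>': "AE x in lborel. \<mu> x = \<mu>' x"
      using nonneg_loc_integrable_borel as by blast
    obtain r where r: "r > 0" "AE x in lborel. x \<in> ball 0 r \<longrightarrow> Gfun f (\<mu> x) \<le> \<epsilon> * norm x powr (- \<theta>)"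
      using as by (auto simp: AE_completion_iff)
    obtain B where B: "AE x in lborel. x \<notin> ball 0 r \<longrightarrow> \<bar>\<mu> x\<bar> \<le> B"
      using as r(1) unfolding in_B_def AE_completion_iff by blast
    define Kc where "Kc = F (max \<tau> B) powr (-k)"
    have "F (max \<tau> B) > 0" using \<tau> by (intro F_pos) (simp add: max_def)
    then have Kc: "Kc > 0" by (simp add: Kc_def)
    define T where "T = (D / Kc) powr (1/k)"
    have T: "T > 0" using D Kc by (simp add: T_def)
    have Psi_le: "F u powr (-k) \<le> F v powr (-k)" if "0 < u" "u \<le> v" for u v
      using that F_antimono[OF that] F_pos[of v] k0 by (intro powr_mono2') auto
    \<comment> \<open>Either \<mu> stays below \<open>max \<tau> B\<close>, which holds off the ball
      and gives the constant, or the point lies in the ball and the smallness assumption raised to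
      the power k gives |y|^(-k\<theta>).\<close>
    have h0_le: "AE y in lborel. ennreal (F (max \<tau> (\<mu>' y)) powr (-k)) \<le> ennreal (\<epsilon> powr k) * ennreal (norm y powr (-(k * \<theta>))) + ennreal Kc"
      using \<mu>' r(2) B
    proof eventually_elim
      case (elim y)
      have "F (max \<tau> (\<mu>' y)) powr (-k) \<le> \<epsilon> powr k * norm y powr (-(k * \<theta>)) + Kc"
      proof (cases "max \<tau> (\<mu>' y) \<le> max \<tau> B")
        case True
        then have "F (max \<tau> (\<mu>' y)) powr (-k) \<le> Kc" unfolding Kc_def using \<tau> by (intro Psi_le) auto
        then show ?thesis by (simp add: add_increasing)
      next
        case False
        then have gt: "\<mu> y > \<tau>" "\<mu> y > B" using elim(1) by auto
        then have "y \<in> ball 0 r" using elim(3) by (cases "y \<in> ball 0 r") auto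
        then have "1 / F (\<mu> y) \<le> \<epsilon> * norm y powr (- \<theta>)" using elim(2) gt(1) \<tau> by (simp add: Gfun_def)
        moreover have Fp: "F (\<mu> y) > 0" using gt(1) \<tau> by (intro F_pos) simp
        ultimately have "(1 / F (\<mu> y)) powr k \<le> (\<epsilon> * norm y powr (- \<theta>)) powr k"
          using k0 by (intro powr_mono2) auto
        also have "\<dots> = \<epsilon> powr k * norm y powr (-(k * \<theta>))" by (simp add: powr_mult powr_powr mult.commute)
        also have "(1 / F (\<mu> y)) powr k = F (\<mu> y) powr (-k)" using Fp by (simp add: powr_divide powr_minus_divide)
        also have "\<mu> y = max \<tau> (\<mu>' y)" using gt(1) elim(1) by simp
        finally show ?thesis using Kc by simp
      qed
      then have "ennreal (F (max \<tau> (\<mu>' y)) powr (-k)) \<le> ennreal (\<epsilon> powr k * norm y powr (-(k * \<theta>)) + Kc)" by (rule ennreal_leI)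
      then show ?case using Kc by (simp add: ennreal_mult)
    qed
    have Z_ge: "heat \<theta> t (\<lambda>y. ennreal (F (max \<tau> (\<mu>' y)) powr (-k))) x \<le> ennreal (Z t)" if t: "0 < t" "t < T" for t x
    proof -
      have "heat \<theta> t (\<lambda>y. ennreal (F (max \<tau> (\<mu>' y)) powr (-k))) x
          \<le> heat \<theta> t (\<lambda>y. ennreal (\<epsilon> powr k) * ennreal (norm y powr (-(k * \<theta>))) + ennreal Kc) x"
        by (rule heat_mono_AE[OF h0_le])
      also have "\<dots> = heat \<theta> t (\<lambda>y. ennreal (\<epsilon> powr k) * ennreal (norm y powr (-(k * \<theta>)))) x + heat \<theta> t (\<lambda>y. ennreal Kc) x"
        by (rule heat_add) measurable
      also have "heat \<theta> t (\<lambda>y. ennreal (\<epsilon> powr k) * ennreal (norm y powr (-(k * \<theta>)))) x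
          = ennreal (\<epsilon> powr k) * heat \<theta> t (\<lambda>y. ennreal (norm y powr (-(k * \<theta>)))) x"
        by (rule heat_cmult) measurable
      also have "heat \<theta> t (\<lambda>y. ennreal Kc) x = ennreal Kc" by (rule heat_const[OF t(1) th])
      also have "ennreal (\<epsilon> powr k) * heat \<theta> t (\<lambda>y. ennreal (norm y powr (-(k * \<theta>)))) x + ennreal Kc
          \<le> ennreal (\<epsilon> powr k) * ennreal (C * t powr (-k)) + ennreal Kc"
        by (intro add_right_mono mult_left_mono C2 t) auto
      also have "\<dots> = ennreal (D * t powr (-k) + Kc)"
        using C Kc by (simp add: ennreal_mult'[symmetric] D_def mult_ac ennreal_plus[symmetric] del: ennreal_plus)
      also have "\<dots> \<le> ennreal (Z t)"
      proof (rule ennreal_leI)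
        have "T powr (-k) \<le> t powr (-k)" using t k0 by (intro powr_mono2') auto
        moreover have "T powr (-k) = Kc / D" using D Kc k0 by (simp add: T_def powr_powr powr_minus_divide)
        ultimately have "D * (Kc / D) \<le> D * t powr (-k)" using D by (intro mult_left_mono) auto
        then show "D * t powr (-k) + Kc \<le> Z t" using D by (simp add: Z_def)
      qed
      finally show ?thesis .
    qed
    define U where "U z = \<Phi> (2 * enn2real (heat \<theta> (snd z) (\<lambda>y. ennreal (F (max \<tau> (\<mu>' y)) powr (-k))) (fst z)))"
      for z :: "(real^'n) \<times> real"
    note supersol = supersolution[where T=T and Z=Z, OF th k0(1) k'(2) prof \<mu>'m]
    have sup: "0 < U z" "(2 * k / (k - k')) * snd z \<le> F (U z)"
      "heat \<theta> (snd z) (\<lambda>y. ennreal (\<mu>' y)) (fst z) + duhamel \<theta> (\<lambda>w. ennreal (f (U w))) z \<le> ennreal (U z)"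
      if "z \<in> QT T" for z
      unfolding U_def
      subgoal by (rule supersol(1)) (fact Z_ge Z_eq that)+
      subgoal by (rule supersol(2)) (fact Z_ge Z_eq that)+
      subgoal by (rule supersol(3)) (fact Z_ge Z_eq that)+
      done
    obtain u where u: "u \<in> borel_measurable borel" "\<And>z. 0 \<le> u z" "\<And>z. z \<in> QT T \<Longrightarrow> u z \<le> U z"
      "\<And>z. z \<in> QT T \<Longrightarrow> ennreal (u z) = heat \<theta> (snd z) (\<lambda>y. ennreal (\<mu>' y)) (fst z) + duhamel \<theta> (\<lambda>w. ennreal (f (u w))) z"
    proof (rule solution_below_supersolution)
      show "continuous_on {0..} f" by (rule f_cont)
      show "f a \<le> f b" if "0 \<le> a" "a \<le> b" for a b using that by (rule f_mono)
      show "(\<lambda>z. heat \<theta> (snd z) (\<lambda>y. ennreal (\<mu>' y)) (fst z)) \<in> borel_measurable borel"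
        by (rule heat_measurable) measurable
      show "0 \<le> U z" if "z \<in> QT T" for z using sup(1)[OF that] by simp
      show "heat \<theta> (snd z) (\<lambda>y. ennreal (\<mu>' y)) (fst z) + duhamel \<theta> (\<lambda>w. ennreal (f (U w))) z \<le> ennreal (U z)"
        if "z \<in> QT T" for z using sup(3)[OF that] .
    qed (rule that)
    have "is_solution \<theta> f \<mu> T u"
      unfolding is_solution_iff[OF th]
    proof (intro conjI ballI u(2))
      have "u \<in> borel_measurable lebesgue" using u(1) by (simp add: measurable_completion)
      then show "u \<in> borel_measurable (lebesgue_on (QT T))" by (rule measurable_restrict_space1)
      have "heat \<theta> t (\<lambda>y. ennreal (\<mu> y)) x = heat \<theta> t (\<lambda>y. ennreal (\<mu>' y)) x" for t and x :: "real^'n"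
        by (rule heat_cong_AE) (use \<mu>' in \<open>auto elim: eventually_mono\<close>)
      then show "AE z in lborel. z \<in> QT T \<longrightarrow> ennreal (u z) = heat \<theta> (snd z) (\<lambda>y. ennreal (\<mu> y)) (fst z) + duhamel \<theta> (\<lambda>w. ennreal (f (u w))) z"
        using u(4) by simp
    qed
    moreover have "Linf_loc_time T u"
      unfolding Linf_loc_time_def
    proof (intro allI impI)
      fix a b :: real assume ab: "0 < a \<and> a \<le> b \<and> b < T"
      let ?e = "2 * k / (k - k')"
      have e: "?e * a > 0" using k' k0 ab by simp
      \<comment> \<open>On [a,b] one has F(U) \<ge> \<open>?e * a\<close>. Since F decreases to 0,
        this caps U, and with it u, by a constant independent of x.\<close>
      have "eventually (\<lambda>u. F u < ?e * a) at_top" using order_tendstoD(2)[OF F_tendsto_0 e] .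
      then obtain c where c: "\<And>u. u \<ge> c \<Longrightarrow> F u < ?e * a" by (auto simp: eventually_at_top_linorder)
      define c' where "c' = max c 1"
      have c': "c' > 0" "F c' < ?e * a" using c[of c'] by (auto simp: c'_def)
      have "\<bar>u z\<bar> \<le> c'" if "snd z \<in> {a..b}" for z
      proof -
        have zQ: "z \<in> QT T" using that ab by (cases z) (auto simp: QT_def)
        have "?e * a \<le> ?e * snd z" using that k' k0 by (intro mult_left_mono) auto
        also have "\<dots> \<le> F (U z)" by (rule sup(2)[OF zQ])
        finally have "F c' \<le> F (U z)" using c'(2) by simp
        then have "U z \<le> c'" using F_le_iff[OF sup(1)[OF zQ] c'(1)] by simp
        then show ?thesis using u(2)[of z] u(3)[OF zQ] by simp
      qed
      then show "\<exists>C. AE z in lebesgue. snd z \<in> {a..b} \<longrightarrow> \<bar>u z\<bar> \<le> C" by (intro exI[of _ c'] AE_I2) auto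
    qed
    ultimately show "\<exists>T>0. \<exists>u. is_solution \<theta> f \<mu> T u \<and> Linf_loc_time T u" using T by blast
  qed
qed

end

section \<open>Nonexistence\<close>

text \<open>The exceptional set is enclosed in a Borel null set before the variables are exchanged,
  because the exchange needs measurability. The outer variable is time, so that almost every whole
  time slice is controlled.\<close>

lemma AE_lborel_slices:
  fixes P :: "'a::euclidean_space \<times> 'b::euclidean_space \<Rightarrow> bool"
  assumes "AE z in lborel. P z"
  shows "AE s in lborel. AE y in lborel. P (y, s)"
proof -
  obtain N where N: "N \<in> null_sets lborel" "{z \<in> space lborel. \<not> P z} \<subseteq> N"
    using assms by (auto simp: eventually_ae_filter)
  have N': "N \<in> null_sets (lborel \<Otimes>\<^sub>M lborel)" using N(1) by (simp only: lborel_prod)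
  have "AE z in lborel \<Otimes>\<^sub>M lborel. z \<notin> N" by (rule AE_not_in[OF N'])
  then have "AE y in lborel. AE s in lborel. (y, s) \<notin> N"
    by (rule lborel_pair.AE_pair)
  moreover have "{z \<in> space (lborel \<Otimes>\<^sub>M lborel). (fst z, snd z) \<notin> N} \<in> sets (lborel \<Otimes>\<^sub>M lborel)"
  proof -
    have "{z \<in> space (lborel \<Otimes>\<^sub>M lborel). (fst z, snd z) \<notin> N} = space (lborel \<Otimes>\<^sub>M lborel) - N" by auto
    then show ?thesis using null_setsD2[OF N'] by (simp only: sets.compl_sets)
  qed
  ultimately have "AE s in lborel. AE y in lborel. (y, s) \<notin> N"
    by (subst (asm) lborel_pair.AE_commute) auto
  then show ?thesis
  proof (rule eventually_mono)
    fix s :: 'b assume "AE y in lborel. (y, s) \<notin> N"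
    then show "AE y in lborel. P (y, s)"
      by (rule eventually_mono) (use N(2) in auto)
  qed
qed

text \<open>Lets an almost-everywhere equation be contradicted: it cannot fail at every point of a
  nonempty open set.\<close>

lemma not_AE_notin_open:
  fixes S :: "'a::euclidean_space set"
  assumes "open S" "S \<noteq> {}" shows "\<not> (AE z in lborel. z \<notin> S)"
proof
  assume "AE z in lborel. z \<notin> S"
  then have "S \<in> null_sets lborel" using assms(1) by (subst (asm) AE_iff_null_sets[symmetric]) auto
  then have "negligible S" by (simp add: negligible_iff_null_sets null_sets_completionI)
  then show False using open_not_negligible assms by blast
qed

text \<open>Reflection centres the kernel; then |x-y|^a \<le> 2^a (|x|^a + |y|^a). Inside |x| \<le>
  t^(1/\<theta>) the first term has the same order t^(a/\<theta>) as the moment.\<close>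

lemma heat_norm_powr:
  assumes th: "0 < \<theta>" "\<theta> \<le> 2" and a: "0 < a" "a < \<theta>"
  obtains C where "C > 0" "\<And>t (x::real^'n). t > 0 \<Longrightarrow> norm x \<le> t powr (1/\<theta>) \<Longrightarrow>
     heat \<theta> t (\<lambda>y. ennreal (norm y powr a)) x \<le> ennreal (C * t powr (a / \<theta>))"
proof -
  obtain C where C: "C > 0" "\<And>t. t > 0 \<Longrightarrow>
     (\<integral>\<^sup>+y. ennreal (Gamma_frac \<theta> (y::real^'n) t) * ennreal (norm y powr a) \<partial>lborel) \<le> ennreal (C * t powr (a / \<theta>))"
    using Gamma_frac_moment[OF th a, where 'n='n] by blast
  have "heat \<theta> t (\<lambda>y. ennreal (norm y powr a)) x \<le> ennreal (2 powr a * (1 + C) * t powr (a / \<theta>))"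
    if t: "t > 0" and x: "norm x \<le> t powr (1/\<theta>)" for t and x :: "real^'n"
  proof -
    have G1: "(\<integral>\<^sup>+y. ennreal (Gamma_frac \<theta> (y::real^'n) t) \<partial>lborel) = 1"
      using nn_integral_Gamma_frac[OF t th, of "0::real^'n"] by (simp add: Gamma_frac_uminus)
    have xa: "norm x powr a \<le> t powr (a / \<theta>)"
    proof -
      have "norm x powr a \<le> (t powr (1/\<theta>)) powr a" using x a by (intro powr_mono2) auto
      then show ?thesis by (simp add: powr_powr)
    qed
    let ?f = "\<lambda>y. ennreal (Gamma_frac \<theta> y t) * ennreal (norm (x - y) powr a)"
    have "heat \<theta> t (\<lambda>y. ennreal (norm y powr a)) x = (\<integral>\<^sup>+y. ?f (x - y) \<partial>lborel)"
      unfolding heat_def by simp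
    also have "\<dots> = (\<integral>\<^sup>+y. ?f y \<partial>lborel)"
      by (rule nn_integral_lborel_reflect) measurable
    also have "\<dots> \<le> (\<integral>\<^sup>+y. ennreal (2 powr a * t powr (a / \<theta>)) * ennreal (Gamma_frac \<theta> y t)
        + ennreal (2 powr a) * (ennreal (Gamma_frac \<theta> y t) * ennreal (norm (y::real^'n) powr a)) \<partial>lborel)"
    proof (rule nn_integral_mono)
      fix y :: "real^'n"
      have "norm (x - y) \<le> 2 * max (norm x) (norm y)" using norm_triangle_ineq4[of x y] by simp
      then have "norm (x - y) powr a \<le> (2 * max (norm x) (norm y)) powr a" using a by (intro powr_mono2) auto
      also have "\<dots> = 2 powr a * (max (norm x) (norm y)) powr a" by (rule powr_mult)
      also have "\<dots> \<le> 2 powr a * (norm x powr a + norm y powr a)"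
        by (intro mult_left_mono) (auto simp: max_def)
      also have "\<dots> \<le> 2 powr a * (t powr (a / \<theta>) + norm y powr a)"
        using xa by (intro mult_left_mono add_right_mono) auto
      finally have "ennreal (norm (x - y) powr a) \<le> ennreal (2 powr a * t powr (a / \<theta>) + 2 powr a * norm y powr a)"
        by (intro ennreal_leI) (simp add: distrib_left)
      also have "\<dots> = ennreal (2 powr a * t powr (a / \<theta>)) + ennreal (2 powr a) * ennreal (norm y powr a)"
        by (simp add: ennreal_mult)
      finally have "?f y \<le> ennreal (Gamma_frac \<theta> y t) * (ennreal (2 powr a * t powr (a / \<theta>)) + ennreal (2 powr a) * ennreal (norm y powr a))"
        by (rule mult_left_mono) simp
      then show "?f y \<le> ennreal (2 powr a * t powr (a / \<theta>)) * ennreal (Gamma_frac \<theta> y t)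
          + ennreal (2 powr a) * (ennreal (Gamma_frac \<theta> y t) * ennreal (norm y powr a))"
        by (simp only: distrib_left mult_ac)
    qed
    also have "\<dots> = ennreal (2 powr a * t powr (a / \<theta>)) * (\<integral>\<^sup>+y. ennreal (Gamma_frac \<theta> (y::real^'n) t) \<partial>lborel)
        + ennreal (2 powr a) * (\<integral>\<^sup>+y. ennreal (Gamma_frac \<theta> (y::real^'n) t) * ennreal (norm y powr a) \<partial>lborel)"
      by (subst nn_integral_add, measurable, subst nn_integral_cmult, measurable, subst nn_integral_cmult) auto
    also have "\<dots> \<le> ennreal (2 powr a * t powr (a / \<theta>)) * 1 + ennreal (2 powr a) * ennreal (C * t powr (a / \<theta>))"
      unfolding G1 by (intro add_mono mult_left_mono C(2) t) auto
    also have "\<dots> = ennreal (2 powr a * t powr (a / \<theta>) + 2 powr a * (C * t powr (a / \<theta>)))"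
      using C(1) by (simp add: ennreal_mult'[symmetric])
    also have "2 powr a * t powr (a / \<theta>) + 2 powr a * (C * t powr (a / \<theta>)) = 2 powr a * (1 + C) * t powr (a / \<theta>)"
      by (simp add: algebra_simps)
    finally show ?thesis .
  qed
  moreover have "2 powr a * (1 + C) > 0" using C(1) by simp
  ultimately show ?thesis using that by blast
qed

context admissible
begin

text \<open>If f stayed below y, F would decrease with slope at least 1/y in absolute value and
  become negative.\<close>

lemma f_unbounded: assumes "w > 0" obtains v where "v \<ge> w" "f v \<ge> y"
proof -
  have "\<exists>v\<ge>w. f v \<ge> y"
  proof (rule ccontr)
    assume "\<not> (\<exists>v\<ge>w. f v \<ge> y)"
    then have lt: "f v < y" if "v \<ge> w" for v using that by auto
    have y: "y > 0" using lt[of w] f_pos[OF assms] by simp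
    \<comment> \<open>Makes (v - w)/y equal to F(w) + 1, which exceeds the total decrease F can
      afford.\<close>
    define v where "v = w + y * (F w + 1)"
    have v: "v \<ge> w" using y F_nonneg[OF assms] by (simp add: v_def)
    have "(v - w) / y \<le> (v - w) / f v" using lt[OF v] v f_pos[of v] assms by (intro divide_left_mono) auto
    also have "\<dots> \<le> F w - F v" using F_diff_ge[OF assms v] .
    also have "\<dots> \<le> F w" using F_nonneg[of v] v assms by simp
    finally show False using y by (simp add: v_def)
  qed
  then show ?thesis using that by blast
qed

text \<open>Compares \<open>W\<close> with the levels \<open>v j\<close> at which \<open>f\<close> has doubled \<open>j\<close> times: \<open>W\<close> climbs from each level
  to the next within time \<open>4 * (F (v j) - F (v (Suc j)))\<close>, so it would be infinite after time \<open>4 * F w\<close>.\<close>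

lemma growth_time_bound:
  assumes w: "w > 0" "W 0 \<ge> w"
    and grow: "\<And>s s'. 0 \<le> s \<Longrightarrow> s \<le> s' \<Longrightarrow> s' \<le> t \<Longrightarrow> W s + (s' - s) * (f (W s) / 2) \<le> W s'"
  shows "t \<le> 4 * F w"
proof (rule ccontr)
  assume "\<not> t \<le> 4 * F w"
  then have t: "4 * F w < t" by simp
  have fw: "f w > 0" by (rule f_pos[OF w(1)])
  have "\<exists>v\<ge>w. f v = 2 ^ j * f w" for j :: nat
  proof -
    obtain b where b: "b \<ge> w" "f b \<ge> 2 ^ j * f w" using f_unbounded[OF w(1)] by blast
    have "f w \<le> 2 ^ j * f w" using fw by simp
    moreover have "continuous_on {w..b} f" using w(1) by (intro f_cont_pos) auto
    ultimately show ?thesis using IVT'[of f w "2 ^ j * f w" b] b by auto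
  qed
  then obtain v' where v': "\<And>j::nat. v' j \<ge> w" "\<And>j. f (v' j) = 2 ^ j * f w" by metis
  \<comment> \<open>f may be constant near \<open>w\<close>, so the level 0 furnished by the
    intermediate value theorem could lie above \<open>w\<close>; it is reset to
    \<open>w\<close>.\<close>
  define v where "v j = (if j = 0 then w else v' j)" for j
  have v: "v j \<ge> w" "f (v j) = 2 ^ j * f w" "v 0 = w" for j using v' by (auto simp: v_def)
  have v_pos: "v j > 0" for j using v(1)[of j] w(1) by simp
  have v_step: "v j < v (Suc j)" for j
  proof (rule ccontr)
    assume "\<not> v j < v (Suc j)"
    then have "f (v (Suc j)) \<le> f (v j)" using v_pos[of "Suc j"] by (intro f_mono) auto
    then show False using v(2) fw by simp
  qed
  \<comment> \<open>The factor 4 is 2 times 2: W grows at half the rate f, and between consecutive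
    levels f is bounded below only by half of the upper value that enters
    \<open>F_diff_ge\<close>.\<close>
  define s where "s j = 4 * (F w - F (v j))" for j
  have s: "0 \<le> s j" "s j \<le> t" for j
    using F_antimono[OF w(1) v(1)[of j]] F_nonneg[OF v_pos[of j]] t by (auto simp: s_def)
  have reach: "v j \<le> W (s j)" for j
  proof (induction j)
    case 0
    have "v 0 = w" by (rule v(3))
    then show ?case using w(2) by (simp add: s_def)
  next
    case (Suc j)
    have Wj: "v j \<le> W (s j)" by (rule Suc)
    have "(v (Suc j) - v j) / f (v (Suc j)) \<le> F (v j) - F (v (Suc j))"
      using F_diff_ge[OF v_pos less_imp_le[OF v_step]] .
    then have ds: "2 * (v (Suc j) - v j) / f (v j) \<le> s (Suc j) - s j"
      using v(2) fw by (simp add: s_def field_simps)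
    have fpos: "f (v j) > 0" by (rule f_pos[OF v_pos])
    have le: "s j \<le> s (Suc j)" unfolding s_def using F_antimono[OF v_pos less_imp_le[OF v_step]] by simp
    have "v (Suc j) = v j + (2 * (v (Suc j) - v j) / f (v j)) * (f (v j) / 2)" using fpos by (simp add: field_simps)
    also have "\<dots> \<le> v j + (s (Suc j) - s j) * (f (v j) / 2)"
      using ds fpos by (intro add_left_mono mult_right_mono) auto
    also have "\<dots> \<le> W (s j) + (s (Suc j) - s j) * (f (W (s j)) / 2)"
      using Wj le f_mono[OF less_imp_le[OF v_pos] Wj] by (intro add_mono mult_left_mono) auto
    also have "\<dots> \<le> W (s (Suc j))" using grow[OF s(1) le s(2)] .
    finally show ?case .
  qed
  have W_mono: "W (s j) \<le> W t" for j
  proof -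
    have "f (W (s j)) > 0" using reach[of j] v_pos[of j] by (intro f_pos) simp
    then have "W (s j) \<le> W (s j) + (t - s j) * (f (W (s j)) / 2)" using s[of j] by simp
    also have "\<dots> \<le> W t" using grow[OF s(1) s(2) order_refl] .
    finally show ?thesis .
  qed
  have "2 ^ j * f w \<le> f (W t)" for j
    using f_mono[OF less_imp_le[OF v_pos] order_trans[OF reach W_mono], of j] v(2)[of j] by simp
  moreover obtain j :: nat where "f (W t) / f w < 2 ^ j" using real_arch_pow[of 2] by auto
  ultimately show False using fw by (simp add: field_simps) (meson not_le)
qed

text \<open>The function f(max \<sigma> u) - f \<sigma> is flat up to \<sigma> and convex and
  nondecreasing beyond it, hence has supporting lines of nonnegative slope on the whole line
  although f need not be convex near 0. The inequality is arranged without differences of u and m,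
  so that it transfers to [0,\<infinity>].\<close>

lemma convex_minorant:
  assumes "hyp_C f"
  obtains \<sigma> where "\<sigma> > 0" "\<And>m. \<exists>c\<ge>0. \<forall>u. f (max \<sigma> m) - f \<sigma> + c * u \<le> f (max \<sigma> u) - f \<sigma> + c * m"
proof -
  obtain a where a: "a \<ge> 0" "convex_on {a..} f" using assms by (auto simp: hyp_C_def)
  define \<sigma> where "\<sigma> = max a tau + 1"
  have \<sigma>: "\<sigma> > 0" "\<sigma> > a" "\<sigma> > tau" using a tau(1) by (auto simp: \<sigma>_def)
  have "\<exists>c\<ge>0. \<forall>u. f (max \<sigma> m) - f \<sigma> + c * u \<le> f (max \<sigma> u) - f \<sigma> + c * m" for m
  proof (cases "m \<le> \<sigma>")
    case True
    have "f \<sigma> \<le> f (max \<sigma> u)" for u using \<sigma> by (intro f_mono) auto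
    then show ?thesis using True by (intro exI[of _ 0]) (auto simp: max_absorb1)
  next
    case False
    then have m: "m > \<sigma>" by simp
    let ?c = "deriv f m"
    have tang: "f u - f m \<ge> ?c * (u - m)" if "u \<ge> a" for u
    proof (rule convex_on_imp_above_tangent[OF a(2)])
      show "m \<in> interior {a..}" using m \<sigma> by (simp add: interior_Ici[of "a - 1"])
      show "(f has_field_derivative ?c) (at m within {a..})"
        by (rule has_field_derivative_at_within[OF tau(2)]) (use m \<sigma> in simp)
    qed (use that in auto)
    have "?c * (m - \<sigma>) \<ge> f m - f \<sigma>" using tang[of \<sigma>] \<sigma> by (simp add: algebra_simps)
    moreover have "f m - f \<sigma> \<ge> 0" using f_mono[of \<sigma> m] m \<sigma> by simp
    ultimately have "0 \<le> ?c * (m - \<sigma>)" by linarith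
    then have c: "?c \<ge> 0" using m by (simp add: zero_le_mult_iff)
    have "f (max \<sigma> m) - f \<sigma> + ?c * u \<le> f (max \<sigma> u) - f \<sigma> + ?c * m" for u
    proof -
      have "f (max \<sigma> u) - f m \<ge> ?c * (max \<sigma> u - m)" using \<sigma> by (intro tang) auto
      moreover have "?c * u \<le> ?c * max \<sigma> u" using c by (intro mult_left_mono) auto
      moreover have "max \<sigma> m = m" using m by simp
      ultimately show ?thesis by (simp add: algebra_simps)
    qed
    then show ?thesis using c by blast
  qed
  then show ?thesis using that \<sigma>(1) by blast
qed

text \<open>The equation at (x,t) makes the Duhamel integral there finite, hence all its partial
  integrals over (0,s). By the semigroup law these partial integrals, added to the linear term, are
  the means of u at time s under the kernel of time t - s. The supporting lines of the minorant turn
  this identity into an integral inequality for the means.\<close>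

lemma blow_up_time_bound:
  fixes u :: "(real^'n) \<times> real \<Rightarrow> real" and \<mu> :: "real^'n \<Rightarrow> real"
  assumes th: "0 < \<theta>" "\<theta> \<le> 2" and fnn: "\<And>a. a \<ge> 0 \<Longrightarrow> f a \<ge> 0"
    and \<sigma>: "\<sigma> > 0" and minorant: "\<And>m. \<exists>c\<ge>0. \<forall>u. f (max \<sigma> m) - f \<sigma> + c * u \<le> f (max \<sigma> u) - f \<sigma> + c * m"
    and \<mu>[measurable]: "\<mu> \<in> borel_measurable borel"
    and u: "u \<in> borel_measurable borel" "\<And>z. u z \<ge> 0"
    and eq: "AE z in lborel. z \<in> QT T \<longrightarrow>
        ennreal (u z) = heat \<theta> (snd z) (\<lambda>y. ennreal (\<mu> y)) (fst z) + duhamel \<theta> (\<lambda>w. ennreal (f (u w))) z"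
    and t: "0 < t" "t < T"
    and eq_xt: "ennreal (u (x, t)) = heat \<theta> t (\<lambda>y. ennreal (\<mu> y)) x + duhamel \<theta> (\<lambda>w. ennreal (f (u w))) (x, t)"
    and w: "heat \<theta> t (\<lambda>y. ennreal (\<mu> y)) x = ennreal w" "w \<ge> \<sigma>" "f w \<ge> 2 * f \<sigma>"
  shows "t \<le> 4 * F w"
proof -
  define v where "v z = ennreal (f (u z))" for z
  have "(\<lambda>z. f (max 0 (u z))) \<in> borel_measurable borel" by (rule measurable_comp_max_0[OF f_cont u(1)])
  then have vm: "v \<in> borel_measurable borel" unfolding v_def using u(2) by (simp add: max_absorb2)
  have [measurable]: "v \<in> borel_measurable (borel \<Otimes>\<^sub>M borel)" "u \<in> borel_measurable (borel \<Otimes>\<^sub>M borel)"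
    using vm u(1) by (simp_all add: borel_prod)
  define g where "g m = f (max \<sigma> m) - f \<sigma>" for m
  have g_mono: "g a \<le> g b" if "a \<le> b" for a b unfolding g_def using \<sigma> that f_mono[of "max \<sigma> a" "max \<sigma> b"] by simp
  have g0: "g a \<ge> 0" for a unfolding g_def using \<sigma> f_mono[of \<sigma> "max \<sigma> a"] by simp
  have g_le: "g a \<le> f a" if "a \<ge> 0" for a
    using fnn[of a] fnn[of \<sigma>] \<sigma> that by (auto simp: g_def max_def)
  have gm: "g \<in> borel_measurable borel"
    by (rule borel_measurable_mono) (auto intro!: monoI g_mono)
  define V where "V s = heat \<theta> (t - s) (\<lambda>y. v (y, s)) x" for s
  have [measurable]: "V \<in> borel_measurable borel" unfolding V_def by measurable
  \<comment> \<open>The mean of u at time s is defined through the Duhamel integral, so that it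
    exists for every s in [0,t], including both ends, and is monotone; the identification with an
    actual mean holds for almost every s.\<close>
  define Winf where "Winf s = ennreal w + (\<integral>\<^sup>+r. indicator {0<..<s} r * V r \<partial>lborel)" for s
  have Winf_mono: "Winf s \<le> Winf s'" if "s \<le> s'" for s s'
    unfolding Winf_def using that by (intro add_left_mono nn_integral_mono) (auto simp: indicator_def)
  have Winf_t: "Winf t = ennreal (u (x, t))"
    unfolding eq_xt w(1) Winf_def duhamel_def V_def v_def by simp
  define W where "W s = enn2real (Winf s)" for s
  have W_eq: "Winf s = ennreal (W s)" if "s \<le> t" for s
  proof -
    have "Winf s \<le> ennreal (u (x, t))" using Winf_mono[OF that] by (simp only: Winf_t)
    also have "\<dots> < \<infinity>" by simp
    finally show ?thesis by (simp add: W_def)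
  qed
  have W_nn: "W s \<ge> 0" for s by (simp add: W_def)
  have W_mono: "W s \<le> W s'" if "s \<le> s'" "s' \<le> t" for s s'
  proof -
    have "ennreal (W s) \<le> ennreal (W s')" using Winf_mono[OF that(1)] W_eq[of s] W_eq[of s'] that by simp
    then show ?thesis using W_nn by simp
  qed
  have w0: "w \<ge> 0" using w(2) \<sigma> by simp
  have W_0: "W 0 = w" using w0 by (simp add: W_def Winf_def)

  \<comment> \<open>Apply the semigroup for time t - s to the equation at time s: the times add up
    to t in the linear term and to t - r under the Duhamel integral.\<close>
  have slice: "heat \<theta> (t - s) (\<lambda>y. ennreal (u (y, s))) x = Winf s"
    if s: "0 < s" "s < t" and AE: "AE y in lborel. (y, s) \<in> QT T \<longrightarrow>
        ennreal (u (y, s)) = heat \<theta> s (\<lambda>y. ennreal (\<mu> y)) y + duhamel \<theta> v (y, s)" for s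
  proof -
    have ts: "t - s > 0" using s by simp
    have "AE y in lborel. ennreal (u (y, s)) = heat \<theta> s (\<lambda>y. ennreal (\<mu> y)) y + duhamel \<theta> v (y, s)"
      using AE by (rule eventually_mono) (use s t in \<open>auto simp: QT_def\<close>)
    then have "heat \<theta> (t - s) (\<lambda>y. ennreal (u (y, s))) x
        = heat \<theta> (t - s) (\<lambda>y. heat \<theta> s (\<lambda>y. ennreal (\<mu> y)) y + duhamel \<theta> v (y, s)) x"
      by (rule heat_cong_AE)
    also have "\<dots> = heat \<theta> (t - s) (heat \<theta> s (\<lambda>y. ennreal (\<mu> y))) x + heat \<theta> (t - s) (\<lambda>y. duhamel \<theta> v (y, s)) x"
    proof (rule heat_add)
      show "heat \<theta> s (\<lambda>y. ennreal (\<mu> y)) \<in> borel_measurable borel" by measurable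
      have "duhamel \<theta> v \<in> borel_measurable (borel \<Otimes>\<^sub>M borel)" using duhamel_measurable[OF vm] by (simp add: borel_prod)
      then show "(\<lambda>y. duhamel \<theta> v (y, s)) \<in> borel_measurable borel" by measurable
    qed
    also have "heat \<theta> (t - s) (heat \<theta> s (\<lambda>y. ennreal (\<mu> y))) x = heat \<theta> (t - s + s) (\<lambda>y. ennreal (\<mu> y)) x"
      by (rule heat_semigroup[OF ts s(1) th]) measurable
    also have "t - s + s = t" by simp
    also have "heat \<theta> (t - s) (\<lambda>y. duhamel \<theta> v (y, s)) x
       = heat \<theta> (t - s) (\<lambda>y. \<integral>\<^sup>+r. indicator {0<..<s} r * heat \<theta> (s - r) (\<lambda>y'. v (y', r)) y \<partial>lborel) x"
      unfolding duhamel_def by simp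
    also have "\<dots> = (\<integral>\<^sup>+r. heat \<theta> (t - s) (\<lambda>y. indicator {0<..<s} r * heat \<theta> (s - r) (\<lambda>y'. v (y', r)) y) x \<partial>lborel)"
      unfolding indicator_Ioo_eq_if by (rule heat_nn_integral) measurable
    also have "\<dots> = (\<integral>\<^sup>+r. indicator {0<..<s} r * V r \<partial>lborel)"
    proof (rule nn_integral_cong)
      fix r
      have "heat \<theta> (t - s) (\<lambda>y. indicator {0<..<s} r * heat \<theta> (s - r) (\<lambda>y'. v (y', r)) y) x
         = indicator {0<..<s} r * heat \<theta> (t - s) (heat \<theta> (s - r) (\<lambda>y'. v (y', r))) x"
        by (rule heat_cmult) measurable
      also have "\<dots> = indicator {0<..<s} r * V r"
      proof (cases "0 < r \<and> r < s")
        case True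
        have "heat \<theta> (t - s) (heat \<theta> (s - r) (\<lambda>y'. v (y', r))) x = heat \<theta> (t - s + (s - r)) (\<lambda>y'. v (y', r)) x"
          using True by (intro heat_semigroup[OF ts _ th]) auto
        then show ?thesis by (simp add: V_def)
      qed auto
      finally show "heat \<theta> (t - s) (\<lambda>y. indicator {0<..<s} r * heat \<theta> (s - r) (\<lambda>y'. v (y', r)) y) x
        = indicator {0<..<s} r * V r" .
    qed
    finally show ?thesis by (simp add: Winf_def w(1))
  qed

  \<comment> \<open>Averages the supporting line at the mean \<open>W s\<close>; the linear term has
    the same value on both sides and is finite, so it cancels.\<close>
  have jensen: "ennreal (g (W s)) \<le> V s"
    if s: "0 < s" "s < t" and sl: "heat \<theta> (t - s) (\<lambda>y. ennreal (u (y, s))) x = Winf s" for s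
  proof -
    have ts: "t - s > 0" using s by simp
    obtain c where c: "c \<ge> 0" "\<And>a. g (W s) + c * a \<le> g a + c * W s"
      using minorant[of "W s"] unfolding g_def by blast
    have [measurable]: "(\<lambda>y. g (u (y, s))) \<in> borel_measurable borel"
      by (rule measurable_compose[OF _ gm]) measurable
    have "ennreal (g (W s)) + ennreal c * ennreal (W s)
       = heat \<theta> (t - s) (\<lambda>_. ennreal (g (W s))) x + heat \<theta> (t - s) (\<lambda>y. ennreal c * ennreal (u (y, s))) x"
    proof -
      have "heat \<theta> (t - s) (\<lambda>y. ennreal c * ennreal (u (y, s))) x = ennreal c * heat \<theta> (t - s) (\<lambda>y. ennreal (u (y, s))) x"
        by (rule heat_cmult) measurable
      then show ?thesis unfolding heat_const[OF ts th] sl using W_eq[of s] s by simp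
    qed
    also have "\<dots> = heat \<theta> (t - s) (\<lambda>y. ennreal (g (W s)) + ennreal c * ennreal (u (y, s))) x"
      by (rule heat_add[symmetric]) measurable
    also have "\<dots> \<le> heat \<theta> (t - s) (\<lambda>y. ennreal (g (u (y, s))) + ennreal (c * W s)) x"
    proof (rule heat_mono)
      fix y
      have "ennreal (g (W s) + c * u (y, s)) \<le> ennreal (g (u (y, s)) + c * W s)" by (rule ennreal_leI[OF c(2)])
      then show "ennreal (g (W s)) + ennreal c * ennreal (u (y, s)) \<le> ennreal (g (u (y, s))) + ennreal (c * W s)"
        using g0 c(1) u(2) W_nn[of s] by (simp add: ennreal_mult)
    qed
    also have "\<dots> = heat \<theta> (t - s) (\<lambda>y. ennreal (g (u (y, s)))) x + heat \<theta> (t - s) (\<lambda>y. ennreal (c * W s)) x"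
      by (rule heat_add) measurable
    also have "heat \<theta> (t - s) (\<lambda>y. ennreal (c * W s)) x = ennreal (c * W s)" by (rule heat_const[OF ts th])
    also have "heat \<theta> (t - s) (\<lambda>y. ennreal (g (u (y, s)))) x + ennreal (c * W s) \<le> V s + ennreal (c * W s)"
      unfolding V_def v_def using g_le u(2) by (intro add_right_mono heat_mono ennreal_leI) blast
    finally have "ennreal (c * W s) + ennreal (g (W s)) \<le> ennreal (c * W s) + V s"
      using c(1) W_nn[of s] by (simp add: ennreal_mult add.commute)
    then show ?thesis unfolding ennreal_add_left_cancel_le by simp
  qed

  have V_ge: "AE s in lborel. 0 < s \<and> s < t \<longrightarrow> ennreal (g (W s)) \<le> V s"
    using AE_lborel_slices[OF eq]
  proof (rule eventually_mono)
    fix s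
    assume "AE y in lborel. (y, s) \<in> QT T \<longrightarrow> ennreal (u (y, s))
        = heat \<theta> (snd (y, s)) (\<lambda>y. ennreal (\<mu> y)) (fst (y, s)) + duhamel \<theta> (\<lambda>w. ennreal (f (u w))) (y, s)"
    then have AE: "AE y in lborel. (y, s) \<in> QT T \<longrightarrow>
        ennreal (u (y, s)) = heat \<theta> s (\<lambda>y. ennreal (\<mu> y)) y + duhamel \<theta> v (y, s)"
      unfolding v_def by simp
    show "0 < s \<and> s < t \<longrightarrow> ennreal (g (W s)) \<le> V s"
      using jensen slice AE by blast
  qed

  \<comment> \<open>For r between s and s' the integrand \<open>V r\<close> is at least g(W r),
    hence at least g(W s) by monotonicity; this replaces a differential inequality.\<close>
  have "W s + (s' - s) * (f (W s) / 2) \<le> W s'" if ss: "0 \<le> s" "s \<le> s'" "s' \<le> t" for s s'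
  proof -
    have "Winf s + ennreal ((s' - s) * g (W s)) \<le> Winf s'"
    proof -
      have "ennreal ((s' - s) * g (W s)) = ennreal (g (W s)) * emeasure lborel {s<..<s'}"
        using ss g0 by (simp add: ennreal_mult mult.commute)
      also have "\<dots> = (\<integral>\<^sup>+r. ennreal (g (W s)) * indicator {s<..<s'} r \<partial>lborel)"
        by (rule nn_integral_cmult_indicator[symmetric]) simp
      finally have "(\<integral>\<^sup>+r. indicator {0<..<s} r * V r \<partial>lborel) + ennreal ((s' - s) * g (W s))
         = (\<integral>\<^sup>+r. indicator {0<..<s} r * V r + ennreal (g (W s)) * indicator {s<..<s'} r \<partial>lborel)"
        by (subst nn_integral_add) (auto simp: indicator_Ioo_eq_if)
      also have "\<dots> \<le> (\<integral>\<^sup>+r. indicator {0<..<s'} r * V r \<partial>lborel)"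
      proof (rule nn_integral_mono_AE)
        show "AE r in lborel. indicator {0<..<s} r * V r + ennreal (g (W s)) * indicator {s<..<s'} r \<le> indicator {0<..<s'} r * V r"
          using V_ge
        proof (rule eventually_mono)
          fix r assume r: "0 < r \<and> r < t \<longrightarrow> ennreal (g (W r)) \<le> V r"
          have "ennreal (g (W s)) \<le> V r" if "s < r" "r < s'"
          proof -
            have "ennreal (g (W s)) \<le> ennreal (g (W r))" using that ss W_mono[of s r] by (intro ennreal_leI g_mono) simp
            also have "\<dots> \<le> V r" using r that ss by simp
            finally show ?thesis .
          qed
          then show "indicator {0<..<s} r * V r + ennreal (g (W s)) * indicator {s<..<s'} r \<le> indicator {0<..<s'} r * V r"
            using ss by (auto simp: indicator_def)
        qed
      qed
      finally show ?thesis unfolding Winf_def by (simp add: add.assoc add_left_mono)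
    qed
    then have "ennreal (W s + (s' - s) * g (W s)) \<le> ennreal (W s')"
      using W_eq[of s] W_eq[of s'] ss W_nn[of s] g0 by simp
    then have 1: "W s + (s' - s) * g (W s) \<le> W s'" using W_nn by simp
    have "W s \<ge> w" using W_mono[of 0 s] W_0 ss by simp
    then have "f (W s) \<ge> f w" "W s \<ge> \<sigma>" using w(2) w0 by (auto intro: f_mono)
    \<comment> \<open>Here f(W s) \<ge> f(w) \<ge> 2 f(\<sigma>), so subtracting f(\<sigma>) costs
      at most half.\<close>
    then have "f (W s) / 2 \<le> g (W s)" using w(3) by (simp add: g_def max_absorb2)
    then have "(s' - s) * (f (W s) / 2) \<le> (s' - s) * g (W s)" using ss by (intro mult_left_mono) auto
    then show ?thesis using 1 by linarith
  qed
  then show ?thesis using growth_time_bound[of w W t] w(2) \<sigma> W_0 by simp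
qed

end

lemma duhamel_cong_AE:
  fixes v w :: "(real^'n) \<times> real \<Rightarrow> ennreal"
  assumes "AE z in lborel. z \<in> QT T \<longrightarrow> v z = w z" "z \<in> QT T"
  shows "duhamel \<theta> v z = duhamel \<theta> w z"
  unfolding duhamel_def
proof (rule nn_integral_cong_AE)
  show "AE s in lborel. indicator {0<..<snd z} s * heat \<theta> (snd z - s) (\<lambda>y. v (y, s)) (fst z)
      = indicator {0<..<snd z} s * heat \<theta> (snd z - s) (\<lambda>y. w (y, s)) (fst z)"
    using AE_lborel_slices[OF assms(1)]
  proof (rule eventually_mono)
    fix s assume AE: "AE y in lborel. (y, s) \<in> QT T \<longrightarrow> v (y, s) = w (y, s)"
    show "indicator {0<..<snd z} s * heat \<theta> (snd z - s) (\<lambda>y. v (y, s)) (fst z)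
      = indicator {0<..<snd z} s * heat \<theta> (snd z - s) (\<lambda>y. w (y, s)) (fst z)"
    proof (cases "0 < s \<and> s < snd z")
      case True
      then have "AE y in lborel. v (y, s) = w (y, s)"
        using AE assms(2) by (auto simp: QT_def elim!: eventually_mono)
      then show ?thesis by (simp add: heat_cong_AE)
    qed auto
  qed
qed

text \<open>Changing u on a null set alters almost no time slice, so the Duhamel term is unchanged
  at every point of \<open>QT T\<close>; the new function is Borel and nonnegative
  everywhere.\<close>

lemma solution_borel_version:
  fixes \<mu> :: "real^'n \<Rightarrow> real"
  assumes th: "0 < \<theta>" "\<theta> \<le> 2" and sol: "is_solution \<theta> f \<mu> T u" and \<mu>': "AE x in lborel. \<mu> x = \<mu>' x"
  obtains u' where "u' \<in> borel_measurable borel" "\<And>z. u' z \<ge> 0"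
    "AE z in lborel. z \<in> QT T \<longrightarrow>
        ennreal (u' z) = heat \<theta> (snd z) (\<lambda>y. ennreal (\<mu>' y)) (fst z) + duhamel \<theta> (\<lambda>w. ennreal (f (u' w))) z"
proof -
  have unn: "\<And>z. z \<in> QT T \<Longrightarrow> u z \<ge> 0" and um: "u \<in> borel_measurable (lebesgue_on (QT T))"
    and eq: "AE z in lborel. z \<in> QT T \<longrightarrow> ennreal (u z) = heat \<theta> (snd z) (\<lambda>y. ennreal (\<mu> y)) (fst z) + duhamel \<theta> (\<lambda>w. ennreal (f (u w))) z"
    using sol unfolding is_solution_iff[OF th] by auto
  have "(\<lambda>z. if z \<in> QT T then u z else 0) \<in> borel_measurable lebesgue"
    by (rule borel_measurable_if_I[OF um]) simp
  then obtain g where g: "g \<in> borel_measurable lborel" "AE z in lborel. (if z \<in> QT T then u z else 0) = g z"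
    using completion_ex_borel_measurable_real by blast
  define u' where "u' z = max 0 (g z)" for z
  have uu': "AE z in lborel. z \<in> QT T \<longrightarrow> u z = u' z"
    using g(2)
  proof (rule eventually_mono)
    fix z assume "(if z \<in> QT T then u z else 0) = g z"
    then show "z \<in> QT T \<longrightarrow> u z = u' z" using unn[of z] by (auto simp: u'_def)
  qed
  then have fuu': "AE z in lborel. z \<in> QT T \<longrightarrow> ennreal (f (u z)) = ennreal (f (u' z))"
    by (rule eventually_mono) auto
  have \<mu>\<mu>': "heat \<theta> t (\<lambda>y. ennreal (\<mu> y)) x = heat \<theta> t (\<lambda>y. ennreal (\<mu>' y)) x" for t x
    by (rule heat_cong_AE) (use \<mu>' in \<open>auto elim: eventually_mono\<close>)
  show ?thesis
  proof (rule that[of u'])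
    show "u' \<in> borel_measurable borel" unfolding u'_def using g(1) by simp
    show "u' z \<ge> 0" for z by (simp add: u'_def)
    show "AE z in lborel. z \<in> QT T \<longrightarrow>
        ennreal (u' z) = heat \<theta> (snd z) (\<lambda>y. ennreal (\<mu>' y)) (fst z) + duhamel \<theta> (\<lambda>w. ennreal (f (u' w))) z"
      using eq uu'
    proof eventually_elim
      case (elim z)
      then show ?case using duhamel_cong_AE[OF fuu', of z \<theta>] by (auto simp: \<mu>\<mu>')
    qed
  qed
qed

context admissible
begin

lemma not_locally_solvable_if_large:
  assumes th: "0 < \<theta>" "\<theta> \<le> 2" and fnn: "\<And>a. a \<ge> 0 \<Longrightarrow> f a \<ge> 0" and cvx: "hyp_C f"
  shows "\<exists>\<gamma>>0. \<forall>\<mu> :: real^'n \<Rightarrow> real. nonneg_loc_integrable \<mu> \<and>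
     (\<exists>r>0. AE x in lebesgue. x \<in> ball 0 r \<longrightarrow> Gfun f (\<mu> x) \<ge> \<gamma> * norm x powr (- \<theta>))
       \<longrightarrow> \<not> locally_solvable \<theta> f \<mu>"
proof -
  obtain \<sigma> where \<sigma>: "\<sigma> > 0" and minorant: "\<And>m. \<exists>c\<ge>0. \<forall>u. f (max \<sigma> m) - f \<sigma> + c * u \<le> f (max \<sigma> u) - f \<sigma> + c * m"
    using convex_minorant[OF cvx] by blast
  have "1/2 < q" using q_ge_1 by simp
  then obtain a where a: "a > tau" "\<And>u v. a \<le> u \<Longrightarrow> u \<le> v \<Longrightarrow> f u * F u powr (1/2) \<le> f v * F v powr (1/2)"
    by (rule fF_powr_eventually_mono) blast
  \<comment> \<open>One threshold for everything: beyond it F^(1/2) is convex, the minorant is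
    active, and f has at least doubled its value at \<sigma>, as the blow-up bound requires.\<close>
  have "0 < max a \<sigma>" using \<sigma> by linarith
  then obtain \<tau> where \<tau>: "\<tau> \<ge> max a \<sigma>" "f \<tau> \<ge> 2 * f \<sigma>"
    by (rule f_unbounded)
  have \<tau>': "\<tau> > 0" "\<tau> \<ge> a" "\<tau> \<ge> \<sigma>" using \<tau> \<sigma> by auto
  define H where "H u = F u powr (1/2)" for u
  \<comment> \<open>The negative of H'; it is decreasing since f F^(1/2) is increasing.\<close>
  define c where "c u = (1/2) / (f u * F u powr (1/2))" for u
  have cden: "f u * F u powr (1/2) > 0" if "u \<ge> \<tau>" for u using f_pos[of u] F_pos[of u] that \<tau>' by simp
  have c0: "c u > 0" if "u \<ge> \<tau>" for u using cden[OF that] by (simp add: c_def)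
  have c_anti: "c v \<le> c u" if "\<tau> \<le> u" "u \<le> v" for u v
    unfolding c_def using a(2)[of u v] cden[of u] cden[of v] that \<tau>' by (intro divide_left_mono) auto
  have H_anti: "H v \<le> H u" if "0 < u" "u \<le> v" for u v
    unfolding H_def using that F_antimono[OF that] F_nonneg[of v] by (intro powr_mono2) auto
  have tang: "H m + c m * (m - u) \<le> H u" if "m \<ge> \<tau>" "u \<ge> \<tau>" for m u
  proof -
    have "H m + (- c m) * (u - m) \<le> H u"
    proof (rule tangent_below_if_mono_deriv[where a=\<tau> and g=H])
      show "(H has_real_derivative - c x) (at x)" if "x \<ge> \<tau>" for x
        using F_powr_has_derivative[of x "1/2"] that \<tau>' unfolding H_def c_def by simp
      show "- c x \<le> - c y" if "\<tau> \<le> x" "x \<le> y" for x y using c_anti[OF that] by simp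
    qed (use that in auto)
    then show ?thesis by (simp add: algebra_simps)
  qed
  define Mb where "Mb = H \<tau> + c \<tau> * \<tau>"
  have H0: "H u \<ge> 0" for u by (simp add: H_def)
  have Mb: "Mb \<ge> H \<tau>" "Mb > 0"
    using c0[of \<tau>] \<tau>' F_pos[of \<tau>] by (auto simp: Mb_def H_def intro!: add_nonneg_pos mult_pos_pos)
  \<comment> \<open>The tangent inequality extended to all u \<ge> 0: below \<tau>, where convexity
    is not known, H is replaced by the constant \<open>Mb\<close>, which absorbs the tangent at m
    prolonged to 0.\<close>
  have key: "H m + c m * m \<le> c m * u + (if u \<ge> \<tau> then H u else Mb)" if m: "m \<ge> \<tau>" and u: "u \<ge> 0" for m u
  proof (cases "u \<ge> \<tau>")
    case True
    then show ?thesis using tang[OF m True] by (simp add: algebra_simps)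
  next
    case False
    have "H m + c m * (m - \<tau>) \<le> H \<tau>" by (rule tang[OF m]) simp
    moreover have "c m * (\<tau> - u) \<le> c \<tau> * \<tau>"
      using c_anti[of \<tau> m] c0[OF m] c0[of \<tau>] m u False by (intro mult_mono) auto
    ultimately show ?thesis using False by (simp add: Mb_def algebra_simps)
  qed
  \<comment> \<open>The order \<theta>/2 carries the main term, of size t^(1/2). Everything away
    from the origin is bounded by a multiple of |y|^(3\<theta>/4), whose mean is of order t^(3/4)
    and therefore negligible for small t; both orders are below \<theta>.\<close>
  have th12: "0 < \<theta> / 2" "\<theta> / 2 < \<theta>" "0 < 3 * \<theta> / 4" "3 * \<theta> / 4 < \<theta>" using th by auto
  obtain C1 where C1: "C1 > 0" "\<And>t (x::real^'n). t > 0 \<Longrightarrow> norm x \<le> t powr (1/\<theta>) \<Longrightarrow>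
     heat \<theta> t (\<lambda>y. ennreal (norm y powr (\<theta> / 2))) x \<le> ennreal (C1 * t powr (\<theta> / 2 / \<theta>))"
    using heat_norm_powr[OF th th12(1,2), where 'n='n] by blast
  obtain C2 where C2: "C2 > 0" "\<And>t (x::real^'n). t > 0 \<Longrightarrow> norm x \<le> t powr (1/\<theta>) \<Longrightarrow>
     heat \<theta> t (\<lambda>y. ennreal (norm y powr (3 * \<theta> / 4))) x \<le> ennreal (C2 * t powr (3 * \<theta> / 4 / \<theta>))"
    using heat_norm_powr[OF th th12(3,4), where 'n='n] by blast
  \<comment> \<open>Makes the main term t^(1/2)/5. With as much allowed for the remainder, F \<le>
    (2/5)^2 t = 4t/25, whereas the blow-up bound needs F \<ge> t/4.\<close>
  define \<gamma> where "\<gamma> = (5 * C1) powr 2"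
  have "\<gamma> powr (-1/2) = 1 / (5 * C1)" unfolding \<gamma>_def powr_powr using C1(1) by (simp add: powr_minus_divide)
  then have \<gamma>: "\<gamma> > 0" "\<gamma> powr (-1/2) * C1 = 1/5" using C1(1) by (auto simp: \<gamma>_def)
  show ?thesis
  proof (rule exI[of _ \<gamma>], intro conjI allI impI \<gamma>(1))
    fix \<mu> :: "real^'n \<Rightarrow> real"
    assume as: "nonneg_loc_integrable \<mu> \<and>
      (\<exists>r>0. AE x in lebesgue. x \<in> ball 0 r \<longrightarrow> Gfun f (\<mu> x) \<ge> \<gamma> * norm x powr (- \<theta>))"
    show "\<not> locally_solvable \<theta> f \<mu>"
    proof
      assume "locally_solvable \<theta> f \<mu>"
      then obtain T u where T: "T > 0" and sol: "is_solution \<theta> f \<mu> T u" by (auto simp: locally_solvable_def)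
      obtain \<mu>' where \<mu>'m[measurable]: "\<mu>' \<in> borel_measurable borel" and \<mu>'0: "\<And>x. \<mu>' x \<ge> 0"
        and \<mu>': "AE x in lborel. \<mu> x = \<mu>' x"
        using nonneg_loc_integrable_borel as by blast
      obtain u' where u': "u' \<in> borel_measurable borel" "\<And>z. u' z \<ge> 0"
        "AE z in lborel. z \<in> QT T \<longrightarrow>
          ennreal (u' z) = heat \<theta> (snd z) (\<lambda>y. ennreal (\<mu>' y)) (fst z) + duhamel \<theta> (\<lambda>w. ennreal (f (u' w))) z"
        using solution_borel_version[OF th sol \<mu>'] by blast
      obtain r where r: "r > 0" "AE x in lborel. x \<in> ball 0 r \<longrightarrow> Gfun f (\<mu> x) \<ge> \<gamma> * norm x powr (- \<theta>)"
        using as by (auto simp: AE_completion_iff)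
      \<comment> \<open>Where \<gamma> |y|^(-\<theta>) exceeds \<open>g0\<close>, the value G(0) is
        excluded, so \<mu> > 0, and F(\<mu>) < F(\<tau>), so \<mu> > \<tau>. The radius
        \<open>r0\<close> is chosen accordingly.\<close>
      define g0 where "g0 = max (1 / F \<tau>) (Gfun f 0)"
      have g0: "g0 > 0" using F_pos[OF \<tau>'(1)] by (simp add: g0_def less_max_iff_disj)
      define r0 where "r0 = min r ((\<gamma> / g0) powr (1/\<theta>))"
      have r0: "r0 > 0" using r \<gamma> g0 by (simp add: r0_def)
      define M2 where "M2 = Mb * r0 powr (- (3 * \<theta> / 4))"
      have M2: "M2 > 0" using Mb r0 by (simp add: M2_def)
      have bound: "AE y in lborel. (if \<mu>' y \<ge> \<tau> then H (\<mu>' y) else Mb) \<le> \<gamma> powr (-1/2) * norm y powr (\<theta> / 2) + M2 * norm y powr (3 * \<theta> / 4)"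
        using \<mu>' r(2) AE_lborel_singleton[of "0::real^'n"]
      proof eventually_elim
        case (elim y)
        define n where "n = norm y"
        have n: "n > 0" using elim(3) by (simp add: n_def)
        show ?case unfolding n_def[symmetric]
        proof (cases "n < r0")
          case True
          have "n powr \<theta> < ((\<gamma> / g0) powr (1/\<theta>)) powr \<theta>" using True n th by (intro powr_less_mono2) (auto simp: r0_def)
          also have "\<dots> = \<gamma> / g0" using \<gamma> g0 th by (simp add: powr_powr)
          finally have "g0 < \<gamma> * n powr (- \<theta>)" using n g0 by (simp add: powr_minus field_simps)
          moreover have G: "\<gamma> * n powr (- \<theta>) \<le> Gfun f (\<mu> y)" using elim(2) True by (simp add: n_def r0_def)
          ultimately have G0: "g0 < Gfun f (\<mu> y)" by simp
          have \<mu>pos: "\<mu> y > 0"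
          proof (rule ccontr)
            assume "\<not> \<mu> y > 0"
            then have "\<mu> y = 0" using \<mu>'0[of y] elim(1) by simp
            then show False using G0 by (simp add: g0_def)
          qed
          have Fp: "F (\<mu> y) > 0" by (rule F_pos[OF \<mu>pos])
          have "1 / F \<tau> < 1 / F (\<mu> y)" using G0 \<mu>pos by (simp add: g0_def Gfun_def)
          then have "F (\<mu> y) < F \<tau>" using Fp F_pos[OF \<tau>'(1)] by (simp add: field_simps)
          then have gt: "\<mu> y > \<tau>" using F_le_iff[OF \<mu>pos \<tau>'(1)] by (simp add: not_le[symmetric])
          have "\<gamma> * n powr (- \<theta>) \<le> 1 / F (\<mu> y)" using G \<mu>pos by (simp add: Gfun_def)
          then have "F (\<mu> y) \<le> n powr \<theta> / \<gamma>" using Fp n \<gamma> by (simp add: powr_minus field_simps)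
          then have "H (\<mu> y) \<le> (n powr \<theta> / \<gamma>) powr (1/2)" unfolding H_def using Fp by (intro powr_mono2) auto
          also have "\<dots> = \<gamma> powr (-1/2) * n powr (\<theta> / 2)"
            using \<gamma> by (simp add: powr_divide powr_powr powr_minus_divide)
          finally have "H (\<mu>' y) \<le> \<gamma> powr (-1/2) * n powr (\<theta> / 2)" using elim(1) by simp
          moreover have "0 \<le> M2 * n powr (3 * \<theta> / 4)" using M2 by simp
          ultimately show "(if \<mu>' y \<ge> \<tau> then H (\<mu>' y) else Mb) \<le> \<gamma> powr (-1/2) * n powr (\<theta> / 2) + M2 * n powr (3 * \<theta> / 4)"
            using gt elim(1) by simp
        next
          case False
          have "(if \<mu>' y \<ge> \<tau> then H (\<mu>' y) else Mb) \<le> Mb"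
            using H_anti[of \<tau> "\<mu>' y"] \<tau>' Mb by auto
          also have "Mb = M2 * r0 powr (3 * \<theta> / 4)" using r0 by (simp add: M2_def powr_minus)
          also have "\<dots> \<le> M2 * n powr (3 * \<theta> / 4)" using False r0 th M2 by (intro mult_left_mono powr_mono2) auto
          finally show "(if \<mu>' y \<ge> \<tau> then H (\<mu>' y) else Mb) \<le> \<gamma> powr (-1/2) * n powr (\<theta> / 2) + M2 * n powr (3 * \<theta> / 4)"
            by (simp add: add_increasing)
        qed
      qed
      \<comment> \<open>The three conditions keep t inside the existence interval, force F(m) <
        F(\<tau>) in the estimate of m, and make the remainder at most t^(1/2)/5.\<close>
      define t0 where "t0 = min T (min (F \<tau>) ((1 / (5 * (M2 * C2))) powr 4))"
      have t0: "t0 > 0" using T F_pos[OF \<tau>'(1)] M2 C2(1) by (simp add: t0_def)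
      have no: False if t: "0 < t" "t < t0" and x: "norm x \<le> t powr (1/\<theta>)"
        and E: "ennreal (u' (x, t)) = heat \<theta> t (\<lambda>y. ennreal (\<mu>' y)) x + duhamel \<theta> (\<lambda>w. ennreal (f (u' w))) (x, t)"
      for t and x :: "real^'n"
      proof -
        have tT: "t < T" "t < F \<tau>" "t < (1 / (5 * (M2 * C2))) powr 4" using t by (auto simp: t0_def)
        have "heat \<theta> t (\<lambda>y. ennreal (\<mu>' y)) x \<le> ennreal (u' (x, t))" unfolding E by simp
        also have "\<dots> < \<infinity>" by simp
        finally obtain w where w: "heat \<theta> t (\<lambda>y. ennreal (\<mu>' y)) x = ennreal w" "w \<ge> 0"
          by (cases "heat \<theta> t (\<lambda>y. ennreal (\<mu>' y)) x") auto
        \<comment> \<open>Tangents are available only from \<tau> on. The estimate is made at m, and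
          its outcome F(m) < F(\<tau>) then shows that the maximum is \<open>w\<close>.\<close>
        define m where "m = max w \<tau>"
        have m: "m \<ge> \<tau>" "m \<ge> w" by (auto simp: m_def)
        let ?b1 = "\<lambda>y::real^'n. ennreal (\<gamma> powr (-1/2)) * ennreal (norm y powr (\<theta> / 2))"
        let ?b2 = "\<lambda>y::real^'n. ennreal M2 * ennreal (norm y powr (3 * \<theta> / 4))"
        have "ennreal (H m + c m * m) = heat \<theta> t (\<lambda>_. ennreal (H m + c m * m)) x"
          by (rule heat_const[OF t(1) th, symmetric])
        also have "\<dots> \<le> heat \<theta> t (\<lambda>y. ennreal (c m) * ennreal (\<mu>' y) + (?b1 y + ?b2 y)) x"
        proof (rule heat_mono_AE, use bound in eventually_elim)
          case (elim y)
          have "H m + c m * m \<le> c m * \<mu>' y + (\<gamma> powr (-1/2) * norm y powr (\<theta> / 2) + M2 * norm y powr (3 * \<theta> / 4))"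
            using key[OF m(1) \<mu>'0[of y]] elim by linarith
          then have "ennreal (H m + c m * m) \<le> ennreal (c m * \<mu>' y + (\<gamma> powr (-1/2) * norm y powr (\<theta> / 2) + M2 * norm y powr (3 * \<theta> / 4)))"
            by (rule ennreal_leI)
          also have "\<dots> = ennreal (c m) * ennreal (\<mu>' y) + (?b1 y + ?b2 y)"
            using c0[OF m(1)] \<mu>'0[of y] M2 by (simp add: ennreal_mult)
          finally show ?case .
        qed
        also have "\<dots> = heat \<theta> t (\<lambda>y. ennreal (c m) * ennreal (\<mu>' y)) x + heat \<theta> t (\<lambda>y. ?b1 y + ?b2 y) x"
          by (rule heat_add) measurable
        also have "heat \<theta> t (\<lambda>y. ?b1 y + ?b2 y) x = heat \<theta> t ?b1 x + heat \<theta> t ?b2 x"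
          by (rule heat_add) measurable
        also have "heat \<theta> t (\<lambda>y. ennreal (c m) * ennreal (\<mu>' y)) x = ennreal (c m) * ennreal w"
          unfolding w(1)[symmetric] by (rule heat_cmult) measurable
        also have "heat \<theta> t ?b1 x = ennreal (\<gamma> powr (-1/2)) * heat \<theta> t (\<lambda>y. ennreal (norm y powr (\<theta> / 2))) x"
          by (rule heat_cmult) measurable
        also have "heat \<theta> t ?b2 x = ennreal M2 * heat \<theta> t (\<lambda>y. ennreal (norm y powr (3 * \<theta> / 4))) x"
          by (rule heat_cmult) measurable
        also have "ennreal (c m) * ennreal w + (ennreal (\<gamma> powr (-1/2)) * heat \<theta> t (\<lambda>y. ennreal (norm y powr (\<theta> / 2))) x
             + ennreal M2 * heat \<theta> t (\<lambda>y. ennreal (norm y powr (3 * \<theta> / 4))) x)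
          \<le> ennreal (c m) * ennreal w + (ennreal (\<gamma> powr (-1/2)) * ennreal (C1 * t powr (\<theta> / 2 / \<theta>))
             + ennreal M2 * ennreal (C2 * t powr (3 * \<theta> / 4 / \<theta>)))"
          by (intro add_left_mono add_mono mult_left_mono C1(2) C2(2) t x) auto
        also have "\<dots> = ennreal (c m * w + (\<gamma> powr (-1/2) * (C1 * t powr (\<theta> / 2 / \<theta>)) + M2 * (C2 * t powr (3 * \<theta> / 4 / \<theta>))))"
          using c0[OF m(1)] w(2) C1(1) C2(1) M2 by (simp add: ennreal_mult)
        finally have "H m + c m * m \<le> c m * w + (\<gamma> powr (-1/2) * (C1 * t powr (\<theta> / 2 / \<theta>)) + M2 * (C2 * t powr (3 * \<theta> / 4 / \<theta>)))"
          using c0[OF m(1)] w(2) C1(1) C2(1) M2 by (subst (asm) ennreal_le_iff) auto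
        moreover have "c m * w \<le> c m * m" using c0[OF m(1)] m(2) by (intro mult_left_mono) auto
        ultimately have "H m \<le> \<gamma> powr (-1/2) * (C1 * t powr (\<theta> / 2 / \<theta>)) + M2 * (C2 * t powr (3 * \<theta> / 4 / \<theta>))"
          by linarith
        also have "\<gamma> powr (-1/2) * (C1 * t powr (\<theta> / 2 / \<theta>)) = 1/5 * t powr (1/2)"
          using \<gamma>(2) th by (simp add: mult.assoc[symmetric])
        also have "M2 * (C2 * t powr (3 * \<theta> / 4 / \<theta>)) \<le> 1/5 * t powr (1/2)"
        proof -
          have "t powr (1/4) \<le> ((1 / (5 * (M2 * C2))) powr 4) powr (1/4)" using t tT by (intro powr_mono2) auto
          also have "\<dots> = 1 / (5 * (M2 * C2))" unfolding powr_powr using M2 C2(1) by simp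
          finally have le: "M2 * C2 * t powr (1/4) \<le> 1/5" using M2 C2(1) by (simp add: field_simps)
          have "t powr (3 * \<theta> / 4 / \<theta>) = t powr (1/4) * t powr (1/2)" using th by (simp add: powr_add[symmetric])
          then have "M2 * (C2 * t powr (3 * \<theta> / 4 / \<theta>)) = (M2 * C2 * t powr (1/4)) * t powr (1/2)" by (simp only: mult.assoc)
          also have "\<dots> \<le> 1/5 * t powr (1/2)" by (rule mult_right_mono[OF le]) simp
          finally show ?thesis .
        qed
        finally have Hm: "H m \<le> 2/5 * t powr (1/2)" by simp
        have Fm: "F m > 0" using m \<tau>' by (intro F_pos) simp
        have "F m = H m * H m" using Fm by (simp add: H_def powr_add[symmetric])
        also have "\<dots> \<le> (2/5 * t powr (1/2)) * (2/5 * t powr (1/2))" using Hm H0 by (intro mult_mono) auto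
        also have "\<dots> = 4/25 * (t powr (1/2) * t powr (1/2))" by simp
        also have "t powr (1/2) * t powr (1/2) = t" using t by (simp add: powr_add[symmetric])
        finally have Fm_le: "F m \<le> 4/25 * t" .
        then have "F m < F \<tau>" using tT(2) t by simp
        then have "m > \<tau>" using F_le_iff[of m \<tau>] m \<tau>' by (simp add: not_le[symmetric])
        then have mw: "m = w" by (simp add: m_def max_def split: if_splits)
        have "t \<le> 4 * F w"
        proof (rule blow_up_time_bound[OF th fnn \<sigma> minorant \<mu>'m u' t(1) tT(1) E w(1)])
          show "\<sigma> \<le> w" using m \<tau>' mw by simp
          have "f \<tau> \<le> f w" using m \<tau>' mw by (intro f_mono) auto
          then show "2 * f \<sigma> \<le> f w" using \<tau>(2) by simp
        qed
        then show False using Fm_le t mw by simp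
      qed
      \<comment> \<open>An open cylinder inside the region |x| \<le> t^(1/\<theta>), t < t0; its
        radius is the one belonging to the earliest time t0/2.\<close>
      define S where "S = ball (0::real^'n) ((t0/2) powr (1/\<theta>)) \<times> {t0/2<..<t0}"
      have "open S" unfolding S_def by (intro open_Times) auto
      moreover have "(0, 3/4 * t0) \<in> S" using t0 by (simp add: S_def)
      then have "S \<noteq> {}" by blast
      moreover have "AE z in lborel. z \<notin> S"
        using u'(3)
      proof (rule eventually_mono)
        fix z
        assume E: "z \<in> QT T \<longrightarrow> ennreal (u' z) = heat \<theta> (snd z) (\<lambda>y. ennreal (\<mu>' y)) (fst z) + duhamel \<theta> (\<lambda>w. ennreal (f (u' w))) z"
        show "z \<notin> S"
        proof
          assume "z \<in> S"
          then obtain x t where z: "z = (x, t)" and xt: "norm x < (t0/2) powr (1/\<theta>)" "t0/2 < t" "t < t0"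
            by (auto simp: S_def)
          have t: "0 < t" "t < T" using xt t0 by (auto simp: t0_def)
          have "(t0/2) powr (1/\<theta>) \<le> t powr (1/\<theta>)" using xt t0 th by (intro powr_mono2) auto
          then have "norm x \<le> t powr (1/\<theta>)" using xt(1) by simp
          then show False using no[OF t(1) xt(3)] E t by (simp add: z QT_def)
        qed
      qed
      ultimately show False using not_AE_notin_open by blast
    qed
  qed
qed

end

theorem theorem1p1:
  fixes \<theta> :: real and f :: "real \<Rightarrow> real"
  assumes theta: "0 < \<theta>" "\<theta> \<le> 2"
    and f_nonneg: "\<forall>u\<ge>0. f u \<ge> 0"
    and M: "hyp_M f" and S: "hyp_S f" and L: "hyp_L f"
  shows
    "(hyp_C f \<longrightarrow>
        (\<exists>\<gamma>>0. \<forall>\<mu> :: real^'n \<Rightarrow> real.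
           nonneg_loc_integrable \<mu> \<and>
           (\<exists>r>0. AE x in lebesgue. x \<in> ball 0 r \<longrightarrow>
                    Gfun f (\<mu> x) \<ge> \<gamma> * norm x powr (- \<theta>))
           \<longrightarrow> \<not> locally_solvable \<theta> f \<mu>))
     \<and>
     (supercritical \<theta> f CARD('n) \<longrightarrow>
        (\<exists>\<epsilon>>0. \<forall>\<mu> :: real^'n \<Rightarrow> real.
           nonneg_loc_integrable \<mu> \<and> in_B \<mu> \<and>
           (\<exists>r>0. AE x in lebesgue. x \<in> ball 0 r \<longrightarrow>
                    Gfun f (\<mu> x) \<le> \<epsilon> * norm x powr (- \<theta>))
           \<longrightarrow> locally_solvable \<theta> f \<mu> \<and>
               (\<exists>T>0. \<exists>u. is_solution \<theta> f \<mu> T u \<and> Linf_loc_time T u)))"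
proof -
  interpret admissible f by standard (fact M S L)+
  have nonneg: "f a \<ge> 0" if "a \<ge> 0" for a using f_nonneg that by simp
  show ?thesis
  proof (intro conjI impI)
    assume "hyp_C f"
    from not_locally_solvable_if_large[OF theta nonneg this]
    show "\<exists>\<gamma>>0. \<forall>\<mu> :: real^'n \<Rightarrow> real.
           nonneg_loc_integrable \<mu> \<and>
           (\<exists>r>0. AE x in lebesgue. x \<in> ball 0 r \<longrightarrow>
                    Gfun f (\<mu> x) \<ge> \<gamma> * norm x powr (- \<theta>))
           \<longrightarrow> \<not> locally_solvable \<theta> f \<mu>" .
  next
    assume "supercritical \<theta> f CARD('n)"
    from locally_solvable_if_small[OF theta this]
    show "\<exists>\<epsilon>>0. \<forall>\<mu> :: real^'n \<Rightarrow> real.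
           nonneg_loc_integrable \<mu> \<and> in_B \<mu> \<and>
           (\<exists>r>0. AE x in lebesgue. x \<in> ball 0 r \<longrightarrow>
                    Gfun f (\<mu> x) \<le> \<epsilon> * norm x powr (- \<theta>))
           \<longrightarrow> locally_solvable \<theta> f \<mu> \<and>
               (\<exists>T>0. \<exists>u. is_solution \<theta> f \<mu> T u \<and> Linf_loc_time T u)"
      unfolding locally_solvable_def by blast
  qed
qed

end
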